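(* Let $d\ge 2$, $D\ge 1$ and $n=2t+l$ with $t,l\ge 1$ integers, and assume $D\ge n^5$. Fix any diagonal $\Omega=\mathrm{diag}(\omega_1,\dots,\omega_D)$ with $(\omega_i)$ a probability vector. Let $U$ be Haar-distributed on $U(dD)$, $V,W$ Haar-distributed on $U(D)$, and $\Lambda=\mathrm{diag}(\lambda_1,\dots,\lambda_D)$ with $(\lambda_i)$ distributed according to Lebesgue measure on $[0,1]^D$, all independent. With $L=V\Lambda V^\dagger$, $R=W\Omega W^\dagger$ and $$\rho_l=\mathrm{tr}_{A,B_1,\dots,B_t,B_{t+l+1},\dots,B_n}\Big(L\, U_{A,B_1}\cdots U_{A,B_n}\big(R\otimes(|0\rangle\langle 0|)^{\otimes n}\big)U_{A,B_n}^\dagger\cdots U_{A,B_1}^\dagger\Big),$$ we have $\mathbb{E}(\mathrm{tr}\,\rho_l^2)\le\frac{1}{4d^l}+O(D^{-1/5})$.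
   Context: $H_A\cong\mathbb{C}^D$ and $H_{B_1},\dots,H_{B_n}\cong\mathbb{C}^d$; $U_{A,B_i}$ denotes $U$ acting on $H_A\otimes H_{B_i}$ and as the identity elsewhere; $L$ acts on $H_A$; $|0\rangle$ is a fixed unit vector in $\mathbb{C}^d$. *)

theory Defs
  imports "HOL-Probability.Probability"
begin

text \<open>Square matrices of size N are represented as functions nat => nat => complex,
  with entries outside {..<N} x {..<N} being irrelevant (set to 0 for unitaries).\<close>

type_synonym cmat = "nat \<Rightarrow> nat \<Rightarrow> complex"

definition mmul :: "nat \<Rightarrow> cmat \<Rightarrow> cmat \<Rightarrow> cmat" where
  "mmul N A B = (\<lambda>i j. if i < N \<and> j < N then (\<Sum>k<N. A i k * B k j) else 0)"

definition madj :: "cmat \<Rightarrow> cmat" where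
  "madj A = (\<lambda>i j. cnj (A j i))"

definition mdiag :: "nat \<Rightarrow> (nat \<Rightarrow> complex) \<Rightarrow> cmat" where
  "mdiag N v = (\<lambda>i j. if i < N \<and> i = j then v i else 0)"

definition unitary_mat :: "nat \<Rightarrow> cmat \<Rightarrow> bool" where
  "unitary_mat N U \<longleftrightarrow>
     (\<forall>i j. (N \<le> i \<or> N \<le> j) \<longrightarrow> U i j = 0) \<and>
     (\<forall>i<N. \<forall>j<N. (\<Sum>k<N. U i k * cnj (U j k)) = (if i = j then 1 else 0))"

text \<open>Haar measure on U(N): a (left-)invariant Borel probability measure concentrated
  on the unitary N x N matrices (unique by uniqueness of Haar measure).\<close>
definition is_haar :: "nat \<Rightarrow> cmat measure \<Rightarrow> bool" where
  "is_haar N \<mu> \<longleftrightarrow> prob_space \<mu> \<and> sets \<mu> = sets borel \<and>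
     emeasure \<mu> {U. unitary_mat N U} = 1 \<and>
     (\<forall>V. unitary_mat N V \<longrightarrow> distr \<mu> borel (mmul N V) = \<mu>)"

definition unif_cube :: "nat \<Rightarrow> (nat \<Rightarrow> real) measure" where
  "unif_cube D = PiM {..<D} (\<lambda>_. restrict_space lborel {0..1::real})"

text \<open>Operators on H_A (x) H_{B_1} (x) ... (x) H_{B_n}, basis indexed by (a, bs) with
  a < D and bs a list of length n with entries < d (bs ! (k-1) is the index of B_k).\<close>
type_synonym idx = "nat \<times> nat list"
type_synonym op = "idx \<Rightarrow> idx \<Rightarrow> complex"

definition idxs :: "nat \<Rightarrow> nat \<Rightarrow> nat \<Rightarrow> idx set" where
  "idxs D d n = {(a, bs). a < D \<and> length bs = n \<and> set bs \<subseteq> {..<d}}"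

definition words :: "nat \<Rightarrow> nat \<Rightarrow> nat list set" where
  "words d l = {c. length c = l \<and> set c \<subseteq> {..<d}}"

definition opmul :: "idx set \<Rightarrow> op \<Rightarrow> op \<Rightarrow> op" where
  "opmul I X Y = (\<lambda>x z. \<Sum>y\<in>I. X x y * Y y z)"

definition opadj :: "op \<Rightarrow> op" where
  "opadj X = (\<lambda>x y. cnj (X y x))"

definition idop :: "op" where
  "idop = (\<lambda>x y. if x = y then 1 else 0)"

text \<open>U_{A,B_{k+1}}: U acting on H_A (x) H_{B_{k+1}} (with the identification
  |a> (x) |b> = e_{a*d+b} of C^D (x) C^d with C^{dD}) and as identity elsewhere.\<close>
definition U_on :: "nat \<Rightarrow> cmat \<Rightarrow> nat \<Rightarrow> op" where
  "U_on d U k = (\<lambda>(a, bs) (a', bs').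
     if length bs = length bs' \<and> (\<forall>j<length bs. j \<noteq> k \<longrightarrow> bs ! j = bs' ! j)
     then U (a * d + bs ! k) (a' * d + bs' ! k) else 0)"

definition circuit :: "nat \<Rightarrow> nat \<Rightarrow> nat \<Rightarrow> cmat \<Rightarrow> op" where
  "circuit D d n U = foldr (\<lambda>k M. opmul (idxs D d n) (U_on d U k) M) [0..<n] idop"

definition on_A :: "cmat \<Rightarrow> op" where
  "on_A X = (\<lambda>(a, bs) (a', bs'). if bs = bs' then X a a' else 0)"

definition init_state :: "nat \<Rightarrow> cmat \<Rightarrow> op" where
  "init_state n R = (\<lambda>(a, bs) (a', bs').
     if bs = replicate n 0 \<and> bs' = replicate n 0 then R a a' else 0)"

definition ptrace_mid :: "nat \<Rightarrow> nat \<Rightarrow> nat \<Rightarrow> nat \<Rightarrow> nat \<Rightarrow> op \<Rightarrow> nat list \<Rightarrow> nat list \<Rightarrow> complex" where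
  "ptrace_mid D d n t l M = (\<lambda>c c'.
     \<Sum>(a, bs)\<in>{(a, bs)\<in>idxs D d n. take l (drop t bs) = c}.
        M (a, bs) (a, take t bs @ c' @ drop (t + l) bs))"

definition rho_l :: "nat \<Rightarrow> nat \<Rightarrow> nat \<Rightarrow> nat \<Rightarrow> cmat \<Rightarrow> cmat \<Rightarrow> cmat \<Rightarrow> nat list \<Rightarrow> nat list \<Rightarrow> complex" where
  "rho_l D d t l L U R =
     (let n = 2 * t + l; I = idxs D d n; X = circuit D d n U in
      ptrace_mid D d n t l
        (opmul I (on_A L) (opmul I X (opmul I (init_state n R) (opadj X)))))"

definition tr_sq :: "nat \<Rightarrow> nat \<Rightarrow> (nat list \<Rightarrow> nat list \<Rightarrow> complex) \<Rightarrow> complex" where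
  "tr_sq d l \<rho> = (\<Sum>c\<in>words d l. \<Sum>c'\<in>words d l. \<rho> c c' * \<rho> c' c)"

end

theory Submission
  imports Defs "HOL-Combinatorics.Multiset_Permutations"
begin

text \<open>The average over the spectrum of \<open>L\<close> satisfies \<open>E (\<lambda>\<^sub>e \<lambda>\<^sub>f) = 1/4 + \<delta>\<^sub>e\<^sub>f/12\<close>. It therefore splits
  \<open>E (tr \<rho>\<^sup>2)\<close> into a quarter of the expected purity for \<open>L = 1\<close> and a fluctuation term, which is
  \<open>O(1/D)\<close> by a fourth moment bound for the columns of \<open>V\<close>.

  No Weingarten calculus is needed. Left invariance alone shows that a polynomial of degree \<open>N\<close> in the
  entries of a Haar unitary of size \<open>M\<close> has a second moment at most \<open>(M - N)\<^sup>-\<^sup>N\<close> times a weighted sum of the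
  squares of its coefficients, as for a Gaussian matrix. This is only an upper bound, but the purity of a state
  of trace one is \<open>\<parallel>(1 + F) \<Psi> \<otimes> \<Psi>\<parallel>\<^sup>2/2 - 1\<close>, with \<open>F\<close> the swap of the middle segments, and
  the subtracted \<open>1\<close> is exact, so that an upper bound for the square suffices.

  The coefficients of \<open>(1 + F) \<Psi> \<otimes> \<Psi>\<close> count pairs of paths of \<open>A\<close>-indices with a given multiset of
  transitions. If no vertex is repeated, then the multiset and the final vertices determine the paths, which gives
  \<open>1 + d\<^sup>-\<^sup>l\<close>. With repetitions their number is at most the product of the factorials of the vertex
  multiplicities, and these contributions add up to \<open>O(n\<^sup>3/D)\<close>.\<close>

subsection \<open>Unitary matrices\<close>

text \<open>The obstacle is that \<open>tr_sq\<close> mixes entries of \<open>U\<close> with their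
  conjugates, whereas averaging over phases controls only the squared modulus of a polynomial in the
  entries themselves. The square of the symmetrized tensor is a sum of such squared moduli, whereas
  the swap term alone is not. The base \<open>M - N\<close> arises because each row is replaced by a
  mean over at least \<open>M - N\<close> rows. With \<open>M = d * D\<close> and
  \<open>N = 2 * n\<close>, path pairs and output words together number \<open>(d * D) ^ N\<close>,
  and the ratio of the two powers is \<open>1 + O(n^2 / D)\<close>. The dominant error is due to
  repeated vertices. A vertex seen c times before enters with weight (c + 1)^2; over all vertices
  these weights add up to at most \<open>D + N ^ 2\<close>, and \<open>N\<close> steps give the
  relative error \<open>N ^ 3 / D\<close>. The assumption \<open>n ^ 5 \<le> D\<close> turns it into
  a multiple of \<open>D powr (- 1 / 5)\<close>. From the purity term \<open>V\<close> disappears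
  because its columns form a full basis of the traced space, and \<open>W\<close> because it can be
  moved into \<open>U\<close> by multiplication on both sides. In the fluctuation term the average
  over \<open>V\<close> is what makes a single eigenvector of \<open>L\<close> contribute only
  \<open>O(1 / D^2)\<close>.\<close>

lemma sum_rotate: "(\<Sum>k\<in>A. \<Sum>i\<in>B. \<Sum>j\<in>C. f k i j) = (\<Sum>i\<in>B. \<Sum>j\<in>C. \<Sum>k\<in>A. f k i j)"
proof -
  have "(\<Sum>k\<in>A. \<Sum>i\<in>B. \<Sum>j\<in>C. f k i j) = (\<Sum>i\<in>B. \<Sum>k\<in>A. \<Sum>j\<in>C. f k i j)"
    by (rule sum.swap)
  also have "\<dots> = (\<Sum>i\<in>B. \<Sum>j\<in>C. \<Sum>k\<in>A. f k i j)"
    by (rule sum.cong[OF refl], rule sum.swap)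
  finally show ?thesis .
qed

lemma of_real_cmod_square: "(complex_of_real (cmod z))\<^sup>2 = z * cnj z"
  using complex_norm_square[of z] by simp

lemma unitary_matD:
  assumes "unitary_mat N U" "i < N" "j < N"
  shows "(\<Sum>k<N. U i k * cnj (U j k)) = (if i = j then 1 else 0)"
  using assms unfolding unitary_mat_def by blast

text \<open>\<open>unitary_mat\<close> provides orthonormal rows only. The matrix s = U* U has the
  same diagonal as s s* and has trace \<open>N\<close>, so the squared Hilbert-Schmidt norm of 1 - s
  is N - N = 0; hence the columns are orthonormal too.\<close>

lemma unitary_mat_cols:
  assumes U: "unitary_mat N U" and i: "i < N" and j: "j < N"
  shows "(\<Sum>k<N. U k i * cnj (U k j)) = (if i = j then 1 else 0)"
proof -
  define s where "s = (\<lambda>j k. \<Sum>i<N. cnj (U i j) * U i k)"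
  define r where "r = (\<lambda>j k. (if k = j then 1 else 0) - s j k)"
  have ss: "(\<Sum>k<N. s j k * cnj (s j k)) = s j j" for j
  proof -
    have "(\<Sum>k<N. s j k * cnj (s j k)) =
        (\<Sum>k<N. \<Sum>i<N. \<Sum>i'<N. cnj (U i j) * U i' j * (U i k * cnj (U i' k)))"
      unfolding s_def cnj_sum sum_product
      by (intro sum.cong refl) (simp add: algebra_simps)
    also have "\<dots> = (\<Sum>i<N. \<Sum>i'<N. cnj (U i j) * U i' j * (\<Sum>k<N. U i k * cnj (U i' k)))"
      unfolding sum_distrib_left
      by (rule sum_rotate)
    also have "\<dots> = (\<Sum>i<N. \<Sum>i'<N. cnj (U i j) * U i' j * (if i = i' then 1 else 0))"
      using unitary_matD[OF U] by (intro sum.cong refl) auto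
    also have "\<dots> = s j j"
      unfolding s_def by (intro sum.cong refl) (simp add: if_distrib cong: if_cong)
    finally show ?thesis .
  qed
  have cs: "cnj (s j j) = s j j" for j
    unfolding s_def by (simp add: mult.commute)
  have rr: "(\<Sum>k<N. r j k * cnj (r j k)) = 1 - s j j" if "j < N" for j
  proof -
    have "r j k * cnj (r j k) = (if k = j then 1 - s j k - cnj (s j k) else 0) + s j k * cnj (s j k)" for k
      unfolding r_def by (simp add: algebra_simps)
    then have "(\<Sum>k<N. r j k * cnj (r j k)) = (\<Sum>k<N. if k = j then 1 - s j k - cnj (s j k) else 0) + s j j"
      by (simp add: sum.distrib ss)
    also have "\<dots> = 1 - s j j" using that by (simp add: cs)
    finally show ?thesis .
  qed
  have re: "complex_of_real (\<Sum>k<N. (cmod (r j k))\<^sup>2) = 1 - s j j" if "j < N" for j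
    using rr[OF that] by (simp add: of_real_cmod_square)
  have "(\<Sum>j<N. s j j) = (\<Sum>j<N. \<Sum>i<N. U i j * cnj (U i j))"
    unfolding s_def by (simp add: mult.commute)
  also have "\<dots> = (\<Sum>i<N. \<Sum>j<N. U i j * cnj (U i j))" by (rule sum.swap)
  also have "\<dots> = (\<Sum>i<N. 1)"
    using unitary_matD[OF U] by (intro sum.cong refl) auto
  finally have "(\<Sum>j<N. 1 - s j j) = 0" by (simp add: sum_subtractf)
  moreover have "complex_of_real (\<Sum>j<N. \<Sum>k<N. (cmod (r j k))\<^sup>2) = (\<Sum>j<N. 1 - s j j)"
    unfolding of_real_sum[of _ "{..<N}"] using re by (intro sum.cong) auto
  ultimately have "complex_of_real (\<Sum>j<N. \<Sum>k<N. (cmod (r j k))\<^sup>2) = 0" by simp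
  then have "(\<Sum>j<N. \<Sum>k<N. (cmod (r j k))\<^sup>2) = 0" using of_real_eq_0_iff by blast
  then have "(\<Sum>k<N. (cmod (r j k))\<^sup>2) = 0"
    using j by (subst (asm) sum_nonneg_eq_0_iff) (auto intro: sum_nonneg)
  then have "r j i = 0"
    using i by (subst (asm) sum_nonneg_eq_0_iff) auto
  then have "s j i = (if i = j then 1 else 0)" unfolding r_def by auto
  then show ?thesis unfolding s_def by (simp add: mult.commute)
qed

lemma unitary_mat_entry_le:
  assumes U: "unitary_mat N U"
  shows "cmod (U i j) \<le> 1"
proof (cases "i < N \<and> j < N")
  case True
  have "complex_of_real (\<Sum>k<N. (cmod (U i k))\<^sup>2) = 1"
    using unitary_matD[OF U, of i i] True by (simp add: of_real_cmod_square)
  then have "(\<Sum>k<N. (cmod (U i k))\<^sup>2) = 1" using of_real_eq_1_iff by blast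
  moreover have "(cmod (U i j))\<^sup>2 \<le> (\<Sum>k<N. (cmod (U i k))\<^sup>2)"
    by (rule member_le_sum) (use True in auto)
  ultimately show ?thesis by (simp add: power_le_one_iff abs_square_le_1)
next
  case False
  then show ?thesis using U by (auto simp: unitary_mat_def)
qed

lemma unitary_mat_mmul:
  assumes A: "unitary_mat N A" and B: "unitary_mat N B"
  shows "unitary_mat N (mmul N A B)"
proof -
  have "(\<Sum>k<N. mmul N A B i k * cnj (mmul N A B j k)) = (if i = j then 1 else 0)"
    if ij: "i < N" "j < N" for i j
  proof -
    have "(\<Sum>k<N. mmul N A B i k * cnj (mmul N A B j k)) =
      (\<Sum>k<N. \<Sum>x<N. \<Sum>y<N. A i x * cnj (A j y) * (B x k * cnj (B y k)))"
      using ij unfolding mmul_def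
      by (intro sum.cong refl) (simp add: sum_product algebra_simps)
    also have "\<dots> = (\<Sum>x<N. \<Sum>y<N. A i x * cnj (A j y) * (\<Sum>k<N. B x k * cnj (B y k)))"
      unfolding sum_distrib_left
      by (rule sum_rotate)
    also have "\<dots> = (\<Sum>x<N. \<Sum>y<N. A i x * cnj (A j y) * (if x = y then 1 else 0))"
      using unitary_matD[OF B] by (intro sum.cong refl) auto
    also have "\<dots> = (\<Sum>x<N. A i x * cnj (A j x))"
      by (intro sum.cong refl) (simp add: if_distrib cong: if_cong)
    also have "\<dots> = (if i = j then 1 else 0)" using unitary_matD[OF A ij] .
    finally show ?thesis .
  qed
  then show ?thesis unfolding unitary_mat_def by (auto simp: mmul_def)
qed

lemma mmul_assoc: "mmul N (mmul N A B) C = mmul N A (mmul N B C)"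
proof (intro ext)
  fix i j
  show "mmul N (mmul N A B) C i j = mmul N A (mmul N B C) i j"
  proof (cases "i < N \<and> j < N")
    case True
    have "(\<Sum>k<N. (\<Sum>x<N. A i x * B x k) * C k j) = (\<Sum>x<N. A i x * (\<Sum>k<N. B x k * C k j))"
      unfolding sum_distrib_left sum_distrib_right
      by (subst sum.swap) (simp add: mult.assoc)
    then show ?thesis using True by (simp add: mmul_def)
  qed (auto simp: mmul_def)
qed

lemma unitary_mdiag:
  assumes "\<And>i. i < N \<Longrightarrow> cmod (z i) = 1"
  shows "unitary_mat N (mdiag N z)"
proof -
  have z: "z i * cnj (z i) = 1" if "i < N" for i
    using assms[OF that] complex_norm_square[of "z i"] by simp
  have "(\<Sum>k<N. mdiag N z i k * cnj (mdiag N z j k)) = (if i = j then 1 else 0)"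
    if ij: "i < N" "j < N" for i j
  proof -
    have "(\<Sum>k<N. mdiag N z i k * cnj (mdiag N z j k)) =
        (\<Sum>k<N. if k = i then z i * cnj (mdiag N z j i) else 0)"
      by (intro sum.cong refl) (auto simp: mdiag_def)
    also have "\<dots> = (if i = j then 1 else 0)"
      using ij z by (auto simp: mdiag_def)
    finally show ?thesis .
  qed
  then show ?thesis unfolding unitary_mat_def by (auto simp: mdiag_def)
qed

lemma mmul_mdiag:
  "mmul N (mdiag N z) U i j = (if i < N \<and> j < N then z i * U i j else 0)"
proof -
  have "(\<Sum>k<N. mdiag N z i k * U k j) = (\<Sum>k<N. if k = i then z i * U i j else 0)" if "i < N"
    using that by (intro sum.cong refl) (auto simp: mdiag_def)
  then show ?thesis unfolding mmul_def by auto
qed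

text \<open>A Householder reflection followed by a diagonal matrix of phases.\<close>
lemma exists_unitary_row:
  assumes T: "T \<subseteq> {..<N}" and r: "r \<in> T" and z: "\<And>k. k \<in> T \<Longrightarrow> cmod (z k) = 1"
  shows "\<exists>Q. unitary_mat N Q \<and>
     (\<forall>k<N. Q r k = (if k \<in> T then z k / sqrt (card T) else 0)) \<and>
     (\<forall>s<N. s \<notin> T \<longrightarrow> (\<forall>k<N. Q s k = (if s = k then 1 else 0)))"
proof -
  have fT: "finite T" using T finite_subset by blast
  define m where "m = sqrt (card T)"
  have m1: "m \<ge> 1" unfolding m_def using fT r by (simp add: Suc_le_eq card_gt_0_iff) blast
  have m2: "m * m = card T" unfolding m_def by simp
  \<comment> \<open>\<open>v\<close> is e_r - u with u the normalized indicator vector of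
    \<open>T\<close>, and its squared norm is \<open>2 * c\<close>, so \<open>H\<close> is the
    reflection that exchanges e_r and u. If \<open>T = {r}\<close>, then \<open>c = 0\<close> and
    \<open>v\<close> vanishes; division by zero then makes \<open>H\<close> the identity, as
    desired.\<close>
  define c where "c = 1 - 1 / m"
  define v where "v = (\<lambda>k. (if k = r then 1 else 0) - (if k \<in> T then 1 / m else 0))"
  define H where "H = (\<lambda>i k. (if i = k then 1 else 0) - v i * v k / c)"
  have vr: "v r = c" unfolding v_def c_def using r by simp
  have vs: "v s = 0" if "s \<notin> T" for s using that r unfolding v_def by auto
  have rN: "r < N" using r T by auto
  have vv: "(\<Sum>k<N. v k * v k) = 2 * c"
  proof -
    have "v k * v k = (if k = r then 1 - 2 / m else 0) + (if k \<in> T then 1 / (m * m) else 0)" for k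
      unfolding v_def using r by (auto simp: field_simps)
    then have "(\<Sum>k<N. v k * v k) = (1 - 2 / m) + (\<Sum>k<N. if k \<in> T then 1 / (m * m) else 0)"
      using rN by (simp add: sum.distrib)
    also have "(\<Sum>k<N. if k \<in> T then 1 / (m * m) else 0) = (\<Sum>k\<in>{..<N} \<inter> T. 1 / (m * m))"
      by (subst sum.inter_restrict) auto
    also have "{..<N} \<inter> T = T" using T by auto
    also have "(\<Sum>k\<in>T. 1 / (m * m)) = 1"
      unfolding m2 using fT r by (simp add: card_gt_0_iff) blast
    finally show ?thesis unfolding c_def by (simp add: field_simps)
  qed
  have c0: "v k = 0" if "c = 0" "k < N" for k
  proof -
    have "(\<Sum>k<N. v k * v k) = 0" using vv that by simp
    then show ?thesis using that by (subst (asm) sum_nonneg_eq_0_iff) auto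
  qed
  have HH: "(\<Sum>k<N. H i k * H j k) = (if i = j then 1 else 0)" if "i < N" "j < N" for i j
  proof (cases "c = 0")
    case True
    have "(\<Sum>k<N. H i k * H j k) = (\<Sum>k<N. if k = i then (if i = j then 1 else 0) else 0)"
      using True by (intro sum.cong refl) (auto simp: H_def)
    then show ?thesis using that by simp
  next
    case False
    have e: "H i k * H j k = (if i = k then (if j = k then 1 else 0) else 0)
        - (if i = k then v j * v k / c else 0) - (if j = k then v i * v k / c else 0)
        + v i * v j / (c * c) * (v k * v k)" for k
      unfolding H_def using False by (auto simp: field_simps)
    have "(\<Sum>k<N. H i k * H j k) = (if j = i then 1 else 0) - v j * v i / c - v i * v j / c
        + v i * v j / (c * c) * (2 * c)"
      unfolding e sum.distrib sum_subtractf sum_distrib_left[symmetric] vv using that by simp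
    also have "\<dots> = (if i = j then 1 else 0)" using False by (auto simp: field_simps)
    finally show ?thesis .
  qed
  define w where "w = (\<lambda>k. if k \<in> T then z k else 1)"
  define Q where "Q = (\<lambda>i k. if i < N \<and> k < N then complex_of_real (H i k) * w k else 0)"
  have w: "w k * cnj (w k) = 1" for k
    unfolding w_def using z[of k] complex_norm_square[of "z k"] by auto
  have "(\<Sum>k<N. Q i k * cnj (Q j k)) = (if i = j then 1 else 0)" if "i < N" "j < N" for i j
  proof -
    have "(\<Sum>k<N. Q i k * cnj (Q j k)) = (\<Sum>k<N. complex_of_real (H i k * H j k) * (w k * cnj (w k)))"
      using that unfolding Q_def by (intro sum.cong refl) (simp add: algebra_simps)
    also have "\<dots> = complex_of_real (\<Sum>k<N. H i k * H j k)" by (simp add: w)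
    also have "\<dots> = (if i = j then 1 else 0)" using HH[OF that] by simp
    finally show ?thesis .
  qed
  then have "unitary_mat N Q" unfolding unitary_mat_def by (auto simp: Q_def)
  moreover have "Q r k = (if k \<in> T then z k / sqrt (card T) else 0)" if "k < N" for k
  proof -
    have "H r k = (if k \<in> T then 1 / m else 0)"
    proof (cases "c = 0")
      case True
      then have "v k = 0" using c0 that by auto
      then show ?thesis unfolding H_def using r by (auto simp: v_def split: if_splits)
    next
      case False
      then have "H r k = (if r = k then 1 else 0) - v k" unfolding H_def vr by simp
      then show ?thesis unfolding v_def by auto
    qed
    then show ?thesis using that rN unfolding Q_def w_def m_def by (simp add: of_real_divide)
  qed
  moreover have "Q s k = (if s = k then 1 else 0)" if "s < N" "s \<notin> T" "k < N" for s k
    using that unfolding Q_def H_def w_def by (auto simp: vs)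
  ultimately show ?thesis by blast
qed

subsection \<open>Bounded measurable functions and Haar averages\<close>

text \<open>The Haar measure lives on the whole type \<open>cmat\<close>, where entries are
  unbounded. Boundedness is therefore required only on a carrier \<open>S\<close> of full measure,
  in practice the unitary matrices. The class is closed under polynomial operations and conjugation,
  and yields integrability.\<close>

definition bmeas :: "'a measure \<Rightarrow> 'a set \<Rightarrow> ('a \<Rightarrow> complex) \<Rightarrow> bool" where
  "bmeas M S f \<longleftrightarrow> f \<in> borel_measurable M \<and> (\<exists>B. \<forall>x\<in>S. cmod (f x) \<le> B)"

lemma bmeasI: "f \<in> borel_measurable M \<Longrightarrow> (\<And>x. x \<in> S \<Longrightarrow> cmod (f x) \<le> B) \<Longrightarrow> bmeas M S f"
  unfolding bmeas_def by blast

lemma bmeas_const [intro, simp]: "bmeas M S (\<lambda>x. c)"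
  unfolding bmeas_def by auto

lemma bmeas_add [intro]: "bmeas M S f \<Longrightarrow> bmeas M S g \<Longrightarrow> bmeas M S (\<lambda>x. f x + g x)"
proof -
  assume "bmeas M S f" "bmeas M S g"
  then obtain A B where "f \<in> borel_measurable M" "g \<in> borel_measurable M"
    "\<forall>x\<in>S. cmod (f x) \<le> A" "\<forall>x\<in>S. cmod (g x) \<le> B" unfolding bmeas_def by blast
  then show ?thesis
    by (intro bmeasI[where B = "A + B"]) (auto intro: norm_triangle_mono)
qed

lemma bmeas_mult [intro]: "bmeas M S f \<Longrightarrow> bmeas M S g \<Longrightarrow> bmeas M S (\<lambda>x. f x * g x)"
proof -
  assume "bmeas M S f" "bmeas M S g"
  then obtain A B where "f \<in> borel_measurable M" "g \<in> borel_measurable M"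
    "\<forall>x\<in>S. cmod (f x) \<le> A" "\<forall>x\<in>S. cmod (g x) \<le> B" unfolding bmeas_def by blast
  then show ?thesis
    by (intro bmeasI[where B = "A * B"])
       (auto simp: norm_mult intro!: mult_mono intro: order_trans[OF norm_ge_zero])
qed

lemma bmeas_cnj [intro]: "bmeas M S f \<Longrightarrow> bmeas M S (\<lambda>x. cnj (f x))"
proof -
  assume "bmeas M S f"
  then obtain A where f: "f \<in> borel_measurable M" "\<forall>x\<in>S. cmod (f x) \<le> A" unfolding bmeas_def by blast
  have "(\<lambda>x. cnj (f x)) \<in> borel_measurable M"
    using measurable_compose[OF f(1) borel_measurable_continuous_onI[OF continuous_on_cnj[OF continuous_on_id]]] by simp
  then show ?thesis using f by (intro bmeasI[where B = A]) auto
qed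

lemma bmeas_sum [intro]: "(\<And>i. i \<in> I \<Longrightarrow> bmeas M S (f i)) \<Longrightarrow> bmeas M S (\<lambda>x. \<Sum>i\<in>I. f i x)"
  by (induction I rule: infinite_finite_induct) auto

lemma bmeas_prod [intro]: "(\<And>i. i \<in> I \<Longrightarrow> bmeas M S (f i)) \<Longrightarrow> bmeas M S (\<lambda>x. \<Prod>i\<in>I. f i x)"
  by (induction I rule: infinite_finite_induct) auto

lemma bmeas_prod_list [intro]:
  "(\<And>i. i \<in> set l \<Longrightarrow> bmeas M S (f i)) \<Longrightarrow> bmeas M S (\<lambda>x. \<Prod>i\<leftarrow>l. f i x)"
  by (induction l) auto

lemma bmeas_integrable:
  assumes "prob_space M" "bmeas M S f" "AE x in M. x \<in> S"
  shows "integrable M f"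
proof -
  interpret prob_space M by fact
  obtain B where "f \<in> borel_measurable M" "\<forall>x\<in>S. cmod (f x) \<le> B"
    using assms(2) unfolding bmeas_def by blast
  then show ?thesis using assms(3) by (intro integrable_const_bound[where B = B]) auto
qed

lemma bmeas_norm_square:
  assumes "bmeas M S f" shows "bmeas M S (\<lambda>x. complex_of_real ((cmod (f x))\<^sup>2))"
  unfolding complex_norm_square by (intro bmeas_mult bmeas_cnj assms)

lemma bmeas_norm_square_integrable:
  assumes "prob_space M" "bmeas M S f" "AE x in M. x \<in> S"
  shows "integrable M (\<lambda>x. (cmod (f x))\<^sup>2)"
proof -
  have "integrable M (\<lambda>x. complex_of_real ((cmod (f x))\<^sup>2))"
    by (rule bmeas_integrable[OF assms(1) bmeas_norm_square[OF assms(2)] assms(3)])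
  then show ?thesis by (simp add: complex_of_real_integrable_eq del: of_real_power)
qed

lemma measurable_cmat_entry [measurable]: "(\<lambda>U::cmat. U i j) \<in> borel_measurable borel"
  by (intro borel_measurable_continuous_onI continuous_on_product_then_coordinatewise[of UNIV "\<lambda>U. U i" j]
     continuous_on_product_coordinates)

lemma bmeas_entry [intro]:
  assumes "sets \<mu> = sets borel"
  shows "bmeas \<mu> {U. unitary_mat N U} (\<lambda>U::cmat. U i j)"
proof (rule bmeasI)
  show "(\<lambda>U::cmat. U i j) \<in> borel_measurable \<mu>"
    unfolding measurable_cong_sets[OF assms refl] by measurable
qed (auto intro: unitary_mat_entry_le)

lemma is_haarD:
  assumes "is_haar N \<mu>"
  shows "prob_space \<mu>" "sets \<mu> = sets borel" "AE U in \<mu>. U \<in> {U. unitary_mat N U}"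
    "\<And>V. unitary_mat N V \<Longrightarrow> distr \<mu> borel (mmul N V) = \<mu>"
proof -
  show *: "prob_space \<mu>" "sets \<mu> = sets borel"
    "\<And>V. unitary_mat N V \<Longrightarrow> distr \<mu> borel (mmul N V) = \<mu>"
    using assms unfolding is_haar_def by auto
  interpret prob_space \<mu> by fact
  have e: "emeasure \<mu> {U. unitary_mat N U} = 1" using assms unfolding is_haar_def by auto
  \<comment> \<open>The value 1 forces measurability, since \<open>emeasure\<close> is 0 on
    nonmeasurable sets.\<close>
  then have "{U. unitary_mat N U} \<in> sets \<mu>" using emeasure_notin_sets by fastforce
  then show "AE U in \<mu>. U \<in> {U. unitary_mat N U}"
    using e by (subst AE_in_set_eq_1) (auto simp: emeasure_eq_measure)
qed

lemma measurable_mmul_left [measurable]: "mmul N V \<in> borel_measurable borel"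
  unfolding mmul_def
  by (intro measurable_coordinatewise_then_product) measurable

lemma measurable_mmul_right [measurable]: "(\<lambda>U. mmul N U V) \<in> borel_measurable borel"
  unfolding mmul_def
  by (intro measurable_coordinatewise_then_product) measurable

lemma haar_shift:
  fixes F :: "cmat \<Rightarrow> 'b::{banach, second_countable_topology}"
  assumes h: "is_haar N \<mu>" and Q: "unitary_mat N Q" and F: "integrable \<mu> F"
  shows "integrable \<mu> (\<lambda>U. F (mmul N Q U))" "(\<integral>U. F (mmul N Q U) \<partial>\<mu>) = (\<integral>U. F U \<partial>\<mu>)"
proof -
  note hd = is_haarD[OF h]
  have m: "mmul N Q \<in> measurable \<mu> borel"
    unfolding measurable_cong_sets[OF hd(2) refl] by measurable
  have F': "F \<in> borel_measurable borel"
    using F hd(2) by (auto simp: measurable_cong_sets[OF hd(2) refl] dest: borel_measurable_integrable)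
  show "integrable \<mu> (\<lambda>U. F (mmul N Q U))"
    using F hd(4)[OF Q] integrable_distr[OF m, of F] by simp
  show "(\<integral>U. F (mmul N Q U) \<partial>\<mu>) = (\<integral>U. F U \<partial>\<mu>)"
    using hd(4)[OF Q] integral_distr[OF m F'] by simp
qed

text \<open>Each translate of \<open>F\<close> has the same integral, so a pointwise bound on the
  mean over finitely many translates is enough. Finite families of roots of unity can thus stand in
  for the torus of phases.\<close>

lemma haar_average_le:
  fixes F G :: "cmat \<Rightarrow> real"
  assumes h: "is_haar N \<mu>" and E: "finite E" "E \<noteq> {}"
    and Q: "\<And>e. e \<in> E \<Longrightarrow> unitary_mat N (Q e)"
    and F: "integrable \<mu> F" and G: "integrable \<mu> G"
    and le: "\<And>U. unitary_mat N U \<Longrightarrow> (\<Sum>e\<in>E. F (mmul N (Q e) U)) \<le> card E * G U"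
  shows "(\<integral>U. F U \<partial>\<mu>) \<le> (\<integral>U. G U \<partial>\<mu>)"
proof -
  have "card E * (\<integral>U. F U \<partial>\<mu>) = (\<Sum>e\<in>E. \<integral>U. F (mmul N (Q e) U) \<partial>\<mu>)"
    using haar_shift(2)[OF h Q F] by simp
  also have "\<dots> = (\<integral>U. (\<Sum>e\<in>E. F (mmul N (Q e) U)) \<partial>\<mu>)"
    using haar_shift(1)[OF h Q F] by (subst Bochner_Integration.integral_sum) auto
  also have "\<dots> \<le> (\<integral>U. card E * G U \<partial>\<mu>)"
  proof (rule integral_mono_AE)
    show "integrable \<mu> (\<lambda>U. \<Sum>e\<in>E. F (mmul N (Q e) U))"
      using haar_shift(1)[OF h Q F] by auto
    show "AE U in \<mu>. (\<Sum>e\<in>E. F (mmul N (Q e) U)) \<le> card E * G U"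
      using is_haarD(3)[OF h] by eventually_elim (use le in auto)
  qed (use G in auto)
  also have "\<dots> = card E * (\<integral>U. G U \<partial>\<mu>)" by simp
  finally have "card E * (\<integral>U. F U \<partial>\<mu>) \<le> card E * (\<integral>U. G U \<partial>\<mu>)" .
  moreover have "0 < real (card E)" using E by (simp add: card_gt_0_iff)
  ultimately show ?thesis by simp
qed

subsection \<open>Averaging over roots of unity\<close>

lemma root_of_unity_sum:
  assumes a: "a < q" and b: "b < q"
  defines "\<zeta> \<equiv> cis (2 * pi / q)"
  shows "(\<Sum>k<q. \<zeta> ^ (k * a) * cnj (\<zeta> ^ (k * b))) = (if a = b then of_nat q else 0)"
proof -
  have z1: "\<zeta> * cnj \<zeta> = 1" unfolding \<zeta>_def by (simp add: cis_mult cis_cnj)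
  have zq: "\<zeta> ^ q = 1" using a unfolding \<zeta>_def by (simp add: Complex.DeMoivre)
  define w where "w = \<zeta> ^ a * cnj (\<zeta> ^ b)"
  have s: "(\<Sum>k<q. \<zeta> ^ (k * a) * cnj (\<zeta> ^ (k * b))) = (\<Sum>k<q. w ^ k)"
    unfolding w_def by (simp add: power_mult_distrib power_mult[symmetric] mult.commute)
  have wq: "w ^ q = 1"
  proof -
    have "w ^ q = (\<zeta> ^ q) ^ a * cnj ((\<zeta> ^ q) ^ b)"
      unfolding w_def by (simp add: power_mult_distrib power_mult[symmetric] mult.commute)
    then show ?thesis by (simp add: zq)
  qed
  show ?thesis
  proof (cases "a = b")
    case True
    then have "w = 1" unfolding w_def using z1 by (simp add: power_mult_distrib[symmetric])
    then show ?thesis using s True by simp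
  next
    case False
    have "w \<noteq> 1"
    proof
      assume "w = 1"
      then have "\<zeta> ^ a * (\<zeta> * cnj \<zeta>) ^ b = \<zeta> ^ b"
        unfolding w_def by (simp add: power_mult_distrib mult_ac)
      then have "\<zeta> ^ a = \<zeta> ^ b" by (simp add: z1)
      then have "cis (2 * pi * real a / real q) = cis (2 * pi * real b / real q)"
        unfolding \<zeta>_def by (simp add: Complex.DeMoivre mult_ac)
      moreover have "inj_on (\<lambda>k. cis (2 * pi * real k / real q)) {..<q}"
        using Complex.bij_betw_roots_unity[of q] a unfolding bij_betw_def by auto
      ultimately show False using a b False by (auto dest: inj_onD)
    qed
    then show ?thesis using s wq False by (simp add: geometric_sum)
  qed
qed

text \<open>Parseval on a product of cyclic groups of order \<open>q\<close>: exponent vectors with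
  all entries below \<open>q\<close> that differ somewhere are distinct, hence orthogonal,
  characters.\<close>

lemma phase_average:
  fixes A :: "'x \<Rightarrow> complex" and \<alpha> :: "'x \<Rightarrow> 'i \<Rightarrow> nat"
  assumes T: "finite T" and lt: "\<And>x i. x \<in> X \<Longrightarrow> i \<in> T \<Longrightarrow> \<alpha> x i < q"
    and inj: "\<And>x y. x \<in> X \<Longrightarrow> y \<in> X \<Longrightarrow> (\<And>i. i \<in> T \<Longrightarrow> \<alpha> x i = \<alpha> y i) \<Longrightarrow> x = y"
  defines "\<zeta> \<equiv> cis (2 * pi / q)"
  shows "(\<Sum>e\<in>PiE T (\<lambda>_. {..<q}). (cmod (\<Sum>x\<in>X. A x * (\<Prod>i\<in>T. \<zeta> ^ (e i * \<alpha> x i))))\<^sup>2)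
       = real q ^ card T * (\<Sum>x\<in>X. (cmod (A x))\<^sup>2)"
proof (cases "finite X")
  case fX: True
  let ?E = "PiE T (\<lambda>_. {..<q})"
  define c where "c = (\<lambda>e x. \<Prod>i\<in>T. \<zeta> ^ (e i * \<alpha> x i))"
  have orth: "(\<Sum>e\<in>?E. c e x * cnj (c e y)) = (if x = y then of_nat q ^ card T else 0)"
    if x: "x \<in> X" and y: "y \<in> X" for x y
  proof -
    have "(\<Sum>e\<in>?E. c e x * cnj (c e y)) = (\<Sum>e\<in>?E. \<Prod>i\<in>T. \<zeta> ^ (e i * \<alpha> x i) * cnj (\<zeta> ^ (e i * \<alpha> y i)))"
      unfolding c_def by (simp add: prod.distrib)
    also have "\<dots> = (\<Prod>i\<in>T. \<Sum>k<q. \<zeta> ^ (k * \<alpha> x i) * cnj (\<zeta> ^ (k * \<alpha> y i)))"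
      by (subst prod_sum_PiE) (use T in auto)
    also have "\<dots> = (\<Prod>i\<in>T. if \<alpha> x i = \<alpha> y i then of_nat q else 0)"
      unfolding \<zeta>_def using lt x y by (intro prod.cong refl root_of_unity_sum) auto
    also have "\<dots> = (if x = y then of_nat q ^ card T else 0)"
    proof (cases "x = y")
      case False
      then obtain i where "i \<in> T" "\<alpha> x i \<noteq> \<alpha> y i" using inj[OF x y] by blast
      then have "(\<Prod>i\<in>T. if \<alpha> x i = \<alpha> y i then of_nat q else (0::complex)) = 0"
        using T by (intro prod_zero) auto
      then show ?thesis using False by simp
    qed simp
    finally show ?thesis .
  qed
  have "complex_of_real (\<Sum>e\<in>?E. (cmod (\<Sum>x\<in>X. A x * c e x))\<^sup>2) =
     (\<Sum>e\<in>?E. \<Sum>x\<in>X. \<Sum>y\<in>X. A x * cnj (A y) * (c e x * cnj (c e y)))"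
    by (simp add: of_real_cmod_square sum_product) (simp add: algebra_simps)
  also have "\<dots> = (\<Sum>x\<in>X. \<Sum>y\<in>X. A x * cnj (A y) * (\<Sum>e\<in>?E. c e x * cnj (c e y)))"
    unfolding sum_distrib_left by (rule sum_rotate)
  also have "\<dots> = (\<Sum>x\<in>X. \<Sum>y\<in>X. if x = y then A x * cnj (A x) * of_nat q ^ card T else 0)"
    using orth by (intro sum.cong refl) auto
  also have "\<dots> = complex_of_real (real q ^ card T * (\<Sum>x\<in>X. (cmod (A x))\<^sup>2))"
    using fX by (simp add: of_real_cmod_square sum_distrib_left mult_ac)
  finally show ?thesis unfolding c_def of_real_eq_iff .
qed simp

subsection \<open>Sums over sequences\<close>

definition seqs :: "'a set \<Rightarrow> nat \<Rightarrow> 'a list set" where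
  "seqs A n = {xs. length xs = n \<and> set xs \<subseteq> A}"

lemma finite_seqs [simp, intro]: "finite A \<Longrightarrow> finite (seqs A n)"
  using finite_lists_length_eq[of A n] unfolding seqs_def by (simp add: conj_commute)

lemma seqs_0 [simp]: "seqs A 0 = {[]}"
  unfolding seqs_def by auto

lemma sum_seqs_Suc:
  "(\<Sum>xs\<in>seqs A (Suc n). f xs) = (\<Sum>x\<in>A. \<Sum>xs\<in>seqs A n. f (x # xs))"
proof -
  have b: "bij_betw (\<lambda>(x, xs). x # xs) (A \<times> seqs A n) (seqs A (Suc n))"
    by (rule bij_betw_byWitness[where f' = "\<lambda>xs. (hd xs, tl xs)"])
       (auto simp: seqs_def length_Suc_conv)
  have "(\<Sum>xs\<in>seqs A (Suc n). f xs) = (\<Sum>(x, xs)\<in>A \<times> seqs A n. f (x # xs))"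
    using sum.reindex_bij_betw[OF b, of f] by (simp add: case_prod_beta)
  then show ?thesis by (simp add: sum.cartesian_product)
qed

lemma prod_list_sum_expand:
  fixes f :: "'i \<Rightarrow> 's \<Rightarrow> complex"
  shows "(\<Prod>s\<leftarrow>j. \<Sum>i\<in>T. f i s) = (\<Sum>is\<in>seqs T (length j). prod_list (map2 f is j))"
  by (induction j) (simp_all add: sum_seqs_Suc sum_product)

text \<open>\<open>prod_list (map2 U is j)\<close> is the entry of the tensor power of
  \<open>U\<close> at the row word \<open>is\<close> and the column word \<open>j\<close>. Its
  columns inherit orthonormality factor by factor.\<close>

lemma tensor_power_orthonormal:
  assumes U: "unitary_mat M U"
  shows "length j = length j' \<Longrightarrow> set j \<subseteq> {..<M} \<Longrightarrow> set j' \<subseteq> {..<M} \<Longrightarrow>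
    (\<Sum>is\<in>seqs {..<M} (length j). prod_list (map2 U is j) * cnj (prod_list (map2 U is j')))
      = (if j = j' then 1 else 0)"
proof (induction j j' rule: list_induct2)
  case (Cons s j s' j')
  let ?P = "\<lambda>is j. prod_list (map2 U is j)"
  have "(\<Sum>is\<in>seqs {..<M} (length (s # j)). ?P is (s # j) * cnj (?P is (s' # j')))
      = (\<Sum>i<M. \<Sum>is\<in>seqs {..<M} (length j). (U i s * cnj (U i s')) * (?P is j * cnj (?P is j')))"
    by (simp add: sum_seqs_Suc mult_ac)
  also have "\<dots> = (\<Sum>i<M. U i s * cnj (U i s')) * (\<Sum>is\<in>seqs {..<M} (length j). ?P is j * cnj (?P is j'))"
    by (rule sum_product[symmetric])
  finally show ?case using Cons unitary_mat_cols[OF U, of s s'] by auto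
qed auto

lemma tensor_power_isometry:
  assumes U: "unitary_mat M U" and J: "finite J" "\<And>j. j \<in> J \<Longrightarrow> length j = a \<and> set j \<subseteq> {..<M}"
  shows "(\<Sum>is\<in>seqs {..<M} a. (cmod (\<Sum>j\<in>J. A j * prod_list (map2 U is j)))\<^sup>2) = (\<Sum>j\<in>J. (cmod (A j))\<^sup>2)"
proof -
  let ?P = "\<lambda>is j. prod_list (map2 U is j)"
  have "complex_of_real (\<Sum>is\<in>seqs {..<M} a. (cmod (\<Sum>j\<in>J. A j * ?P is j))\<^sup>2) =
     (\<Sum>is\<in>seqs {..<M} a. \<Sum>x\<in>J. \<Sum>y\<in>J. A x * cnj (A y) * (?P is x * cnj (?P is y)))"
    by (simp add: of_real_cmod_square sum_product) (simp add: algebra_simps)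
  also have "\<dots> = (\<Sum>x\<in>J. \<Sum>y\<in>J. A x * cnj (A y) * (\<Sum>is\<in>seqs {..<M} a. ?P is x * cnj (?P is y)))"
    unfolding sum_distrib_left by (rule sum_rotate)
  also have "\<dots> = (\<Sum>x\<in>J. \<Sum>y\<in>J. if x = y then A x * cnj (A x) else 0)"
  proof (intro sum.cong refl)
    fix x y assume "x \<in> J" "y \<in> J"
    then have "(\<Sum>is\<in>seqs {..<M} a. ?P is x * cnj (?P is y)) = (if x = y then 1 else 0)"
      using tensor_power_orthonormal[OF U, of x y] J(2)[of x] J(2)[of y] by simp
    then show "A x * cnj (A y) * (\<Sum>is\<in>seqs {..<M} a. ?P is x * cnj (?P is y)) =
        (if x = y then A x * cnj (A x) else 0)" by simp
  qed
  also have "\<dots> = complex_of_real (\<Sum>j\<in>J. (cmod (A j))\<^sup>2)"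
    using J by (simp add: of_real_cmod_square)
  finally show ?thesis unfolding of_real_eq_iff .
qed

lemma cmod_sum_square_le:
  "(cmod (\<Sum>x\<in>X. f x))\<^sup>2 \<le> card X * (\<Sum>x\<in>X. (cmod (f x))\<^sup>2)"
proof -
  have "(cmod (\<Sum>x\<in>X. f x))\<^sup>2 \<le> (\<Sum>x\<in>X. cmod (f x))\<^sup>2"
    by (intro power_mono norm_sum) auto
  also have "\<dots> \<le> card X * (\<Sum>x\<in>X. (cmod (f x))\<^sup>2)"
    using sum_squared_le_sum_of_squares[of "\<lambda>x. cmod (f x)" X] by (cases "finite X") (auto simp: mult.commute)
  finally show ?thesis .
qed

lemma card_same_mset_le: "card {ys. mset ys = mset xs} \<le> fact (length xs)"
proof -
  have "card (permutations_of_multiset (mset xs)) \<le> fact (size (mset xs))"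
    unfolding card_permutations_of_multiset(1) by (rule div_le_dividend)
  then show ?thesis by (simp add: permutations_of_multiset_def)
qed

lemma prod_list_power_count:
  fixes z :: "'a::comm_monoid_mult"
  assumes "finite T" "set is \<subseteq> T"
  shows "(\<Prod>i\<leftarrow>is. z ^ e i) = (\<Prod>i\<in>T. z ^ (e i * count_list is i))"
  using assms(2)
proof (induction "is")
  case (Cons x xs)
  have "(\<Prod>i\<in>T. z ^ (e i * count_list (x # xs) i)) =
      (\<Prod>i\<in>T. (if i = x then z ^ e x else 1) * z ^ (e i * count_list xs i))"
    by (intro prod.cong) (auto simp: power_add)
  also have "\<dots> = z ^ e x * (\<Prod>i\<in>T. z ^ (e i * count_list xs i))"
    unfolding prod.distrib using assms(1) Cons.prems by simp
  finally show ?case using Cons by simp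
qed simp

text \<open>Expanding the product over the superposed row yields row words \<open>is\<close> over
  \<open>T\<close>, with normalization \<open>card T\<close> to the power \<open>a\<close> in the
  square. The phases separate words with different letter counts. A class of equal counts has at
  most \<open>a!\<close> words, so Cauchy-Schwarz costs \<open>fact a\<close>, and the tensor power
  of \<open>U\<close> preserves the remaining norm. Roots of order \<open>Suc a\<close> suffice
  because counts range from 0 to \<open>a\<close>.\<close>

lemma row_average:
  assumes U: "unitary_mat M U" and T: "T \<subseteq> {..<M}"
    and J: "finite J" "\<And>j. j \<in> J \<Longrightarrow> length j = a \<and> set j \<subseteq> {..<M}"
  defines "\<zeta> \<equiv> cis (2 * pi / Suc a)"
  shows "(\<Sum>e\<in>PiE T (\<lambda>_. {..<Suc a}).
       (cmod (\<Sum>j\<in>J. A j * (\<Prod>s\<leftarrow>j. \<Sum>i\<in>T. \<zeta> ^ e i / sqrt (card T) * U i s)))\<^sup>2)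
     \<le> real (Suc a) ^ card T * (fact a / real (card T) ^ a * (\<Sum>j\<in>J. (cmod (A j))\<^sup>2))"
proof -
  let ?E = "PiE T (\<lambda>_. {..<Suc a})"
  have fT: "finite T" using T finite_subset by blast
  define m where "m = sqrt (card T)"
  define B where "B = (\<lambda>is. \<Sum>j\<in>J. A j * prod_list (map2 U is j))"
  \<comment> \<open>The phase attached to a row word depends only on its letter counts, recorded by
    \<open>\<gamma>\<close>.\<close>
  define \<gamma> where "\<gamma> = (\<lambda>is. restrict (count_list is) T)"
  define F where "F = (\<lambda>g. {is \<in> seqs T a. \<gamma> is = g})"
  define X where "X = \<gamma> ` seqs T a"
  have expand: "(\<Sum>j\<in>J. A j * (\<Prod>s\<leftarrow>j. \<Sum>i\<in>T. \<zeta> ^ e i / m * U i s)) =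
      (\<Sum>g\<in>X. (\<Sum>is\<in>F g. B is / m ^ a) * (\<Prod>i\<in>T. \<zeta> ^ (e i * g i)))" for e
  proof -
    have p: "prod_list (map2 (\<lambda>i s. \<zeta> ^ e i / m * U i s) is j) =
        (\<Prod>i\<leftarrow>is. \<zeta> ^ e i) * prod_list (map2 U is j) / m ^ length is"
      if "length is = length j" for "is" j
      using that by (induction "is" j rule: list_induct2) (auto simp: field_simps)
    have "(\<Sum>j\<in>J. A j * (\<Prod>s\<leftarrow>j. \<Sum>i\<in>T. \<zeta> ^ e i / m * U i s)) =
       (\<Sum>j\<in>J. \<Sum>is\<in>seqs T a. A j * prod_list (map2 U is j) / m ^ a * (\<Prod>i\<leftarrow>is. \<zeta> ^ e i))"
      unfolding prod_list_sum_expand sum_distrib_left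
    proof (intro sum.cong)
      fix j "is" assume j: "j \<in> J" and "is": "is \<in> seqs T a"
      have l: "length is = length j" "length is = a" using J(2)[OF j] "is" unfolding seqs_def by auto
      show "A j * prod_list (map2 (\<lambda>i s. \<zeta> ^ e i / m * U i s) is j) =
         A j * prod_list (map2 U is j) / m ^ a * (\<Prod>i\<leftarrow>is. \<zeta> ^ e i)"
        unfolding p[OF l(1)] l(2) by simp
    qed (use J(2) in auto)
    also have "\<dots> = (\<Sum>is\<in>seqs T a. B is / m ^ a * (\<Prod>i\<leftarrow>is. \<zeta> ^ e i))"
      unfolding B_def by (subst sum.swap) (simp add: sum_distrib_right sum_divide_distrib)
    also have "\<dots> = (\<Sum>is\<in>seqs T a. B is / m ^ a * (\<Prod>i\<in>T. \<zeta> ^ (e i * \<gamma> is i)))"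
      using fT unfolding \<gamma>_def
      by (intro sum.cong refl) (auto simp: seqs_def prod_list_power_count[where T = T])
    also have "\<dots> = (\<Sum>g\<in>X. \<Sum>is\<in>F g. B is / m ^ a * (\<Prod>i\<in>T. \<zeta> ^ (e i * \<gamma> is i)))"
      unfolding X_def F_def by (rule sum.image_gen) (use fT in auto)
    also have "\<dots> = (\<Sum>g\<in>X. (\<Sum>is\<in>F g. B is / m ^ a) * (\<Prod>i\<in>T. \<zeta> ^ (e i * g i)))"
      unfolding sum_distrib_right by (intro sum.cong refl) (auto simp: F_def)
    finally show ?thesis .
  qed
  have "(\<Sum>e\<in>?E. (cmod (\<Sum>j\<in>J. A j * (\<Prod>s\<leftarrow>j. \<Sum>i\<in>T. \<zeta> ^ e i / m * U i s)))\<^sup>2)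
     = real (Suc a) ^ card T * (\<Sum>g\<in>X. (cmod (\<Sum>is\<in>F g. B is / m ^ a))\<^sup>2)"
    unfolding expand unfolding \<zeta>_def
  proof (rule phase_average[OF fT])
    fix g i assume "g \<in> X" "i \<in> T"
    then obtain "is" where "is \<in> seqs T a" "g i = count_list is i" unfolding X_def \<gamma>_def by auto
    then show "g i < Suc a" using count_le_length[of "is" i] unfolding seqs_def by auto
  next
    fix g h assume "g \<in> X" "h \<in> X" "\<And>i. i \<in> T \<Longrightarrow> g i = h i"
    then show "g = h" unfolding X_def \<gamma>_def by (auto simp: restrict_def fun_eq_iff)
  qed
  also have "\<dots> \<le> real (Suc a) ^ card T * (\<Sum>g\<in>X. fact a * (\<Sum>is\<in>F g. (cmod (B is))\<^sup>2 / real (card T) ^ a))"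
  proof (intro mult_left_mono sum_mono)
    fix g assume "g \<in> X"
    then obtain is0 where is0: "is0 \<in> F g" unfolding X_def F_def by auto
    have "F g \<subseteq> {ys. mset ys = mset is0}"
    proof
      fix ys assume y: "ys \<in> F g"
      then have "\<gamma> ys = \<gamma> is0" "set ys \<subseteq> T" "set is0 \<subseteq> T" using is0 unfolding F_def seqs_def by auto
      then have "count_list ys i = count_list is0 i" for i
        unfolding \<gamma>_def by (cases "i \<in> T") (metis restrict_apply', metis count_notin subsetD)
      then show "ys \<in> {ys. mset ys = mset is0}"
        by (auto intro: multiset_eqI simp: count_mset)
    qed
    moreover have "finite {ys. mset ys = mset is0}"
      using finite_permutations_of_multiset[of "mset is0"] by (simp add: permutations_of_multiset_def)
    ultimately have "card (F g) \<le> card {ys. mset ys = mset is0}" by (rule card_mono[rotated])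
    also have "\<dots> \<le> fact (length is0)" by (rule card_same_mset_le)
    also have "length is0 = a" using is0 unfolding F_def seqs_def by auto
    finally have c: "real (card (F g)) \<le> fact a" by (metis of_nat_fact of_nat_le_iff)
    have "(m ^ a)\<^sup>2 = (m\<^sup>2) ^ a" by (simp only: power_mult[symmetric] mult.commute)
    then have mm: "(m ^ a)\<^sup>2 = real (card T) ^ a" unfolding m_def by simp
    have nb: "(cmod (B is / complex_of_real (m ^ a)))\<^sup>2 = (cmod (B is))\<^sup>2 / real (card T) ^ a" for "is"
      unfolding mm[symmetric] by (simp add: norm_divide norm_power power_divide m_def)
    have "(cmod (\<Sum>is\<in>F g. B is / m ^ a))\<^sup>2 \<le> card (F g) * (\<Sum>is\<in>F g. (cmod (B is / m ^ a))\<^sup>2)"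
      by (rule cmod_sum_square_le)
    also have "\<dots> \<le> fact a * (\<Sum>is\<in>F g. (cmod (B is / m ^ a))\<^sup>2)"
      by (intro mult_right_mono c sum_nonneg) auto
    finally show "(cmod (\<Sum>is\<in>F g. B is / m ^ a))\<^sup>2 \<le> fact a * (\<Sum>is\<in>F g. (cmod (B is))\<^sup>2 / real (card T) ^ a)"
      unfolding nb .
  qed auto
  also have "(\<Sum>g\<in>X. fact a * (\<Sum>is\<in>F g. (cmod (B is))\<^sup>2 / real (card T) ^ a)) =
      fact a * (\<Sum>is\<in>seqs T a. (cmod (B is))\<^sup>2 / real (card T) ^ a)"
    unfolding sum_distrib_left[symmetric] X_def F_def
    by (subst sum.image_gen[of "seqs T a" _ \<gamma>]) (use fT in auto)
  \<comment> \<open>Adding the row words that leave \<open>T\<close> completes the columns of the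
    tensor power, so that the isometry applies.\<close>
  also have "\<dots> \<le> fact a * (\<Sum>is\<in>seqs {..<M} a. (cmod (B is))\<^sup>2 / real (card T) ^ a)"
  proof (intro mult_left_mono sum_mono2)
    show "seqs T a \<subseteq> seqs {..<M} a" using T unfolding seqs_def by auto
  qed auto
  also have "\<dots> = fact a / real (card T) ^ a * (\<Sum>j\<in>J. (cmod (A j))\<^sup>2)"
  proof -
    have "(\<Sum>is\<in>seqs {..<M} a. (cmod (B is))\<^sup>2) = (\<Sum>j\<in>J. (cmod (A j))\<^sup>2)"
      unfolding B_def by (rule tensor_power_isometry[OF U J])
    then show ?thesis unfolding sum_divide_distrib[symmetric] by simp
  qed
  finally show ?thesis unfolding m_def by (simp add: mult_left_mono)
qed

subsection \<open>Second moments of polynomials in the entries of a Haar unitary\<close>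

lemma bmeas_row_poly:
  assumes "sets \<mu> = sets borel"
  shows "bmeas \<mu> {U. unitary_mat M U} (\<lambda>U. \<Sum>x\<in>X. C x * (\<Prod>r\<in>S. \<Prod>s\<leftarrow>\<kappa> x r. U r s))"
  by (intro bmeas_sum bmeas_mult bmeas_prod bmeas_prod_list bmeas_const bmeas_entry assms)

text \<open>The rows are peeled off one at a time: left invariance lets us replace row \<open>r\<close> by a phase-twisted
  uniform superposition of the rows outside the remaining \<open>S\<close>.\<close>
lemma haar_moment_fixed_rows:
  assumes h: "is_haar M \<mu>" and N: "N < M"
  shows "finite S \<Longrightarrow> S \<subseteq> {..<M} \<Longrightarrow> card S \<le> N \<Longrightarrow> finite X \<Longrightarrow>
    (\<And>x r. x \<in> X \<Longrightarrow> r \<in> S \<Longrightarrow> length (\<kappa> x r) = \<alpha> r \<and> set (\<kappa> x r) \<subseteq> {..<M}) \<Longrightarrow>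
    (\<And>x y. x \<in> X \<Longrightarrow> y \<in> X \<Longrightarrow> (\<And>r. r \<in> S \<Longrightarrow> \<kappa> x r = \<kappa> y r) \<Longrightarrow> x = y) \<Longrightarrow>
    (\<integral>U. (cmod (\<Sum>x\<in>X. C x * (\<Prod>r\<in>S. \<Prod>s\<leftarrow>\<kappa> x r. U r s)))\<^sup>2 \<partial>\<mu>)
      \<le> (\<Prod>r\<in>S. fact (\<alpha> r) / real (M - N) ^ \<alpha> r) * (\<Sum>x\<in>X. (cmod (C x))\<^sup>2)"
proof (induction S arbitrary: X rule: finite_induct)
  case empty
  interpret prob_space \<mu> using is_haarD(1)[OF h] .
  \<comment> \<open>Without rows the separation hypothesis leaves at most one index, so the
    integrand is constant and the bound is an equality.\<close>
  have "X = {} \<or> (\<exists>x. X = {x})" using empty.prems(5) by (metis empty_iff equals0I insertI1 is_singletonI' is_singleton_def)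
  then show ?case by (auto simp: prob_space)
next
  case (insert r S)
  note hd = is_haarD[OF h]
  \<comment> \<open>\<open>T\<close> contains \<open>r\<close> and every row that no longer matters,
    while the rows in \<open>S\<close> stay fixed under \<open>Q e\<close>. So translation changes
    only the factor of row \<open>r\<close>, and \<open>card T\<close> is at least
    \<open>M - N\<close>.\<close>
  define T where "T = {..<M} - S"
  define a where "a = \<alpha> r"
  define \<zeta> where "\<zeta> = cis (2 * pi / Suc a)"
  let ?E = "PiE T (\<lambda>_. {..<Suc a})"
  have rT: "r \<in> T" and TM: "T \<subseteq> {..<M}" and fT: "finite T" using insert unfolding T_def by auto
  have cT: "card T = M - card S"
    unfolding T_def using insert by (subst card_Diff_subset) auto
  then have cT': "M - N \<le> card T" using insert.prems(2) insert.hyps by auto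
  define J where "J = (\<lambda>x. \<kappa> x r) ` X"
  have J: "finite J" "\<And>j. j \<in> J \<Longrightarrow> length j = a \<and> set j \<subseteq> {..<M}"
    using insert.prems unfolding J_def a_def by auto
  define X' where "X' = (\<lambda>j. {x \<in> X. \<kappa> x r = j})"
  define f where "f = (\<lambda>j U. \<Sum>x\<in>X' j. C x * (\<Prod>r\<in>S. \<Prod>s\<leftarrow>\<kappa> x r. U r s))"
  define F where "F = (\<lambda>U. (cmod (\<Sum>x\<in>X. C x * (\<Prod>r\<in>insert r S. \<Prod>s\<leftarrow>\<kappa> x r. U r s)))\<^sup>2)"
  define G where "G = (\<lambda>U. fact a / real (card T) ^ a * (\<Sum>j\<in>J. (cmod (f j U))\<^sup>2))"
  have "\<forall>e\<in>?E. \<exists>Q. unitary_mat M Q \<and>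
     (\<forall>k<M. Q r k = (if k \<in> T then \<zeta> ^ e k / sqrt (card T) else 0)) \<and>
     (\<forall>s<M. s \<notin> T \<longrightarrow> (\<forall>k<M. Q s k = (if s = k then 1 else 0)))"
    by (intro ballI exists_unitary_row TM rT) (simp add: \<zeta>_def norm_power)
  from bchoice[OF this] obtain Q where Q0: "\<forall>e\<in>?E. unitary_mat M (Q e) \<and>
     (\<forall>k<M. Q e r k = (if k \<in> T then \<zeta> ^ e k / sqrt (card T) else 0)) \<and>
     (\<forall>s<M. s \<notin> T \<longrightarrow> (\<forall>k<M. Q e s k = (if s = k then 1 else 0)))" ..
  have Q: "\<And>e. e \<in> ?E \<Longrightarrow> unitary_mat M (Q e)"
     "\<And>e k. e \<in> ?E \<Longrightarrow> k < M \<Longrightarrow> Q e r k = (if k \<in> T then \<zeta> ^ e k / sqrt (card T) else 0)"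
     "\<And>e k s. e \<in> ?E \<Longrightarrow> s < M \<Longrightarrow> s \<notin> T \<Longrightarrow> k < M \<Longrightarrow> Q e s k = (if s = k then 1 else 0)"
    using Q0 by blast+
  have F_split: "F U = (cmod (\<Sum>j\<in>J. f j U * (\<Prod>s\<leftarrow>j. U r s)))\<^sup>2" for U
  proof -
    have "(\<Sum>x\<in>X. C x * (\<Prod>r\<in>insert r S. \<Prod>s\<leftarrow>\<kappa> x r. U r s)) =
       (\<Sum>x\<in>X. C x * (\<Prod>r\<in>S. \<Prod>s\<leftarrow>\<kappa> x r. U r s) * (\<Prod>s\<leftarrow>\<kappa> x r. U r s))"
      using insert.hyps by (simp add: mult_ac)
    also have "\<dots> = (\<Sum>j\<in>J. \<Sum>x\<in>X' j. C x * (\<Prod>r\<in>S. \<Prod>s\<leftarrow>\<kappa> x r. U r s) * (\<Prod>s\<leftarrow>\<kappa> x r. U r s))"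
      unfolding J_def X'_def by (rule sum.image_gen) (use insert in auto)
    also have "\<dots> = (\<Sum>j\<in>J. f j U * (\<Prod>s\<leftarrow>j. U r s))"
      unfolding f_def sum_distrib_right by (intro sum.cong refl) (auto simp: X'_def)
    finally show ?thesis unfolding F_def by simp
  qed
  have bf: "bmeas \<mu> {U. unitary_mat M U} (f j)" for j
    unfolding f_def by (rule bmeas_row_poly[OF hd(2)])
  have intf: "integrable \<mu> (\<lambda>U. (cmod (f j U))\<^sup>2)" for j
    by (rule bmeas_norm_square_integrable[OF hd(1) bf hd(3)])
  have intF: "integrable \<mu> F"
    unfolding F_def by (rule bmeas_norm_square_integrable[OF hd(1) bmeas_row_poly[OF hd(2)] hd(3)])
  have intG: "integrable \<mu> G" unfolding G_def using intf by auto
  have cE: "card ?E = Suc a ^ card T" using fT by (simp add: card_PiE)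
  have "(\<integral>U. F U \<partial>\<mu>) \<le> (\<integral>U. G U \<partial>\<mu>)"
  proof (rule haar_average_le[OF h, where E = ?E and Q = Q])
    show "finite ?E" "?E \<noteq> {}" using fT by (auto intro: finite_PiE simp: PiE_eq_empty_iff)
    fix U assume U: "unitary_mat M U"
    have "F (mmul M (Q e) U) =
      (cmod (\<Sum>j\<in>J. f j U * (\<Prod>s\<leftarrow>j. \<Sum>i\<in>T. \<zeta> ^ e i / sqrt (card T) * U i s)))\<^sup>2" if e: "e \<in> ?E" for e
    proof -
      have same: "mmul M (Q e) U r' s = U r' s" if "r' \<in> S" "s < M" for r' s
      proof -
        have r': "r' < M" "r' \<notin> T" using that insert.prems unfolding T_def by auto
        have "(\<Sum>k<M. Q e r' k * U k s) = (\<Sum>k<M. if k = r' then U r' s else 0)"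
          using Q(3)[OF e r'] by (intro sum.cong refl) auto
        then show ?thesis using r' that unfolding mmul_def by simp
      qed
      have new: "mmul M (Q e) U r s = (\<Sum>i\<in>T. \<zeta> ^ e i / sqrt (card T) * U i s)" if "s < M" for s
      proof -
        have "(\<Sum>k<M. Q e r k * U k s) = (\<Sum>k<M. if k \<in> T then \<zeta> ^ e k / sqrt (card T) * U k s else 0)"
          using Q(2)[OF e] by (intro sum.cong refl) auto
        also have "\<dots> = (\<Sum>k\<in>{..<M} \<inter> T. \<zeta> ^ e k / sqrt (card T) * U k s)"
          by (subst sum.inter_restrict) auto
        also have "{..<M} \<inter> T = T" using TM by auto
        finally show ?thesis using that rT TM unfolding mmul_def by auto
      qed
      have "f j (mmul M (Q e) U) = f j U" for j
      proof -
        have "(\<Prod>s\<leftarrow>\<kappa> x r'. mmul M (Q e) U r' s) = (\<Prod>s\<leftarrow>\<kappa> x r'. U r' s)" if "x \<in> X' j" "r' \<in> S" for x r'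
          using insert.prems(4)[of x r'] that same[OF that(2)] unfolding X'_def
          by (intro arg_cong[where f = prod_list] map_cong) auto
        then show ?thesis unfolding f_def by (intro sum.cong refl arg_cong2[where f = times] prod.cong) auto
      qed
      moreover have "(\<Prod>s\<leftarrow>j. mmul M (Q e) U r s) = (\<Prod>s\<leftarrow>j. \<Sum>i\<in>T. \<zeta> ^ e i / sqrt (card T) * U i s)"
        if "j \<in> J" for j
        using J(2)[OF that] new by (intro arg_cong[where f = prod_list] map_cong) auto
      ultimately show ?thesis unfolding F_split by (intro arg_cong[where f = "\<lambda>z. (cmod z)\<^sup>2"] sum.cong) auto
    qed
    then have "(\<Sum>e\<in>?E. F (mmul M (Q e) U)) =
        (\<Sum>e\<in>?E. (cmod (\<Sum>j\<in>J. f j U * (\<Prod>s\<leftarrow>j. \<Sum>i\<in>T. \<zeta> ^ e i / sqrt (card T) * U i s)))\<^sup>2)"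
      by (intro sum.cong) auto
    also have "\<dots> \<le> real (Suc a) ^ card T * (fact a / real (card T) ^ a * (\<Sum>j\<in>J. (cmod (f j U))\<^sup>2))"
      unfolding \<zeta>_def by (rule row_average[OF U TM J])
    finally show "(\<Sum>e\<in>?E. F (mmul M (Q e) U)) \<le> card ?E * G U"
      unfolding G_def cE by simp
  qed (use Q intF intG in auto)
  also have "(\<integral>U. G U \<partial>\<mu>) = fact a / real (card T) ^ a * (\<Sum>j\<in>J. \<integral>U. (cmod (f j U))\<^sup>2 \<partial>\<mu>)"
    unfolding G_def using intf by simp
  also have "\<dots> \<le> fact a / real (M - N) ^ a * (\<Sum>j\<in>J. (\<Prod>r\<in>S. fact (\<alpha> r) / real (M - N) ^ \<alpha> r) * (\<Sum>x\<in>X' j. (cmod (C x))\<^sup>2))"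
  proof (intro mult_mono sum_mono sum_nonneg)
    show "fact a / real (card T) ^ a \<le> fact a / real (M - N) ^ a"
      using cT' N by (intro divide_left_mono power_mono mult_pos_pos zero_less_power) auto
    fix j assume j: "j \<in> J"
    show "(\<integral>U. (cmod (f j U))\<^sup>2 \<partial>\<mu>) \<le> (\<Prod>r\<in>S. fact (\<alpha> r) / real (M - N) ^ \<alpha> r) * (\<Sum>x\<in>X' j. (cmod (C x))\<^sup>2)"
      unfolding f_def
    proof (rule insert.IH)
      fix x y assume "x \<in> X' j" "y \<in> X' j" "\<And>r. r \<in> S \<Longrightarrow> \<kappa> x r = \<kappa> y r"
      moreover from this have "\<kappa> x r' = \<kappa> y r'" if "r' \<in> insert r S" for r'
        using that unfolding X'_def by auto
      ultimately show "x = y" using insert.prems(5)[of x y] unfolding X'_def by blast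
    qed (use insert.prems insert.hyps in \<open>auto simp: X'_def\<close>)
  qed (auto intro!: Bochner_Integration.integral_nonneg)
  also have "\<dots> = (\<Prod>r\<in>insert r S. fact (\<alpha> r) / real (M - N) ^ \<alpha> r) * (\<Sum>j\<in>J. \<Sum>x\<in>X' j. (cmod (C x))\<^sup>2)"
    using insert.hyps by (simp add: sum_distrib_left[symmetric] a_def)
  also have "(\<Sum>j\<in>J. \<Sum>x\<in>X' j. (cmod (C x))\<^sup>2) = (\<Sum>x\<in>X. (cmod (C x))\<^sup>2)"
    unfolding J_def X'_def by (rule sum.image_gen[symmetric]) (use insert in auto)
  finally show ?case unfolding F_def .
qed

lemma prod_restrict_support:
  fixes h :: "nat \<Rightarrow> 'a::comm_monoid_mult" and g :: "nat \<Rightarrow> nat"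
  assumes "\<And>r. r < M \<Longrightarrow> g r = 0 \<Longrightarrow> h r = 1"
  shows "(\<Prod>r<M. h r) = (\<Prod>r\<in>{r. r < M \<and> g r \<noteq> 0}. h r)"
  using assms by (intro prod.mono_neutral_right) auto

text \<open>Diagonal phase matrices make the components of different row degrees orthogonal.\<close>
lemma haar_moment_rows:
  assumes h: "is_haar M \<mu>" and N: "N < M" and X: "finite X"
    and deg: "\<And>x. x \<in> X \<Longrightarrow> (\<Sum>r<M. length (\<kappa> x r)) = N"
    and cols: "\<And>x r. x \<in> X \<Longrightarrow> r < M \<Longrightarrow> set (\<kappa> x r) \<subseteq> {..<M}"
    and inj: "\<And>x y. x \<in> X \<Longrightarrow> y \<in> X \<Longrightarrow> (\<And>r. r < M \<Longrightarrow> \<kappa> x r = \<kappa> y r) \<Longrightarrow> x = y"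
  shows "(\<integral>U. (cmod (\<Sum>x\<in>X. C x * (\<Prod>r<M. \<Prod>s\<leftarrow>\<kappa> x r. U r s)))\<^sup>2 \<partial>\<mu>)
      \<le> (\<Sum>x\<in>X. (\<Prod>r<M. fact (length (\<kappa> x r))) / real (M - N) ^ N * (cmod (C x))\<^sup>2)"
proof -
  note hd = is_haarD[OF h]
  define \<alpha> where "\<alpha> = (\<lambda>x. restrict (\<lambda>r. length (\<kappa> x r)) {..<M})"
  define \<zeta> where "\<zeta> = cis (2 * pi / Suc N)"
  let ?E = "PiE {..<M} (\<lambda>_. {..<Suc N})"
  define Q where "Q = (\<lambda>e. mdiag M (\<lambda>r. \<zeta> ^ e r))"
  define X' where "X' = (\<lambda>g. {x \<in> X. \<alpha> x = g})"
  define f where "f = (\<lambda>g U. \<Sum>x\<in>X' g. C x * (\<Prod>r<M. \<Prod>s\<leftarrow>\<kappa> x r. U r s))"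
  define F where "F = (\<lambda>U. (cmod (\<Sum>x\<in>X. C x * (\<Prod>r<M. \<Prod>s\<leftarrow>\<kappa> x r. U r s)))\<^sup>2)"
  define G where "G = (\<lambda>U. \<Sum>g\<in>\<alpha> ` X. (cmod (f g U))\<^sup>2)"
  have intf: "integrable \<mu> (\<lambda>U. (cmod (f g U))\<^sup>2)" for g
    unfolding f_def by (rule bmeas_norm_square_integrable[OF hd(1) bmeas_row_poly[OF hd(2)] hd(3)])
  have intF: "integrable \<mu> F"
    unfolding F_def by (rule bmeas_norm_square_integrable[OF hd(1) bmeas_row_poly[OF hd(2)] hd(3)])
  have len: "length (\<kappa> x r) \<le> N" if "x \<in> X" "r < M" for x r
    using deg[OF that(1)] member_le_sum[of r "{..<M}" "\<lambda>r. length (\<kappa> x r)"] that by auto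
  have "(\<integral>U. F U \<partial>\<mu>) \<le> (\<integral>U. G U \<partial>\<mu>)"
  proof (rule haar_average_le[OF h, where E = ?E and Q = Q])
    show "finite ?E" "?E \<noteq> {}" by (auto intro: finite_PiE simp: PiE_eq_empty_iff)
    show "unitary_mat M (Q e)" for e
      unfolding Q_def by (rule unitary_mdiag) (simp add: \<zeta>_def norm_power)
    fix U assume U: "unitary_mat M U"
    have "F (mmul M (Q e) U) = (cmod (\<Sum>g\<in>\<alpha> ` X. f g U * (\<Prod>r<M. \<zeta> ^ (e r * g r))))\<^sup>2" for e
    proof -
      have p: "(\<Prod>s\<leftarrow>l. mmul M (Q e) U r s) = \<zeta> ^ (e r * length l) * (\<Prod>s\<leftarrow>l. U r s)"
        if "r < M" "set l \<subseteq> {..<M}" for r l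
        using that(2) by (induction l) (auto simp: Q_def mmul_mdiag that(1) power_add)
      have "(\<Sum>x\<in>X. C x * (\<Prod>r<M. \<Prod>s\<leftarrow>\<kappa> x r. mmul M (Q e) U r s)) =
          (\<Sum>x\<in>X. C x * (\<Prod>r<M. \<zeta> ^ (e r * \<alpha> x r) * (\<Prod>s\<leftarrow>\<kappa> x r. U r s)))"
        using p cols unfolding \<alpha>_def by (intro sum.cong refl arg_cong2[where f = times] prod.cong) auto
      also have "\<dots> = (\<Sum>x\<in>X. C x * (\<Prod>r<M. \<Prod>s\<leftarrow>\<kappa> x r. U r s) * (\<Prod>r<M. \<zeta> ^ (e r * \<alpha> x r)))"
        by (simp add: prod.distrib mult_ac)
      also have "\<dots> = (\<Sum>g\<in>\<alpha> ` X. \<Sum>x\<in>X' g. C x * (\<Prod>r<M. \<Prod>s\<leftarrow>\<kappa> x r. U r s) * (\<Prod>r<M. \<zeta> ^ (e r * \<alpha> x r)))"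
        unfolding X'_def by (rule sum.image_gen[OF X])
      also have "\<dots> = (\<Sum>g\<in>\<alpha> ` X. f g U * (\<Prod>r<M. \<zeta> ^ (e r * g r)))"
        unfolding f_def sum_distrib_right by (intro sum.cong refl) (auto simp: X'_def)
      finally show ?thesis unfolding F_def by simp
    qed
    then have "(\<Sum>e\<in>?E. F (mmul M (Q e) U)) =
        (\<Sum>e\<in>?E. (cmod (\<Sum>g\<in>\<alpha> ` X. f g U * (\<Prod>r<M. \<zeta> ^ (e r * g r))))\<^sup>2)" by simp
    also have "\<dots> = real (Suc N) ^ card {..<M} * G U"
      unfolding G_def \<zeta>_def
    proof (rule phase_average)
      show "g i < Suc N" if "g \<in> \<alpha> ` X" "i \<in> {..<M}" for g i
        using that len unfolding \<alpha>_def by (auto simp: less_Suc_eq_le)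
      fix g h assume "g \<in> \<alpha> ` X" "h \<in> \<alpha> ` X" "\<And>i. i \<in> {..<M} \<Longrightarrow> g i = h i"
      then show "g = h" unfolding \<alpha>_def by (auto simp: restrict_def fun_eq_iff)
    qed simp
    finally show "(\<Sum>e\<in>?E. F (mmul M (Q e) U)) \<le> card ?E * G U" by (simp add: card_PiE)
  qed (use intF intf in \<open>auto simp: G_def\<close>)
  also have "\<dots> = (\<Sum>g\<in>\<alpha> ` X. \<integral>U. (cmod (f g U))\<^sup>2 \<partial>\<mu>)" unfolding G_def using intf by simp
  also have "\<dots> \<le> (\<Sum>g\<in>\<alpha> ` X. \<Sum>x\<in>X' g. (\<Prod>r<M. fact (length (\<kappa> x r))) / real (M - N) ^ N * (cmod (C x))\<^sup>2)"
  proof (rule sum_mono)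
    fix g assume "g \<in> \<alpha> ` X"
    then obtain x0 where x0: "x0 \<in> X" "g = \<alpha> x0" by auto
    \<comment> \<open>Only rows of positive degree are peeled off. Their degrees sum to
      \<open>N\<close>, so there are at most \<open>N\<close> of them.\<close>
    define S where "S = {r. r < M \<and> g r \<noteq> 0}"
    have S: "finite S" "S \<subseteq> {..<M}" unfolding S_def by auto
    have gl: "length (\<kappa> x r) = g r" if "x \<in> X' g" "r < M" for x r
      using that unfolding X'_def \<alpha>_def by auto
    have gs: "(\<Sum>r<M. g r) = N" using deg[OF x0(1)] x0(2) unfolding \<alpha>_def by simp
    have "card S \<le> (\<Sum>r\<in>S. g r)"
      using S sum_mono[of S "\<lambda>_. 1" g] unfolding S_def by (auto simp: Suc_le_eq)
    also have "\<dots> \<le> N" unfolding gs[symmetric] using S by (intro sum_mono2) auto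
    finally have cS: "card S \<le> N" .
    note onS = prod_restrict_support[where g = g and M = M, folded S_def]
    have fS: "f g = (\<lambda>U. \<Sum>x\<in>X' g. C x * (\<Prod>r\<in>S. \<Prod>s\<leftarrow>\<kappa> x r. U r s))"
      unfolding f_def
    proof (intro ext sum.cong refl arg_cong2[where f = times] onS)
      fix x r and U :: cmat assume "x \<in> X' g" "r < M" "g r = 0"
      then have "\<kappa> x r = []" using gl[of x r] by simp
      then show "(\<Prod>s\<leftarrow>\<kappa> x r. U r s) = 1" by simp
    qed
    have "(\<integral>U. (cmod (f g U))\<^sup>2 \<partial>\<mu>) \<le> (\<Prod>r\<in>S. fact (g r) / real (M - N) ^ g r) * (\<Sum>x\<in>X' g. (cmod (C x))\<^sup>2)"
      unfolding fS
    proof (rule haar_moment_fixed_rows[OF h N S cS])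
      fix x y assume xy: "x \<in> X' g" "y \<in> X' g" "\<And>r. r \<in> S \<Longrightarrow> \<kappa> x r = \<kappa> y r"
      have "\<kappa> x r = \<kappa> y r" if "r < M" for r
        using xy(3)[of r] gl[OF xy(1) that] gl[OF xy(2) that] that unfolding S_def by (cases "g r = 0") auto
      then show "x = y" using xy inj unfolding X'_def by auto
    next
      fix x r assume "x \<in> X' g" "r \<in> S"
      then show "length (\<kappa> x r) = g r \<and> set (\<kappa> x r) \<subseteq> {..<M}"
        using gl[of x r] cols[of x r] S unfolding X'_def by blast
    qed (use X in \<open>auto simp: X'_def\<close>)
    also have "(\<Prod>r\<in>S. fact (g r) / real (M - N) ^ g r) = (\<Prod>r<M. fact (g r) / real (M - N) ^ g r)"
      by (rule onS[symmetric]) auto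
    also have "\<dots> = (\<Prod>r<M. fact (g r)) / real (M - N) ^ N"
      by (simp add: prod_dividef power_sum[symmetric] gs)
    also have "\<dots> * (\<Sum>x\<in>X' g. (cmod (C x))\<^sup>2) =
        (\<Sum>x\<in>X' g. (\<Prod>r<M. fact (length (\<kappa> x r))) / real (M - N) ^ N * (cmod (C x))\<^sup>2)"
      unfolding sum_distrib_left using gl
      by (intro sum.cong refl arg_cong2[where f = times] arg_cong2[where f = divide] prod.cong) auto
    finally show "(\<integral>U. (cmod (f g U))\<^sup>2 \<partial>\<mu>) \<le>
        (\<Sum>x\<in>X' g. (\<Prod>r<M. fact (length (\<kappa> x r))) / real (M - N) ^ N * (cmod (C x))\<^sup>2)" .
  qed
  also have "\<dots> = (\<Sum>x\<in>X. (\<Prod>r<M. fact (length (\<kappa> x r))) / real (M - N) ^ N * (cmod (C x))\<^sup>2)"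
    unfolding X'_def by (rule sum.image_gen[OF X, symmetric])
  finally show ?thesis unfolding F_def .
qed

section \<open>Monomials in the matrix entries as multisets of (row, column) pairs\<close>

definition monom_at :: "cmat \<Rightarrow> (nat \<times> nat) multiset \<Rightarrow> complex" where
  "monom_at U g = (\<Prod>e\<in>#g. U (fst e) (snd e))"

definition row_deg :: "(nat \<times> nat) multiset \<Rightarrow> nat \<Rightarrow> nat" where
  "row_deg g r = size {#e \<in># g. fst e = r#}"

lemma monom_at_simps [simp]:
  "monom_at U {#} = 1" "monom_at U (add_mset e g) = U (fst e) (snd e) * monom_at U g"
  "monom_at U (g + h) = monom_at U g * monom_at U h"
  unfolding monom_at_def by auto

lemma monom_at_rows:
  assumes "\<And>e. e \<in># g \<Longrightarrow> fst e < M"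
  shows "monom_at U g = (\<Prod>r<M. \<Prod>e\<in>#{#e \<in># g. fst e = r#}. U r (snd e))"
  using assms
proof (induction g)
  case (add e g)
  have "(\<Prod>r<M. \<Prod>e\<in>#{#x \<in># add_mset e g. fst x = r#}. U r (snd e)) =
     (\<Prod>r<M. (if r = fst e then U (fst e) (snd e) else 1) * (\<Prod>e\<in>#{#x \<in># g. fst x = r#}. U r (snd e)))"
    by (intro prod.cong refl) auto
  then show ?case unfolding prod.distrib using add by simp
qed simp

lemma size_rows:
  fixes g :: "(nat \<times> nat) multiset"
  assumes "\<And>e. e \<in># g \<Longrightarrow> fst e < M"
  shows "(\<Sum>r<M. row_deg g r) = size g"
  using assms
proof (induction g)
  case (add e g)
  have "(\<Sum>r<M. row_deg (add_mset e g) r) = (\<Sum>r<M. (if r = fst e then 1 else 0) + row_deg g r)"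
    by (intro sum.cong refl) (auto simp: row_deg_def)
  then show ?case unfolding sum.distrib using add by simp
qed (simp add: row_deg_def)

lemma haar_moment_le:
  assumes h: "is_haar M \<mu>" and N: "N < M" and G: "finite G"
    and g: "\<And>g. g \<in> G \<Longrightarrow> size g = N \<and> set_mset g \<subseteq> {..<M} \<times> {..<M}"
  shows "(\<integral>U. (cmod (\<Sum>g\<in>G. C g * monom_at U g))\<^sup>2 \<partial>\<mu>)
     \<le> (\<Sum>g\<in>G. (\<Prod>r<M. fact (row_deg g r)) / real (M - N) ^ N * (cmod (C g))\<^sup>2)"
proof -
  \<comment> \<open>Sorting picks one column word per row, so that distinct multisets have distinct
    families of words.\<close>
  define \<kappa> where "\<kappa> = (\<lambda>(g :: (nat \<times> nat) multiset) r. sorted_list_of_multiset (image_mset snd {#e \<in># g. fst e = r#}))"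
  have len: "length (\<kappa> g r) = row_deg g r" for g :: "(nat \<times> nat) multiset" and r
    unfolding \<kappa>_def row_deg_def by (metis mset_sorted_list_of_multiset size_image_mset size_mset)
  have gM: "fst e < M" if "g \<in> G" "e \<in># g" for g e using assms(4)[OF that(1)] that(2) by auto
  have m: "monom_at U h = (\<Prod>r<M. \<Prod>s\<leftarrow>\<kappa> h r. U r s)" if "h \<in> G" for U h
  proof -
    have "(\<Prod>s\<leftarrow>\<kappa> h r. U r s) = (\<Prod>e\<in>#{#e \<in># h. fst e = r#}. U r (snd e))" for r
    proof -
      have "(\<Prod>s\<leftarrow>\<kappa> h r. U r s) = (\<Prod>s\<in>#mset (\<kappa> h r). U r s)"
        by (metis mset_map prod_mset_prod_list)
      then show ?thesis unfolding \<kappa>_def by (simp add: image_mset.compositionality comp_def)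
    qed
    then show ?thesis using monom_at_rows[of h M U] gM[OF that] by simp
  qed
  have "(\<integral>U. (cmod (\<Sum>g\<in>G. C g * (\<Prod>r<M. \<Prod>s\<leftarrow>\<kappa> g r. U r s)))\<^sup>2 \<partial>\<mu>)
      \<le> (\<Sum>g\<in>G. (\<Prod>r<M. fact (length (\<kappa> g r))) / real (M - N) ^ N * (cmod (C g))\<^sup>2)"
  proof (rule haar_moment_rows[OF h N G])
    show "(\<Sum>r<M. length (\<kappa> x r)) = N" if "x \<in> G" for x
      unfolding len using size_rows[of x M] gM[OF that] g[OF that] by simp
    show "set (\<kappa> x r) \<subseteq> {..<M}" if "x \<in> G" "r < M" for x r
      using g[OF that(1)] unfolding \<kappa>_def by auto
    fix x y :: "(nat \<times> nat) multiset" assume xy: "x \<in> G" "y \<in> G" "\<And>r. r < M \<Longrightarrow> \<kappa> x r = \<kappa> y r"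
    show "x = y"
    proof (rule multiset_eqI)
      fix e :: "nat \<times> nat"
      have c: "count x (r, s) = count (image_mset snd {#e \<in># x. fst e = r#}) s" for x :: "(nat \<times> nat) multiset" and r s
        by (induction x) auto
      show "count x e = count y e"
      proof (cases "fst e < M")
        case True
        then have "mset (\<kappa> x (fst e)) = mset (\<kappa> y (fst e))" using xy(3) by simp
        then show ?thesis using c[of x "fst e" "snd e"] c[of y "fst e" "snd e"] unfolding \<kappa>_def by simp
      next
        case False
        then have "e \<notin># x" "e \<notin># y" using gM[OF xy(1)] gM[OF xy(2)] by blast+
        then show ?thesis by (simp add: not_in_iff)
      qed
    qed
  qed
  then show ?thesis unfolding len using m by (simp cong: sum.cong)
qed

subsection \<open>Paths\<close>

text \<open>The matrix element of the circuit from \<open>i\<close> with all B systems in state 0 to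
  \<open>a\<close> with output word \<open>bs\<close>. The columns are multiples of \<open>d\<close>
  because every B system enters in state 0. The head of \<open>bs\<close> belongs to the leftmost
  factor, the one that acts last.\<close>

fun amp :: "nat \<Rightarrow> nat \<Rightarrow> cmat \<Rightarrow> nat \<Rightarrow> nat list \<Rightarrow> nat \<Rightarrow> complex" where
  "amp D d U a [] i = (if a = i then 1 else 0)"
| "amp D d U a (b # bs) i = (\<Sum>c<D. U (a * d + b) (c * d) * amp D d U c bs i)"

text \<open>A step from \<open>v\<close> to \<open>w\<close> with output letter \<open>b\<close>
  uses the entry in row \<open>v * d + b\<close> and column \<open>w * d\<close>. Division of the
  row index by \<open>d\<close> recovers the vertex \<open>v\<close>; the final vertex of a path is
  the source of no edge.\<close>

fun path_edges :: "nat \<Rightarrow> nat list \<Rightarrow> nat list \<Rightarrow> (nat \<times> nat) multiset" where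
  "path_edges d (v # w # vs) (b # bs) = add_mset (v * d + b, w * d) (path_edges d (w # vs) bs)"
| "path_edges d _ _ = {#}"

definition paths :: "nat \<Rightarrow> nat \<Rightarrow> nat \<Rightarrow> nat \<Rightarrow> nat list set" where
  "paths D n a i = {vs. length vs = Suc n \<and> set vs \<subseteq> {..<D} \<and> hd vs = a \<and> last vs = i}"

lemma finite_paths [simp, intro]: "finite (paths D n a i)"
  by (rule finite_subset[OF _ finite_seqs[of "{..<D}" "Suc n"]]) (auto simp: paths_def seqs_def)

lemma paths_0: "a < D \<Longrightarrow> paths D 0 a i = (if a = i then {[a]} else {})"
  unfolding paths_def by (auto simp: length_Suc_conv)

lemma sum_paths_Suc:
  assumes "a < D"
  shows "(\<Sum>vs\<in>paths D (Suc n) a i. f vs) = (\<Sum>c<D. \<Sum>vs\<in>paths D n c i. f (a # vs))"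
proof -
  have b: "bij_betw (\<lambda>(c, vs). a # vs) (SIGMA c:{..<D}. paths D n c i) (paths D (Suc n) a i)"
    by (rule bij_betw_byWitness[where f' = "\<lambda>vs. (hd (tl vs), tl vs)"])
       (use assms in \<open>auto simp: paths_def length_Suc_conv split: if_splits\<close>)
  have "(\<Sum>vs\<in>paths D (Suc n) a i. f vs) = (\<Sum>(c, vs)\<in>(SIGMA c:{..<D}. paths D n c i). f (a # vs))"
    using sum.reindex_bij_betw[OF b, of f] by (simp add: case_prod_beta)
  then show ?thesis by (simp add: sum.Sigma)
qed

lemma path_edges_Cons:
  assumes "vs \<in> paths D n c i"
  shows "path_edges d (a # vs) (b # bs) = add_mset (a * d + b, c * d) (path_edges d vs bs)"
  using assms unfolding paths_def by (cases vs) auto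

lemma amp_eq_sum_paths:
  "a < D \<Longrightarrow> amp D d U a bs i = (\<Sum>vs\<in>paths D (length bs) a i. monom_at U (path_edges d vs bs))"
proof (induction bs arbitrary: a)
  case Nil
  then show ?case by (simp add: paths_0)
next
  case (Cons b bs)
  have "(\<Sum>vs\<in>paths D (length (b # bs)) a i. monom_at U (path_edges d vs (b # bs))) =
     (\<Sum>c<D. \<Sum>vs\<in>paths D (length bs) c i. monom_at U (path_edges d (a # vs) (b # bs)))"
    using Cons.prems by (simp add: sum_paths_Suc)
  also have "\<dots> = (\<Sum>c<D. \<Sum>vs\<in>paths D (length bs) c i. U (a * d + b) (c * d) * monom_at U (path_edges d vs bs))"
    by (intro sum.cong refl) (simp add: path_edges_Cons)
  also have "\<dots> = amp D d U a (b # bs) i"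
    using Cons.IH by (simp add: sum_distrib_left[symmetric])
  finally show ?case by simp
qed

lemma size_path_edges: "length vs = Suc (length bs) \<Longrightarrow> size (path_edges d vs bs) = length bs"
  by (induction d vs bs rule: path_edges.induct) auto

lemma index_less: "a < (D::nat) \<Longrightarrow> b < d \<Longrightarrow> a * d + b < D * d"
proof -
  assume "a < D" "b < d"
  then have "a * d + b < Suc a * d" by simp
  also have "\<dots> \<le> D * d" using \<open>a < D\<close> by (intro mult_le_mono1) simp
  finally show ?thesis .
qed

lemma path_edges_subset:
  "length vs = Suc (length bs) \<Longrightarrow> set vs \<subseteq> {..<D} \<Longrightarrow> set bs \<subseteq> {..<d} \<Longrightarrow>
    set_mset (path_edges d vs bs) \<subseteq> {..<D * d} \<times> {..<D * d}"
proof (induction d vs bs rule: path_edges.induct)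
  case (1 d v w vs b bs)
  then show ?case using index_less[of v D b d] index_less[of w D 0 d] by auto
qed auto

lemma path_edges_vertices:
  "length vs = Suc (length bs) \<Longrightarrow> set bs \<subseteq> {..<d} \<Longrightarrow>
    image_mset (\<lambda>e. fst e div d) (path_edges d vs bs) = mset (butlast vs)"
  by (induction d vs bs rule: path_edges.induct) (auto simp: length_Suc_conv)

definition vert_deg :: "nat \<Rightarrow> (nat \<times> nat) multiset \<Rightarrow> nat \<Rightarrow> nat" where
  "vert_deg d g v = count (image_mset (\<lambda>e. fst e div d) g) v"

lemma vert_deg_add_mset:
  "vert_deg d (add_mset e g) v = (if fst e div d = v then 1 else 0) + vert_deg d g v"
  unfolding vert_deg_def by auto

text \<open>This plays two roles: it dominates the row factorials of the Haar moment bound, and it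
  bounds the number of path pairs with a given monomial. Unlike the row factorials it depends only
  on the vertices visited, not on the output letters.\<close>

definition fact_prod :: "nat \<Rightarrow> nat \<Rightarrow> (nat \<times> nat) multiset \<Rightarrow> nat" where
  "fact_prod D d g = (\<Prod>v<D. fact (vert_deg d g v))"

lemma fact_prod_pos: "0 < fact_prod D d g"
  unfolding fact_prod_def by (simp add: prod_pos)

lemma fact_prod_add_mset:
  assumes "fst e div d = v" "v < D"
  shows "fact_prod D d (add_mset e g) = vert_deg d (add_mset e g) v * fact_prod D d g"
proof -
  have "fact_prod D d (add_mset e g) = (\<Prod>u<D. (if u = v then vert_deg d (add_mset e g) v else 1) * fact (vert_deg d g u))"
    unfolding fact_prod_def by (intro prod.cong refl) (use assms in \<open>auto simp: vert_deg_add_mset\<close>)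
  then show ?thesis unfolding prod.distrib fact_prod_def using assms by simp
qed

text \<open>Choosing the edges of a path one after the other, there are at most \<open>vert_deg d g v\<close> ways to
  leave \<open>v\<close>, and each step uses up one of them.\<close>
lemma card_paths_le:
  assumes d: "0 < d" and R: "\<And>g. finite (R g)" "\<And>g. card (R g) \<le> fact_prod D d g"
  shows "a < D \<Longrightarrow> set bs \<subseteq> {..<d} \<Longrightarrow>
    card {(vs, y). vs \<in> paths D (length bs) a i \<and> path_edges d vs bs \<subseteq># g \<and> y \<in> R (g - path_edges d vs bs)}
      \<le> fact_prod D d g"
proof (induction bs arbitrary: a g)
  case Nil
  have "{(vs, y). vs \<in> paths D (length []) a i \<and> path_edges d vs [] \<subseteq># g \<and> y \<in> R (g - path_edges d vs [])}
      \<subseteq> {[a]} \<times> R g"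
    using Nil by (auto simp: paths_0 split: if_splits)
  then have "card {(vs, y). vs \<in> paths D (length []) a i \<and> path_edges d vs [] \<subseteq># g \<and> y \<in> R (g - path_edges d vs [])}
      \<le> card ({[a]} \<times> R g)"
    by (rule card_mono[rotated]) (use R in auto)
  also have "\<dots> \<le> fact_prod D d g" using R(2)[of g] by (simp add: card_cartesian_product)
  finally show ?case .
next
  case (Cons b bs)
  define S where "S = (\<lambda>c g. {(vs, y). vs \<in> paths D (length bs) c i \<and> path_edges d vs bs \<subseteq># g \<and> y \<in> R (g - path_edges d vs bs)})"
  define e where "e = (\<lambda>c. (a * d + b, c * d))"
  define Cs where "Cs = {c. c < D \<and> e c \<in># g}"
  have fin: "finite (S c g)" for c g
  proof (rule finite_subset)
    show "S c g \<subseteq> (SIGMA vs:paths D (length bs) c i. R (g - path_edges d vs bs))" unfolding S_def by auto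
  qed (use R in auto)
  have ea: "fst (e c) div d = a" for c using Cons.prems d unfolding e_def by simp
  have "{(vs, y). vs \<in> paths D (length (b # bs)) a i \<and> path_edges d vs (b # bs) \<subseteq># g \<and> y \<in> R (g - path_edges d vs (b # bs))}
     \<subseteq> (\<Union>c\<in>Cs. (\<lambda>(vs, y). (a # vs, y)) ` S c (g - {#e c#}))"
  proof clarify
    fix vs y assume vs: "vs \<in> paths D (length (b # bs)) a i" and sub: "path_edges d vs (b # bs) \<subseteq># g"
      and y: "y \<in> R (g - path_edges d vs (b # bs))"
    then obtain w ws where w: "vs = a # w # ws" unfolding paths_def by (auto simp: length_Suc_conv)
    have pe: "path_edges d vs (b # bs) = add_mset (e w) (path_edges d (w # ws) bs)" unfolding w e_def by simp
    have "w \<in> Cs" using vs sub pe unfolding Cs_def w paths_def by (auto dest: mset_subset_eqD)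
    moreover have "(w # ws, y) \<in> S w (g - {#e w#})"
      using vs sub y pe unfolding S_def w paths_def
      by (auto simp: insert_subset_eq_iff split: if_splits)
    ultimately show "(vs, y) \<in> (\<Union>c\<in>Cs. (\<lambda>(vs, y). (a # vs, y)) ` S c (g - {#e c#}))" unfolding w by force
  qed
  then have "card {(vs, y). vs \<in> paths D (length (b # bs)) a i \<and> path_edges d vs (b # bs) \<subseteq># g \<and> y \<in> R (g - path_edges d vs (b # bs))}
      \<le> card (\<Union>c\<in>Cs. (\<lambda>(vs, y). (a # vs, y)) ` S c (g - {#e c#}))"
    by (intro card_mono) (auto simp: Cs_def fin)
  also have "\<dots> \<le> (\<Sum>c\<in>Cs. card ((\<lambda>(vs, y). (a # vs, y)) ` S c (g - {#e c#})))"
    by (rule card_UN_le) (auto simp: Cs_def)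
  also have "\<dots> \<le> (\<Sum>c\<in>Cs. fact_prod D d (g - {#e c#}))"
  proof (rule sum_mono)
    fix c assume "c \<in> Cs"
    then have "card (S c (g - {#e c#})) \<le> fact_prod D d (g - {#e c#})"
      using Cons.prems unfolding S_def Cs_def by (intro Cons.IH) auto
    then show "card ((\<lambda>(vs, y). (a # vs, y)) ` S c (g - {#e c#})) \<le> fact_prod D d (g - {#e c#})"
      using card_image_le[OF fin] order_trans by blast
  qed
  finally have le: "card {(vs, y). vs \<in> paths D (length (b # bs)) a i \<and> path_edges d vs (b # bs) \<subseteq># g \<and> y \<in> R (g - path_edges d vs (b # bs))}
     \<le> (\<Sum>c\<in>Cs. fact_prod D d (g - {#e c#}))" .
  have fp: "fact_prod D d g = vert_deg d g a * fact_prod D d (g - {#e c#})" if "c \<in> Cs" for c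
    using fact_prod_add_mset[OF ea[of c] Cons.prems(1), of "g - {#e c#}"] that unfolding Cs_def by simp
  have cC: "card Cs \<le> vert_deg d g a"
  proof -
    have "inj_on e Cs" unfolding e_def using d by (auto intro: inj_onI)
    then have "card Cs = card (e ` Cs)" by (simp add: card_image)
    also have "\<dots> \<le> card (set_mset {#x \<in># g. fst x div d = a#})"
      by (rule card_mono) (auto simp: Cs_def ea)
    also have "\<dots> \<le> size {#x \<in># g. fst x div d = a#}" 
      by (metis size_mset_set mset_set_set_mset_msubset size_mset_mono)
    also have "\<dots> = vert_deg d g a" unfolding vert_deg_def by (induction g) auto
    finally show ?thesis .
  qed
  have "(\<Sum>c\<in>Cs. fact_prod D d (g - {#e c#})) \<le> fact_prod D d g"
  proof (cases "Cs = {}")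
    case False
    then obtain c0 where c0: "c0 \<in> Cs" by auto
    have pos: "0 < vert_deg d g a" using fp[OF c0] fact_prod_pos[of D d g] by (auto intro: Nat.gr0I)
    \<comment> \<open>Each edge leaving \<open>a\<close> lowers the same factorial, so all summands
      agree; their number is at most the out-degree that \<open>fp\<close> restores.\<close>
    have "fact_prod D d (g - {#e c#}) = fact_prod D d (g - {#e c0#})" if "c \<in> Cs" for c
      using fp[OF that] fp[OF c0] pos by simp
    then have "(\<Sum>c\<in>Cs. fact_prod D d (g - {#e c#})) = card Cs * fact_prod D d (g - {#e c0#})" by simp
    also have "\<dots> \<le> fact_prod D d g" unfolding fp[OF c0] by (rule mult_le_mono1[OF cC])
    finally show ?thesis .
  qed (simp)
  with le show ?case by (rule order_trans)
qed

section \<open>Pairs of paths with a common monomial\<close>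

definition path_pairs :: "nat \<Rightarrow> nat \<Rightarrow> nat \<Rightarrow> nat \<Rightarrow> nat \<Rightarrow> nat \<Rightarrow> (nat list \<times> nat list) set" where
  "path_pairs D n a a' i i' = paths D n a i \<times> paths D n a' i'"

definition pair_edges :: "nat \<Rightarrow> nat list \<times> nat list \<Rightarrow> nat list \<times> nat list \<Rightarrow> (nat \<times> nat) multiset" where
  "pair_edges d \<beta> z = path_edges d (fst z) (fst \<beta>) + path_edges d (snd z) (snd \<beta>)"

definition pair_count :: "nat \<Rightarrow> nat \<Rightarrow> nat \<Rightarrow> nat \<Rightarrow> nat \<Rightarrow> nat \<Rightarrow> nat \<Rightarrow> nat list \<times> nat list \<Rightarrow> (nat \<times> nat) multiset \<Rightarrow> nat" where
  "pair_count D d n a a' i i' \<beta> g = card {z \<in> path_pairs D n a a' i i'. pair_edges d \<beta> z = g}"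

lemma pair_count_le:
  assumes d: "0 < d" and a: "a < D" "a' < D" and \<beta>: "\<beta> \<in> seqs {..<d} n \<times> seqs {..<d} n"
  shows "pair_count D d n a a' i i' \<beta> g \<le> fact_prod D d g"
proof -
  obtain bs bs' where b: "\<beta> = (bs, bs')" "length bs = n" "length bs' = n" "set bs \<subseteq> {..<d}" "set bs' \<subseteq> {..<d}"
    using \<beta> unfolding seqs_def by auto
  \<comment> \<open>The counting bound is applied twice. \<open>R\<close> collects the second paths
    that use up exactly the edges left by the first one, and \<open>R0\<close> demands that nothing
    is left after the second.\<close>
  define R where "R = (\<lambda>g. {vs. vs \<in> paths D n a' i' \<and> path_edges d vs bs' = g})"
  define R0 where "R0 = (\<lambda>g :: (nat \<times> nat) multiset. if g = {#} then {()} else {})"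
  have "card (R0 g) \<le> fact_prod D d g" for g
    using fact_prod_pos[of D d g] unfolding R0_def by auto
  then have c0: "card {(vs, y). vs \<in> paths D (length bs') a' i' \<and> path_edges d vs bs' \<subseteq># g \<and> y \<in> R0 (g - path_edges d vs bs')}
     \<le> fact_prod D d g" for g
    by (intro card_paths_le d a b) (auto simp: R0_def)
  have Rc: "card (R g) \<le> fact_prod D d g" for g
  proof -
    have "R g = fst ` {(vs, y). vs \<in> paths D (length bs') a' i' \<and> path_edges d vs bs' \<subseteq># g \<and> y \<in> R0 (g - path_edges d vs bs')}"
      (is "_ = fst ` ?A") unfolding R_def R0_def b by (force simp: Diff_eq_empty_iff_mset intro: subset_mset.antisym split: if_splits)
    moreover have "finite ?A"
      by (rule finite_subset[of _ "paths D (length bs') a' i' \<times> UNIV"]) auto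
    ultimately show ?thesis using card_image_le[of ?A fst] c0[of g] by simp
  qed
  have "{z \<in> path_pairs D n a a' i i'. pair_edges d \<beta> z = g} =
     {(vs, y). vs \<in> paths D (length bs) a i \<and> path_edges d vs bs \<subseteq># g \<and> y \<in> R (g - path_edges d vs bs)}"
    unfolding path_pairs_def pair_edges_def R_def b by (auto simp: subset_mset.add_diff_inverse)
  moreover have "card {(vs, y). vs \<in> paths D (length bs) a i \<and> path_edges d vs bs \<subseteq># g \<and> y \<in> R (g - path_edges d vs bs)} \<le> fact_prod D d g"
    by (intro card_paths_le d a b Rc) (auto simp: R_def)
  ultimately show ?thesis unfolding pair_count_def by simp
qed

definition pair_verts :: "nat list \<times> nat list \<Rightarrow> nat list" where
  "pair_verts z = butlast (fst z) @ butlast (snd z)"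

lemma pair_edges_vertices:
  assumes "\<beta> \<in> seqs {..<d} n \<times> seqs {..<d} n" "z \<in> path_pairs D n a a' i i'"
  shows "image_mset (\<lambda>e. fst e div d) (pair_edges d \<beta> z) = mset (pair_verts z)"
  using assms path_edges_vertices[of "fst z" "fst \<beta>" d] path_edges_vertices[of "snd z" "snd \<beta>" d]
  unfolding pair_edges_def pair_verts_def path_pairs_def paths_def seqs_def by auto

text \<open>If \<open>g\<close> has at most one edge out of each vertex, a walk inside
  \<open>g\<close> is determined by its start: every step and every output letter is read off from
  the unique edge available.\<close>

lemma path_edges_rigid:
  assumes g: "\<And>e e'. e \<in># g \<Longrightarrow> e' \<in># g \<Longrightarrow> fst e div d = fst e' div d \<Longrightarrow> e = e'"
  shows "length vs = Suc (length bs) \<Longrightarrow> length ws = Suc (length cs) \<Longrightarrow> length bs = length cs \<Longrightarrow>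
    set bs \<subseteq> {..<d} \<Longrightarrow> set cs \<subseteq> {..<d} \<Longrightarrow> hd vs = hd ws \<Longrightarrow>
    set_mset (path_edges d vs bs) \<subseteq> set_mset g \<Longrightarrow> set_mset (path_edges d ws cs) \<subseteq> set_mset g \<Longrightarrow>
    vs = ws \<and> bs = cs"
proof (induction bs arbitrary: vs ws cs)
  case Nil
  then show ?case by (auto simp: length_Suc_conv)
next
  case (Cons b bs)
  obtain c cs' where cs: "cs = c # cs'" using Cons.prems by (cases cs) auto
  obtain v w vs' where vs: "vs = v # w # vs'" using Cons.prems by (auto simp: length_Suc_conv)
  obtain x ws' where ws: "ws = v # x # ws'" using Cons.prems unfolding vs cs by (auto simp: length_Suc_conv)
  have "(v * d + b, w * d) = (v * d + c, x * d)"
    by (rule g) (use Cons.prems in \<open>auto simp: vs ws cs\<close>)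
  moreover have "0 < d" using Cons.prems by auto
  ultimately have "b = c" "w = x" by auto
  moreover have "w # vs' = x # ws' \<and> bs = cs'"
    by (rule Cons.IH) (use Cons.prems \<open>w = x\<close> in \<open>auto simp: vs ws cs\<close>)
  ultimately show ?case unfolding vs ws cs by simp
qed

text \<open>Distinct source vertices make the edge out of each vertex unique, across both paths at
  once. The final vertices may repeat earlier ones, since no edge leaves from them. The output words
  are recovered as well, so different pairs of words share no such monomial.\<close>

lemma pair_edges_rigid:
  assumes \<beta>: "\<beta> \<in> seqs {..<d} n \<times> seqs {..<d} n" and \<beta>': "\<beta>' \<in> seqs {..<d} n \<times> seqs {..<d} n"
    and z: "z \<in> path_pairs D n a a' i i'" and y: "y \<in> path_pairs D n a a' i i'"
    and dist: "distinct (pair_verts z)" and eq: "pair_edges d \<beta>' y = pair_edges d \<beta> z"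
  shows "y = z \<and> \<beta>' = \<beta>"
proof -
  define g where "g = pair_edges d \<beta> z"
  have inj: "e = e'" if e: "e \<in># g" "e' \<in># g" "fst e div d = fst e' div d" for e e'
  proof (rule ccontr)
    assume ne: "e \<noteq> e'"
    obtain h where h: "g = add_mset e h" using multi_member_split[OF e(1)] by blast
    have eh: "e' \<in># h" using e(2) ne unfolding h by simp
    obtain h' where h': "h = add_mset e' h'" using multi_member_split[OF eh] by blast
    have "2 \<le> count (image_mset (\<lambda>e. fst e div d) g) (fst e div d)"
      unfolding h h' image_mset_add_mset e(3) by simp
    moreover have "count (mset (pair_verts z)) (fst e div d) \<le> 1"
      using dist unfolding distinct_count_atmost_1 by (metis le_refl zero_le_one)
    ultimately show False unfolding g_def pair_edges_vertices[OF \<beta> z] by simp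
  qed
  have g1: "set_mset (path_edges d (fst z) (fst \<beta>)) \<subseteq> set_mset g" "set_mset (path_edges d (snd z) (snd \<beta>)) \<subseteq> set_mset g"
    unfolding g_def pair_edges_def by auto
  have g2: "set_mset (path_edges d (fst y) (fst \<beta>')) \<subseteq> set_mset g" "set_mset (path_edges d (snd y) (snd \<beta>')) \<subseteq> set_mset g"
    unfolding trans[OF g_def eq[symmetric]] unfolding pair_edges_def by auto
  have "fst y = fst z \<and> fst \<beta>' = fst \<beta>"
    by (rule path_edges_rigid[OF inj _ _ _ _ _ _ g2(1) g1(1)])
       (use \<beta> \<beta>' z y in \<open>auto simp: path_pairs_def paths_def seqs_def\<close>)
  moreover have "snd y = snd z \<and> snd \<beta>' = snd \<beta>"
    by (rule path_edges_rigid[OF inj _ _ _ _ _ _ g2(2) g1(2)])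
       (use \<beta> \<beta>' z y in \<open>auto simp: path_pairs_def paths_def seqs_def\<close>)
  ultimately show ?thesis by (simp add: prod_eq_iff)
qed

section \<open>Factorial weights: from rows to vertices to words\<close>

lemma prod_fact_le_fact_sum: "finite A \<Longrightarrow> (\<Prod>x\<in>A. fact (f x) :: nat) \<le> fact (\<Sum>x\<in>A. f x)"
proof (induction A rule: finite_induct)
  case (insert x A)
  have "fact (f x) * fact (\<Sum>x\<in>A. f x) \<le> (fact (f x + (\<Sum>x\<in>A. f x)) :: nat)"
    by (rule dvd_imp_le[OF fact_fact_dvd_fact]) simp
  moreover have "fact (f x) * (\<Prod>x\<in>A. fact (f x)) \<le> fact (f x) * (fact (\<Sum>x\<in>A. f x) :: nat)"
    using insert by simp
  ultimately have "fact (f x) * (\<Prod>x\<in>A. fact (f x)) \<le> (fact (f x + (\<Sum>x\<in>A. f x)) :: nat)"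
    by (meson order_trans)
  then show ?case using insert by simp
qed simp

text \<open>The \<open>d\<close> rows from \<open>v * d\<close> on all belong to the vertex
  \<open>v\<close> and their degrees add up to its out-degree; a product of factorials is at most
  the factorial of the sum.\<close>

lemma row_fact_le:
  assumes d: "0 < d"
  shows "(\<Prod>r<D * d. fact (row_deg g r) :: nat) \<le> fact_prod D d g"
proof -
  have s: "(\<Sum>r\<in>{v * d..<v * d + d}. row_deg g r) = vert_deg d g v" for v
  proof (induction g)
    case (add e g)
    have "row_deg (add_mset e g) r = (if r = fst e then 1 else 0) + row_deg g r" for r
      unfolding row_deg_def by auto
    moreover have "fst e \<in> {v * d..<v * d + d} \<longleftrightarrow> fst e div d = v"
    proof
      assume "fst e div d = v"
      moreover have "fst e = fst e div d * d + fst e mod d" by simp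
      moreover have "fst e mod d < d" using d by simp
      ultimately show "fst e \<in> {v * d..<v * d + d}" by auto
    qed (auto intro!: div_nat_eqI simp: mult.commute)
    ultimately show ?case using add by (simp add: sum.distrib vert_deg_add_mset)
  qed (simp add: row_deg_def vert_deg_def)
  have "(\<Prod>r<D * d. fact (row_deg g r) :: nat) = (\<Prod>v<D. \<Prod>r\<in>{v * d..<v * d + d}. fact (row_deg g r))"
    by (rule prod.nat_group[symmetric])
  also have "\<dots> \<le> (\<Prod>v<D. fact (\<Sum>r\<in>{v * d..<v * d + d}. row_deg g r))"
    by (intro prod_mono conjI prod_fact_le_fact_sum) (auto simp: prod_nonneg)
  finally show ?thesis unfolding s fact_prod_def .
qed

text \<open>With the end fixed and the start summed over, \<open>butlast\<close> is a bijection from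
  the paths onto all words of length \<open>n\<close>.\<close>

lemma sum_all_paths:
  "i < D \<Longrightarrow> (\<Sum>a<D. \<Sum>vs\<in>paths D n a i. f (butlast vs)) = (\<Sum>as\<in>seqs {..<D} n. f as)"
proof (induction n arbitrary: f)
  case 0
  have "(\<Sum>a<D. \<Sum>vs\<in>paths D 0 a i. f (butlast vs)) = (\<Sum>a<D. if a = i then f [] else 0)"
    by (intro sum.cong refl) (auto simp: paths_0)
  then show ?case using 0 by simp
next
  case (Suc n)
  have "(\<Sum>a<D. \<Sum>vs\<in>paths D (Suc n) a i. f (butlast vs)) =
      (\<Sum>a<D. \<Sum>c<D. \<Sum>vs\<in>paths D n c i. f (butlast (a # vs)))"
    by (intro sum.cong refl) (simp add: sum_paths_Suc)
  also have "\<dots> = (\<Sum>a<D. \<Sum>c<D. \<Sum>vs\<in>paths D n c i. f (a # butlast vs))"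
    by (intro sum.cong refl) (auto simp: paths_def)
  also have "\<dots> = (\<Sum>a<D. \<Sum>as\<in>seqs {..<D} n. f (a # as))"
    using Suc.IH[of "\<lambda>as. f (x # as)" for x] Suc.prems by simp
  finally show ?case by (simp add: sum_seqs_Suc)
qed

lemma sum_seqs_append:
  "(\<Sum>xs\<in>seqs A n. \<Sum>ys\<in>seqs A m. f (xs @ ys)) = (\<Sum>zs\<in>seqs A (n + m). f zs)"
proof (induction n arbitrary: f)
  case (Suc n)
  show ?case using Suc[of "\<lambda>zs. f (x # zs)" for x] by (simp add: sum_seqs_Suc)
qed simp

lemma sum_all_path_pairs:
  assumes "i < D" "i' < D"
  shows "(\<Sum>a<D. \<Sum>a'<D. \<Sum>z\<in>path_pairs D n a a' i i'. f (pair_verts z)) = (\<Sum>as\<in>seqs {..<D} (2 * n). f as)"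
proof -
  have "(\<Sum>a<D. \<Sum>a'<D. \<Sum>z\<in>path_pairs D n a a' i i'. f (pair_verts z)) =
      (\<Sum>a<D. \<Sum>a'<D. \<Sum>vs\<in>paths D n a i. \<Sum>ws\<in>paths D n a' i'. f (butlast vs @ butlast ws))"
    unfolding path_pairs_def pair_verts_def by (simp add: sum.cartesian_product case_prod_beta)
  also have "\<dots> = (\<Sum>a<D. \<Sum>vs\<in>paths D n a i. \<Sum>a'<D. \<Sum>ws\<in>paths D n a' i'. f (butlast vs @ butlast ws))"
    by (rule sum.cong[OF refl], rule sum.swap)
  also have "\<dots> = (\<Sum>a<D. \<Sum>vs\<in>paths D n a i. \<Sum>ys\<in>seqs {..<D} n. f (butlast vs @ ys))"
    by (simp add: sum_all_paths[OF assms(2), where f = "\<lambda>ys. f (x @ ys)" for x])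
  also have "\<dots> = (\<Sum>xs\<in>seqs {..<D} n. \<Sum>ys\<in>seqs {..<D} n. f (xs @ ys))"
    by (rule sum_all_paths[OF assms(1)])
  finally show ?thesis by (simp add: sum_seqs_append mult_2)
qed

text \<open>The square combines the two uses of \<open>fact_prod\<close>: one factor from the Haar
  moment, one from the number of path pairs sharing a monomial.\<close>

definition fact_weight :: "nat \<Rightarrow> nat list \<Rightarrow> real" where
  "fact_weight D as = (\<Prod>v<D. fact (count_list as v))\<^sup>2"

lemma fact_weight_ge_1: "1 \<le> fact_weight D as"
proof -
  have "1 \<le> (\<Prod>v<D. fact (count_list as v) :: real)"
    by (rule prod_ge_1) simp
  then show ?thesis unfolding fact_weight_def by (simp add: one_le_power)
qed

lemma fact_weight_Cons:
  assumes "a < D"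
  shows "fact_weight D (a # as) = (real (count_list as a) + 1)\<^sup>2 * fact_weight D as"
proof -
  have "(\<Prod>v<D. fact (count_list (a # as) v)) = (\<Prod>v<D. (if v = a then real (count_list as a) + 1 else 1) * fact (count_list as v))"
    by (intro prod.cong refl) (auto simp: add.commute)
  also have "\<dots> = (real (count_list as a) + 1) * (\<Prod>v<D. fact (count_list as v))"
    unfolding prod.distrib using assms by simp
  finally show ?thesis unfolding fact_weight_def by (simp add: power_mult_distrib)
qed

lemma sum_count_list_less:
  fixes D :: nat
  assumes "as \<in> seqs {..<D} k" shows "(\<Sum>v<D. count_list as v) = k"
proof -
  have "(\<Sum>v<D. count_list as v) = (\<Sum>v\<in>set as. count_list as v)"
    using assms by (intro sum.mono_neutral_right) (auto simp: seqs_def count_notin)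
  then show ?thesis using assms sum_count_set[of as "set as"] unfolding seqs_def by auto
qed

text \<open>Prefixing a letter that occurs c times multiplies the weight by (c + 1)^2. As the counts
  sum to \<open>k\<close>, these factors add up to at most \<open>D + (k + 1)^2\<close> over all
  letters.\<close>

lemma sum_fact_weight_le:
  "k \<le> N \<Longrightarrow> (\<Sum>as\<in>seqs {..<D} k. fact_weight D as) \<le> (real D + real N ^ 2) ^ k"
proof (induction k)
  case 0
  then show ?case by (simp add: fact_weight_def)
next
  case (Suc k)
  have "(\<Sum>as\<in>seqs {..<D} (Suc k). fact_weight D as) =
      (\<Sum>as\<in>seqs {..<D} k. (\<Sum>a<D. (real (count_list as a) + 1)\<^sup>2) * fact_weight D as)"
    unfolding sum_seqs_Suc by (subst sum.swap) (simp add: fact_weight_Cons sum_distrib_right)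
  also have "\<dots> \<le> (\<Sum>as\<in>seqs {..<D} k. (real D + real N ^ 2) * fact_weight D as)"
  proof (intro sum_mono mult_right_mono)
    fix as assume as: "as \<in> seqs {..<D} k"
    have s: "(\<Sum>a<D. real (count_list as a)) = k"
      using sum_count_list_less[OF as] by (metis of_nat_sum)
    have "(\<Sum>a<D. (real (count_list as a) + 1)\<^sup>2) = (\<Sum>a<D. (real (count_list as a))\<^sup>2) + 2 * real k + real D"
      by (simp add: power2_sum sum.distrib sum_distrib_left[symmetric] s)
    also have "(\<Sum>a<D. (real (count_list as a))\<^sup>2) \<le> (\<Sum>a<D. real (count_list as a))\<^sup>2"
    proof -
      have "(\<Sum>a<D. (real (count_list as a))\<^sup>2) \<le> (\<Sum>a<D. real (count_list as a) * (\<Sum>a<D. real (count_list as a)))"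
        unfolding power2_eq_square by (intro sum_mono mult_left_mono member_le_sum) auto
      then show ?thesis by (simp add: sum_distrib_right[symmetric] power2_eq_square)
    qed
    also have "(\<Sum>a<D. real (count_list as a))\<^sup>2 + 2 * real k + real D \<le> real D + (real k + 1)\<^sup>2"
      unfolding s by (simp add: power2_sum)
    also have "(real k + 1)\<^sup>2 \<le> (real N)\<^sup>2" using Suc.prems by (intro power_mono) auto
    finally show "(\<Sum>a<D. (real (count_list as a) + 1)\<^sup>2) \<le> real D + (real N)\<^sup>2" by simp
  qed (use fact_weight_ge_1[of D] in \<open>auto intro: order_trans[OF zero_le_one]\<close>)
  also have "\<dots> \<le> (real D + real N ^ 2) * (real D + real N ^ 2) ^ k"
    unfolding sum_distrib_left[symmetric] using Suc by (intro mult_left_mono) auto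
  finally show ?case by simp
qed

lemma card_seqs: "finite A \<Longrightarrow> card (seqs A n) = card A ^ n"
  using card_lists_length_eq[of A n] unfolding seqs_def by (simp add: conj_commute)

text \<open>The distinct words are subtracted from the total: there are at least
  \<open>(D - N) ^ N\<close> of them, each of weight at least 1.\<close>

lemma sum_fact_weight_collision_le:
  assumes "N \<le> D"
  shows "(\<Sum>as\<in>{as \<in> seqs {..<D} N. \<not> distinct as}. fact_weight D as)
     \<le> (real D + real N ^ 2) ^ N - (real D - real N) ^ N"
proof -
  let ?S = "seqs {..<D} N"
  have "(real D - real N) ^ N \<le> real (card {as \<in> ?S. distinct as})"
  proof -
    have "{as \<in> ?S. distinct as} = {xs. length xs = N \<and> distinct xs \<and> set xs \<subseteq> {..<D}}"
      unfolding seqs_def by auto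
    then have "card {as \<in> ?S. distinct as} = \<Prod>{D - N + 1..D}"
      using card_lists_distinct_length_eq[of "{..<D}" N] assms by simp
    also have "\<dots> \<ge> (\<Prod>i\<in>{D - N + 1..D}. D - N)"
      by (rule prod_mono) auto
    finally have "(D - N) ^ N \<le> card {as \<in> ?S. distinct as}" using assms by simp
    then have "real ((D - N) ^ N) \<le> real (card {as \<in> ?S. distinct as})" by (rule of_nat_mono)
    then show ?thesis using assms by (simp add: of_nat_diff)
  qed
  also have "\<dots> = (\<Sum>as\<in>{as \<in> ?S. distinct as}. 1)" by simp
  also have "\<dots> \<le> (\<Sum>as\<in>{as \<in> ?S. distinct as}. fact_weight D as)"
    by (rule sum_mono) (rule fact_weight_ge_1)
  finally have 1: "(real D - real N) ^ N \<le> (\<Sum>as\<in>{as \<in> ?S. distinct as}. fact_weight D as)" .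
  have "(\<Sum>as\<in>{as \<in> ?S. distinct as}. fact_weight D as) + (\<Sum>as\<in>{as \<in> ?S. \<not> distinct as}. fact_weight D as)
      = (\<Sum>as\<in>?S. fact_weight D as)"
    by (subst sum.union_disjoint[symmetric]) (auto intro!: sum.cong)
  then show ?thesis using 1 sum_fact_weight_le[of N N D] by simp
qed

subsection \<open>Second moment of pairs of path amplitudes\<close>

definition pair_amp :: "nat \<Rightarrow> nat \<Rightarrow> cmat \<Rightarrow> nat \<Rightarrow> nat \<Rightarrow> nat \<Rightarrow> nat \<Rightarrow> nat list \<times> nat list \<Rightarrow> complex" where
  "pair_amp D d U a a' i i' \<beta> = amp D d U a (fst \<beta>) i * amp D d U a' (snd \<beta>) i'"

lemma pair_amp_eq_sum:
  assumes "a < D" "a' < D" "\<beta> \<in> seqs {..<d} n \<times> seqs {..<d} n"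
  shows "pair_amp D d U a a' i i' \<beta> = (\<Sum>z\<in>path_pairs D n a a' i i'. monom_at U (pair_edges d \<beta> z))"
proof -
  have "length (fst \<beta>) = n" "length (snd \<beta>) = n" using assms(3) unfolding seqs_def by auto
  then show ?thesis
    using assms(1,2) unfolding pair_amp_def path_pairs_def pair_edges_def
    by (simp add: amp_eq_sum_paths sum_product sum.cartesian_product case_prod_beta)
qed

lemma finite_path_pairs [simp, intro]: "finite (path_pairs D n a a' i i')"
  unfolding path_pairs_def by auto

lemma fact_prod_pair_edges:
  assumes "\<beta> \<in> seqs {..<d} n \<times> seqs {..<d} n" "z \<in> path_pairs D n a a' i i'"
  shows "real (fact_prod D d (pair_edges d \<beta> z)) ^ 2 = fact_weight D (pair_verts z)"
  unfolding fact_prod_def fact_weight_def vert_deg_def pair_edges_vertices[OF assms]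
  by (simp add: count_mset)

lemma fact_prod_distinct:
  assumes "\<beta> \<in> seqs {..<d} n \<times> seqs {..<d} n" "z \<in> path_pairs D n a a' i i'" "distinct (pair_verts z)"
  shows "fact_prod D d (pair_edges d \<beta> z) = 1"
proof -
  have "fact (count (mset (pair_verts z)) v) = (1 :: nat)" for v
    using assms(3) unfolding distinct_count_atmost_1 by (cases "v \<in> set (pair_verts z)") auto
  then show ?thesis unfolding fact_prod_def vert_deg_def pair_edges_vertices[OF assms(1,2)] by simp
qed

definition collision_sum :: "nat \<Rightarrow> nat \<Rightarrow> real" where
  "collision_sum D N = (\<Sum>as\<in>{as \<in> seqs {..<D} N. \<not> distinct as}. fact_weight D as)"

text \<open>Expanding the left-hand side over pairs of path pairs with the same monomial. Without repeated
  vertices the two path pairs coincide by rigidity.\<close>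
lemma sum_pair_count_le:
  assumes d: "0 < d" and i: "i < D" "i' < D"
    and \<beta>: "\<beta> \<in> seqs {..<d} n \<times> seqs {..<d} n" "\<beta>' \<in> seqs {..<d} n \<times> seqs {..<d} n"
    and \<G>: "finite \<G>" "\<And>a a' z. a < D \<Longrightarrow> a' < D \<Longrightarrow> z \<in> path_pairs D n a a' i i' \<Longrightarrow> pair_edges d \<beta> z \<in> \<G>"
  shows "(\<Sum>a<D. \<Sum>a'<D. \<Sum>g\<in>\<G>. real (fact_prod D d g) * (real (pair_count D d n a a' i i' \<beta> g) * real (pair_count D d n a a' i i' \<beta>' g)))
     \<le> (if \<beta>' = \<beta> then real D ^ (2 * n) else 0) + collision_sum D (2 * n)"
proof -
  let ?Z = "path_pairs D n"
  have step: "(\<Sum>g\<in>\<G>. real (fact_prod D d g) * (real (pair_count D d n a a' i i' \<beta> g) * real (pair_count D d n a a' i i' \<beta>' g)))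
     \<le> (\<Sum>z\<in>?Z a a' i i'. if distinct (pair_verts z) then (if \<beta>' = \<beta> then 1 else 0) else fact_weight D (pair_verts z))"
    if a: "a < D" "a' < D" for a a'
  proof -
    let ?p = "pair_count D d n a a' i i'"
    have "(\<Sum>g\<in>\<G>. real (fact_prod D d g) * (real (?p \<beta> g) * real (?p \<beta>' g)))
       = (\<Sum>g\<in>\<G>. \<Sum>z\<in>{z \<in> ?Z a a' i i'. pair_edges d \<beta> z = g}. real (fact_prod D d g) * real (?p \<beta>' g))"
      unfolding pair_count_def[of D d n a a' i i' \<beta>] by (intro sum.cong refl) simp
    also have "\<dots> = (\<Sum>g\<in>\<G>. \<Sum>z\<in>{z \<in> ?Z a a' i i'. pair_edges d \<beta> z = g}.
         real (fact_prod D d (pair_edges d \<beta> z)) * real (?p \<beta>' (pair_edges d \<beta> z)))"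
      by (intro sum.cong refl) auto
    also have "\<dots> = (\<Sum>z\<in>?Z a a' i i'. real (fact_prod D d (pair_edges d \<beta> z)) * real (?p \<beta>' (pair_edges d \<beta> z)))"
      by (rule sum.group) (use \<G> a in auto)
    also have "\<dots> \<le> (\<Sum>z\<in>?Z a a' i i'. if distinct (pair_verts z) then (if \<beta>' = \<beta> then 1 else 0) else fact_weight D (pair_verts z))"
    proof (rule sum_mono)
      fix z assume z: "z \<in> ?Z a a' i i'"
      show "real (fact_prod D d (pair_edges d \<beta> z)) * real (?p \<beta>' (pair_edges d \<beta> z))
        \<le> (if distinct (pair_verts z) then (if \<beta>' = \<beta> then 1 else 0) else fact_weight D (pair_verts z))"
      proof (cases "distinct (pair_verts z)")
        case True
        have "{y \<in> ?Z a a' i i'. pair_edges d \<beta>' y = pair_edges d \<beta> z} \<subseteq> (if \<beta>' = \<beta> then {z} else {})"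
          using pair_edges_rigid[OF \<beta> z _ True] by auto
        from card_mono[OF _ this] have "?p \<beta>' (pair_edges d \<beta> z) \<le> (if \<beta>' = \<beta> then 1 else 0)"
          unfolding pair_count_def by (auto split: if_splits)
        then show ?thesis using True fact_prod_distinct[OF \<beta>(1) z True] by (auto split: if_splits)
      next
        case False
        have "real (fact_prod D d (pair_edges d \<beta> z)) * real (?p \<beta>' (pair_edges d \<beta> z)) \<le>
           real (fact_prod D d (pair_edges d \<beta> z)) * real (fact_prod D d (pair_edges d \<beta> z))"
          using pair_count_le[OF d a \<beta>(2)] by (intro mult_left_mono) auto
        also have "\<dots> = fact_weight D (pair_verts z)"
          using fact_prod_pair_edges[OF \<beta>(1) z] by (simp add: power2_eq_square)
        finally show ?thesis using False by simp
      qed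
    qed
    finally show ?thesis .
  qed
  have "(\<Sum>a<D. \<Sum>a'<D. \<Sum>g\<in>\<G>. real (fact_prod D d g) * (real (pair_count D d n a a' i i' \<beta> g) * real (pair_count D d n a a' i i' \<beta>' g)))
     \<le> (\<Sum>a<D. \<Sum>a'<D. \<Sum>z\<in>?Z a a' i i'. if distinct (pair_verts z) then (if \<beta>' = \<beta> then 1 else 0) else fact_weight D (pair_verts z))"
    by (intro sum_mono step) auto
  also have "\<dots> = (\<Sum>as\<in>seqs {..<D} (2 * n). if distinct as then (if \<beta>' = \<beta> then 1 else 0) else fact_weight D as)"
    by (rule sum_all_path_pairs[OF i])
  also have "\<dots> \<le> (\<Sum>as\<in>seqs {..<D} (2 * n). (if \<beta>' = \<beta> then 1 else 0) + (if \<not> distinct as then fact_weight D as else 0))"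
    by (intro sum_mono) auto
  also have "\<dots> = (if \<beta>' = \<beta> then real D ^ (2 * n) else 0) + collision_sum D (2 * n)"
    unfolding collision_sum_def by (simp add: sum.distrib card_seqs sum.inter_filter)
  finally show ?thesis .
qed

text \<open>The coefficients of the symmetrized amplitude are sums of two path counts, and their
  squares expand into two diagonal terms and a cross term. Reindexing by the involution identifies
  the diagonal sums, each with main part \<open>D ^ (2 * n)\<close> per pair of words. By rigidity
  the cross term has such a main part only where \<open>\<sigma> \<beta> = \<beta>\<close>;
  everything else is a collision.\<close>

lemma swap_moment_le:
  assumes h: "is_haar (D * d) \<mu>" and d: "0 < d" and i: "i < D" "i' < D" and N: "2 * n < D * d"
    and \<sigma>: "\<And>\<beta>. \<beta> \<in> seqs {..<d} n \<times> seqs {..<d} n \<Longrightarrow> \<sigma> \<beta> \<in> seqs {..<d} n \<times> seqs {..<d} n"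
       "\<And>\<beta>. \<beta> \<in> seqs {..<d} n \<times> seqs {..<d} n \<Longrightarrow> \<sigma> (\<sigma> \<beta>) = \<beta>"
  defines "B \<equiv> seqs {..<d} n \<times> seqs {..<d} n"
  shows "(\<Sum>a<D. \<Sum>a'<D. \<Sum>\<beta>\<in>B. \<integral>U. (cmod (pair_amp D d U a a' i i' \<beta> + pair_amp D d U a a' i i' (\<sigma> \<beta>)))\<^sup>2 \<partial>\<mu>)
    \<le> 2 * (real D ^ (2 * n) * (real d ^ (2 * n) + card {\<beta> \<in> B. \<sigma> \<beta> = \<beta>}) + 2 * real d ^ (2 * n) * collision_sum D (2 * n))
       / real (D * d - 2 * n) ^ (2 * n)"
proof -
  let ?N = "2 * n"
  define m where "m = real (D * d - 2 * n) ^ (2 * n)"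
  have m0: "0 < m" unfolding m_def by (rule zero_less_power) (use N in \<open>simp only: of_nat_0_less_iff zero_less_diff\<close>)
  have fB: "finite B" unfolding B_def by auto
  have cB: "real (card B) = real d ^ (2 * n)"
    unfolding B_def by (simp add: card_cartesian_product card_seqs mult_2 power_add)
  \<comment> \<open>One finite set of monomials for all starts and words, so that the sums over
    \<open>g\<close> can be exchanged with the others.\<close>
  define \<G> where "\<G> = (\<Union>a<D. \<Union>a'<D. \<Union>\<beta>\<in>B. pair_edges d \<beta> ` path_pairs D n a a' i i')"
  have f\<G>: "finite \<G>" unfolding \<G>_def using fB by auto
  have in\<G>: "pair_edges d \<beta> z \<in> \<G>" if "a < D" "a' < D" "\<beta> \<in> B" "z \<in> path_pairs D n a a' i i'" for a a' \<beta> z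
    using that unfolding \<G>_def by blast
  have g\<G>: "size g = ?N \<and> set_mset g \<subseteq> {..<D * d} \<times> {..<D * d}" if "g \<in> \<G>" for g
  proof -
    obtain a a' \<beta> z where "\<beta> \<in> B" and z: "z \<in> path_pairs D n a a' i i'" and g: "g = pair_edges d \<beta> z"
      using \<open>g \<in> \<G>\<close> unfolding \<G>_def by auto
    then have l: "length (fst z) = Suc (length (fst \<beta>))" "length (snd z) = Suc (length (snd \<beta>))"
      "set (fst z) \<subseteq> {..<D}" "set (snd z) \<subseteq> {..<D}" "set (fst \<beta>) \<subseteq> {..<d}" "set (snd \<beta>) \<subseteq> {..<d}"
      "length (fst \<beta>) = n" "length (snd \<beta>) = n"
      unfolding B_def path_pairs_def paths_def seqs_def by auto
    show ?thesis
      unfolding g pair_edges_def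
      using path_edges_subset[OF l(1,3,5)] path_edges_subset[OF l(2,4,6)] size_path_edges[OF l(1)] size_path_edges[OF l(2)] l(7,8)
      by auto
  qed
  let ?p = "\<lambda>a a'. pair_count D d n a a' i i'"
  let ?q = "\<lambda>a a' \<beta> g. real (?p a a' \<beta> g) + real (?p a a' (\<sigma> \<beta>) g)"
  let ?h = "\<lambda>a a' \<beta> U. pair_amp D d U a a' i i' \<beta> + pair_amp D d U a a' i i' (\<sigma> \<beta>)"
  let ?c = "real D ^ ?N + collision_sum D ?N"
  let ?S = "\<lambda>\<beta> \<beta>'. \<Sum>a<D. \<Sum>a'<D. \<Sum>g\<in>\<G>. real (fact_prod D d g) * (real (?p a a' \<beta> g) * real (?p a a' \<beta>' g))"
  have amp_eq: "pair_amp D d U a a' i i' \<beta> = (\<Sum>g\<in>\<G>. of_nat (?p a a' \<beta> g) * monom_at U g)"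
    if "a < D" "a' < D" "\<beta> \<in> B" for U a a' \<beta>
  proof -
    have "pair_amp D d U a a' i i' \<beta> = (\<Sum>z\<in>path_pairs D n a a' i i'. monom_at U (pair_edges d \<beta> z))"
      using that unfolding B_def by (rule pair_amp_eq_sum)
    also have "\<dots> = (\<Sum>g\<in>\<G>. \<Sum>z\<in>{z \<in> path_pairs D n a a' i i'. pair_edges d \<beta> z = g}. monom_at U (pair_edges d \<beta> z))"
      by (rule sum.group[symmetric]) (use f\<G> in\<G>[OF that] in blast)+
    also have "\<dots> = (\<Sum>g\<in>\<G>. of_nat (?p a a' \<beta> g) * monom_at U g)"
      unfolding pair_count_def by (intro sum.cong refl) simp
    finally show ?thesis .
  qed
  have one: "(\<integral>U. (cmod (?h a a' \<beta> U))\<^sup>2 \<partial>\<mu>)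
     \<le> (\<Sum>g\<in>\<G>. real (fact_prod D d g) * (?q a a' \<beta> g)\<^sup>2) / m"
    if a: "a < D" "a' < D" and \<beta>: "\<beta> \<in> B" for a a' \<beta>
  proof -
    have \<sigma>\<beta>: "\<sigma> \<beta> \<in> B" using \<sigma> \<beta> unfolding B_def by blast
    have "(\<integral>U. (cmod (?h a a' \<beta> U))\<^sup>2 \<partial>\<mu>)
      = (\<integral>U. (cmod (\<Sum>g\<in>\<G>. of_nat (?p a a' \<beta> g + ?p a a' (\<sigma> \<beta>) g) * monom_at U g))\<^sup>2 \<partial>\<mu>)"
      unfolding amp_eq[OF a \<beta>] amp_eq[OF a \<sigma>\<beta>] by (simp add: sum.distrib[symmetric] algebra_simps)
    also have "\<dots> \<le> (\<Sum>g\<in>\<G>. (\<Prod>r<D * d. fact (row_deg g r)) / real (D * d - ?N) ^ ?N * (cmod (of_nat (?p a a' \<beta> g + ?p a a' (\<sigma> \<beta>) g)))\<^sup>2)"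
      by (rule haar_moment_le[OF h N f\<G> g\<G>])
    also have "\<dots> \<le> (\<Sum>g\<in>\<G>. real (fact_prod D d g) / m * (?q a a' \<beta> g)\<^sup>2)"
    proof (rule sum_mono)
      fix g
      have "(\<Prod>r<D * d. fact (row_deg g r) :: real) = real (\<Prod>r<D * d. fact (row_deg g r))" by simp
      also have "\<dots> \<le> real (fact_prod D d g)" by (intro of_nat_mono row_fact_le d)
      finally have "(\<Prod>r<D * d. fact (row_deg g r) :: real) \<le> real (fact_prod D d g)" .
      moreover have "cmod (of_nat (?p a a' \<beta> g + ?p a a' (\<sigma> \<beta>) g)) = ?q a a' \<beta> g"
        unfolding norm_of_nat by simp
      ultimately show "(\<Prod>r<D * d. fact (row_deg g r)) / real (D * d - ?N) ^ ?N * (cmod (of_nat (?p a a' \<beta> g + ?p a a' (\<sigma> \<beta>) g)))\<^sup>2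
         \<le> real (fact_prod D d g) / m * (?q a a' \<beta> g)\<^sup>2"
        using m0 unfolding m_def[symmetric] by (simp add: mult_right_mono divide_right_mono)
    qed
    finally show ?thesis unfolding sum_divide_distrib by simp
  qed
  have "(\<Sum>a<D. \<Sum>a'<D. \<Sum>\<beta>\<in>B. \<integral>U. (cmod (?h a a' \<beta> U))\<^sup>2 \<partial>\<mu>)
     \<le> (\<Sum>a<D. \<Sum>a'<D. \<Sum>\<beta>\<in>B. (\<Sum>g\<in>\<G>. real (fact_prod D d g) * (?q a a' \<beta> g)\<^sup>2) / m)"
    by (intro sum_mono one) auto
  also have "\<dots> = (\<Sum>\<beta>\<in>B. \<Sum>a<D. \<Sum>a'<D. \<Sum>g\<in>\<G>. real (fact_prod D d g) * (?q a a' \<beta> g)\<^sup>2) / m"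
    unfolding sum_divide_distrib by (rule sum_rotate[symmetric])
  also have "(\<Sum>\<beta>\<in>B. \<Sum>a<D. \<Sum>a'<D. \<Sum>g\<in>\<G>. real (fact_prod D d g) * (?q a a' \<beta> g)\<^sup>2)
     = (\<Sum>\<beta>\<in>B. ?S \<beta> \<beta> + ?S (\<sigma> \<beta>) (\<sigma> \<beta>) + 2 * ?S \<beta> (\<sigma> \<beta>))"
    by (simp add: power2_sum power2_eq_square sum.distrib sum_distrib_left distrib_left mult_ac)
  also have "\<dots> = (\<Sum>\<beta>\<in>B. ?S \<beta> \<beta>) + (\<Sum>\<beta>\<in>B. ?S (\<sigma> \<beta>) (\<sigma> \<beta>)) + 2 * (\<Sum>\<beta>\<in>B. ?S \<beta> (\<sigma> \<beta>))"
    by (simp add: sum.distrib sum_distrib_left)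
  also have "(\<Sum>\<beta>\<in>B. ?S (\<sigma> \<beta>) (\<sigma> \<beta>)) = (\<Sum>\<beta>\<in>B. ?S \<beta> \<beta>)"
    by (rule sum.reindex_bij_betw[where g = "\<lambda>\<beta>. ?S \<beta> \<beta>"], rule bij_betw_byWitness[where f' = \<sigma>])
       (use \<sigma>[folded B_def] in blast)+
  also have "(\<Sum>\<beta>\<in>B. ?S \<beta> \<beta>) + (\<Sum>\<beta>\<in>B. ?S \<beta> \<beta>) + 2 * (\<Sum>\<beta>\<in>B. ?S \<beta> (\<sigma> \<beta>))
      = 2 * ((\<Sum>\<beta>\<in>B. ?S \<beta> \<beta>) + (\<Sum>\<beta>\<in>B. ?S \<beta> (\<sigma> \<beta>)))" by simp
  also have "(\<Sum>\<beta>\<in>B. ?S \<beta> \<beta>) \<le> (\<Sum>\<beta>\<in>B. ?c)"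
  proof (rule sum_mono)
    fix \<beta> assume "\<beta> \<in> B"
    then show "?S \<beta> \<beta> \<le> ?c"
      using sum_pair_count_le[OF d i, of \<beta> n \<beta> \<G>] f\<G> in\<G> unfolding B_def by simp
  qed
  also have "(\<Sum>\<beta>\<in>B. ?S \<beta> (\<sigma> \<beta>)) \<le> (\<Sum>\<beta>\<in>B. (if \<sigma> \<beta> = \<beta> then real D ^ ?N else 0) + collision_sum D ?N)"
  proof (rule sum_mono)
    fix \<beta> assume "\<beta> \<in> B"
    then show "?S \<beta> (\<sigma> \<beta>) \<le> (if \<sigma> \<beta> = \<beta> then real D ^ ?N else 0) + collision_sum D ?N"
      using \<sigma>(1) f\<G> in\<G> unfolding B_def by (intro sum_pair_count_le[OF d i]) auto
  qed
  also have "(\<Sum>\<beta>\<in>B. ?c) = real d ^ ?N * (?c)"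
    by (simp add: cB)
  also have "(\<Sum>\<beta>\<in>B. (if \<sigma> \<beta> = \<beta> then real D ^ ?N else 0) + collision_sum D ?N)
     = real (card {\<beta> \<in> B. \<sigma> \<beta> = \<beta>}) * real D ^ ?N + real d ^ ?N * collision_sum D ?N"
    using fB by (simp add: sum.distrib cB sum.inter_filter[symmetric])
  finally show ?thesis using m0 unfolding m_def[symmetric] by (simp add: divide_right_mono algebra_simps)
qed

subsection \<open>Swapping the middle segments\<close>

definition mid :: "nat \<Rightarrow> nat \<Rightarrow> nat list \<Rightarrow> nat list" where
  "mid t l bs = take l (drop t bs)"

definition ins :: "nat \<Rightarrow> nat \<Rightarrow> nat list \<Rightarrow> nat list \<Rightarrow> nat list" where
  "ins t l bs c = take t bs @ c @ drop (t + l) bs"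

definition swap_mid :: "nat \<Rightarrow> nat \<Rightarrow> nat list \<times> nat list \<Rightarrow> nat list \<times> nat list" where
  "swap_mid t l \<beta> = (ins t l (fst \<beta>) (mid t l (snd \<beta>)), ins t l (snd \<beta>) (mid t l (fst \<beta>)))"

lemma words_eq_seqs: "words d n = seqs {..<d} n"
  unfolding words_def seqs_def ..

lemma mid_in_words: "t + l \<le> n \<Longrightarrow> bs \<in> seqs {..<d} n \<Longrightarrow> mid t l bs \<in> seqs {..<d} l"
  unfolding mid_def seqs_def by (auto dest: in_set_takeD in_set_dropD)

lemma ins_in_words: "t + l \<le> n \<Longrightarrow> bs \<in> seqs {..<d} n \<Longrightarrow> c \<in> seqs {..<d} l \<Longrightarrow> ins t l bs c \<in> seqs {..<d} n"
  unfolding ins_def seqs_def by (auto dest: in_set_takeD in_set_dropD)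

lemma mid_ins: "t + l \<le> length bs \<Longrightarrow> length c = l \<Longrightarrow> mid t l (ins t l bs c) = c"
  unfolding mid_def ins_def by simp

lemma ins_ins: "t + l \<le> length bs \<Longrightarrow> length c = l \<Longrightarrow> ins t l (ins t l bs c) c' = ins t l bs c'"
  unfolding ins_def by simp

lemma ins_mid: "ins t l bs (mid t l bs) = bs"
proof -
  have "take t bs @ take l (drop t bs) = take (t + l) bs" by (simp add: take_add)
  then show ?thesis unfolding mid_def ins_def by (metis append_assoc append_take_drop_id)
qed

lemma swap_mid_closed:
  assumes "t + l \<le> n" "\<beta> \<in> seqs {..<d} n \<times> seqs {..<d} n"
  shows "swap_mid t l \<beta> \<in> seqs {..<d} n \<times> seqs {..<d} n"
  using assms mid_in_words ins_in_words unfolding swap_mid_def by (auto simp: mem_Times_iff)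

lemma swap_mid_swap_mid:
  assumes "t + l \<le> n" "\<beta> \<in> seqs {..<d} n \<times> seqs {..<d} n"
  shows "swap_mid t l (swap_mid t l \<beta>) = \<beta>"
proof -
  have l: "length (fst \<beta>) = n" "length (snd \<beta>) = n" using assms unfolding seqs_def by auto
  then have "length (mid t l (fst \<beta>)) = l" "length (mid t l (snd \<beta>)) = l"
    using assms(1) unfolding mid_def by auto
  then show ?thesis using l assms(1) unfolding swap_mid_def
    by (simp add: mid_ins ins_ins ins_mid)
qed

text \<open>A fixed pair has equal middle segments, so the second one can be deleted without loss.
  Relative to all pairs this is the factor \<open>d ^ l\<close> in the denominator, the purity of
  the maximally mixed state on the middle.\<close>

lemma card_swap_mid_fixed:
  assumes tl: "t + l \<le> n" and d: "0 < d"
  shows "real (card {\<beta> \<in> seqs {..<d} n \<times> seqs {..<d} n. swap_mid t l \<beta> = \<beta>}) \<le> real d ^ (2 * n) / real d ^ l"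
proof -
  let ?F = "{\<beta> \<in> seqs {..<d} n \<times> seqs {..<d} n. swap_mid t l \<beta> = \<beta>}"
  define f where "f = (\<lambda>\<beta> :: nat list \<times> nat list. (fst \<beta>, take t (snd \<beta>) @ drop (t + l) (snd \<beta>)))"
  have meq: "mid t l (snd \<beta>) = mid t l (fst \<beta>)" if "\<beta> \<in> ?F" for \<beta>
  proof -
    have "length (fst \<beta>) = n" "length (snd \<beta>) = n" using that unfolding seqs_def by auto
    then have "mid t l (ins t l (fst \<beta>) (mid t l (snd \<beta>))) = mid t l (snd \<beta>)"
      using tl by (intro mid_ins) (auto simp: mid_def)
    then show ?thesis using that unfolding swap_mid_def by (metis (mono_tags, lifting) fst_conv mem_Collect_eq)
  qed
  have "inj_on f ?F"
  proof (rule inj_onI)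
    fix x y assume x: "x \<in> ?F" and y: "y \<in> ?F" and e: "f x = f y"
    have l: "length (snd x) = n" "length (snd y) = n" using x y unfolding seqs_def by auto
    have 1: "fst x = fst y" using e unfolding f_def by simp
    have "take t (snd x) = take t (snd y) \<and> drop (t + l) (snd x) = drop (t + l) (snd y)"
      using e l tl unfolding f_def by (auto simp: append_eq_append_conv)
    moreover have "mid t l (snd x) = mid t l (snd y)" using meq[OF x] meq[OF y] 1 by simp
    ultimately have "ins t l (snd x) (mid t l (snd x)) = ins t l (snd y) (mid t l (snd y))"
      unfolding ins_def by simp
    then show "x = y" using 1 by (simp add: ins_mid prod_eq_iff)
  qed
  moreover have "f ` ?F \<subseteq> seqs {..<d} n \<times> seqs {..<d} (n - l)"
    using tl set_take_subset set_drop_subset unfolding f_def seqs_def by fastforce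
  ultimately have "card ?F \<le> card (seqs {..<d} n \<times> seqs {..<d} (n - l))"
    by (rule card_inj_on_le) auto
  also have "\<dots> = d ^ n * d ^ (n - l)" by (simp add: card_cartesian_product card_seqs)
  finally have "real (card ?F) \<le> real (d ^ n * d ^ (n - l))" by (rule of_nat_mono)
  also have "\<dots> = real d ^ n * real d ^ (n - l)" by simp
  also have "\<dots> = real d ^ (2 * n) / real d ^ l"
    using d tl by (subst power_diff) (auto simp: mult_2 power_add)
  finally show ?thesis .
qed

text \<open>An involution of the index set acts as a selfadjoint unitary. The identity expands the
  squared norm of \<open>H\<close> plus its image, the inequality is nonnegativity of the squared
  norm of \<open>H\<close> minus its image.\<close>

lemma involution_polarization:
  fixes H :: "'b \<Rightarrow> complex"
  assumes B: "finite B" and \<sigma>: "\<And>\<beta>. \<beta> \<in> B \<Longrightarrow> \<sigma> \<beta> \<in> B" "\<And>\<beta>. \<beta> \<in> B \<Longrightarrow> \<sigma> (\<sigma> \<beta>) = \<beta>"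
  shows "(\<Sum>\<beta>\<in>B. (cmod (H \<beta> + H (\<sigma> \<beta>)))\<^sup>2) = 2 * (\<Sum>\<beta>\<in>B. (cmod (H \<beta>))\<^sup>2) + 2 * Re (\<Sum>\<beta>\<in>B. H \<beta> * cnj (H (\<sigma> \<beta>)))"
    and "Re (\<Sum>\<beta>\<in>B. H \<beta> * cnj (H (\<sigma> \<beta>))) \<le> (\<Sum>\<beta>\<in>B. (cmod (H \<beta>))\<^sup>2)"
proof -
  have r: "(\<Sum>\<beta>\<in>B. (cmod (H (\<sigma> \<beta>)))\<^sup>2) = (\<Sum>\<beta>\<in>B. (cmod (H \<beta>))\<^sup>2)"
    by (rule sum.reindex_bij_betw[where g = "\<lambda>\<beta>. (cmod (H \<beta>))\<^sup>2"], rule bij_betw_byWitness[where f' = \<sigma>])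
       (use \<sigma> in auto)
  have e: "(cmod (x + y))\<^sup>2 = (cmod x)\<^sup>2 + (cmod y)\<^sup>2 + 2 * Re (x * cnj y)"
    "(cmod (x - y))\<^sup>2 = (cmod x)\<^sup>2 + (cmod y)\<^sup>2 - 2 * Re (x * cnj y)" for x y
    unfolding cmod_power2 by (simp_all add: power2_eq_square algebra_simps)
  show "(\<Sum>\<beta>\<in>B. (cmod (H \<beta> + H (\<sigma> \<beta>)))\<^sup>2) = 2 * (\<Sum>\<beta>\<in>B. (cmod (H \<beta>))\<^sup>2) + 2 * Re (\<Sum>\<beta>\<in>B. H \<beta> * cnj (H (\<sigma> \<beta>)))"
    unfolding e Re_sum sum.distrib r sum_distrib_left[symmetric] by simp
  have "0 \<le> (\<Sum>\<beta>\<in>B. (cmod (H \<beta> - H (\<sigma> \<beta>)))\<^sup>2)" by (intro sum_nonneg) auto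
  also have "\<dots> = 2 * (\<Sum>\<beta>\<in>B. (cmod (H \<beta>))\<^sup>2) - 2 * Re (\<Sum>\<beta>\<in>B. H \<beta> * cnj (H (\<sigma> \<beta>)))"
    unfolding e Re_sum sum.distrib sum_subtractf r sum_distrib_left[symmetric] by simp
  finally show "Re (\<Sum>\<beta>\<in>B. H \<beta> * cnj (H (\<sigma> \<beta>))) \<le> (\<Sum>\<beta>\<in>B. (cmod (H \<beta>))\<^sup>2)" by simp
qed

text \<open>The form \<open>tr (\<rho>\<^sub>f \<rho>\<^sub>g)\<close> for the states \<open>\<rho>\<^sub>f\<close>, \<open>\<rho>\<^sub>g\<close> on the middle segment.\<close>
definition overlap :: "nat \<Rightarrow> nat \<Rightarrow> nat \<Rightarrow> nat \<Rightarrow> (nat list \<Rightarrow> complex) \<Rightarrow> (nat list \<Rightarrow> complex) \<Rightarrow> complex" where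
  "overlap d n t l f g = (\<Sum>\<beta>\<in>seqs {..<d} n \<times> seqs {..<d} n.
     f (fst \<beta>) * g (snd \<beta>) * cnj (f (fst (swap_mid t l \<beta>)) * g (snd (swap_mid t l \<beta>))))"

definition reduced :: "nat \<Rightarrow> nat \<Rightarrow> nat \<Rightarrow> nat \<Rightarrow> (nat list \<Rightarrow> complex) \<Rightarrow> nat list \<Rightarrow> nat list \<Rightarrow> complex" where
  "reduced d n t l f c c' = (\<Sum>bs\<in>{bs \<in> seqs {..<d} n. mid t l bs = c}. f bs * cnj (f (ins t l bs c')))"

text \<open>The labels \<open>c\<close> and \<open>c'\<close> are the middle segments of the two
  words summed over, so summing over them only removes the grouping; each conjugated factor then
  carries the middle segment of the other word.\<close>

lemma trace_reduced:
  assumes tl: "t + l \<le> n"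
  shows "(\<Sum>c\<in>words d l. \<Sum>c'\<in>words d l. reduced d n t l f c c' * reduced d n t l g c' c) = overlap d n t l f g"
proof -
  let ?S = "seqs {..<d} n" and ?W = "seqs {..<d} l"
  let ?h = "\<lambda>bs bs'. f bs * cnj (f (ins t l bs (mid t l bs'))) * (g bs' * cnj (g (ins t l bs' (mid t l bs))))"
  have "(\<Sum>c\<in>?W. \<Sum>c'\<in>?W. reduced d n t l f c c' * reduced d n t l g c' c) =
     (\<Sum>c\<in>?W. \<Sum>c'\<in>?W. \<Sum>bs\<in>{bs \<in> ?S. mid t l bs = c}. \<Sum>bs'\<in>{bs \<in> ?S. mid t l bs = c'}. ?h bs bs')"
    unfolding reduced_def sum_product by (intro sum.cong refl) auto
  also have "\<dots> = (\<Sum>c\<in>?W. \<Sum>bs\<in>{bs \<in> ?S. mid t l bs = c}. \<Sum>c'\<in>?W. \<Sum>bs'\<in>{bs \<in> ?S. mid t l bs = c'}. ?h bs bs')"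
    by (rule sum.cong[OF refl], rule sum.swap)
  also have "\<dots> = (\<Sum>bs\<in>?S. \<Sum>c'\<in>?W. \<Sum>bs'\<in>{bs \<in> ?S. mid t l bs = c'}. ?h bs bs')"
    by (rule sum.group) (use mid_in_words[OF tl] in auto)
  also have "\<dots> = (\<Sum>bs\<in>?S. \<Sum>bs'\<in>?S. ?h bs bs')"
    by (rule sum.cong[OF refl], rule sum.group) (use mid_in_words[OF tl] in auto)
  also have "\<dots> = overlap d n t l f g"
    unfolding overlap_def swap_mid_def by (simp add: sum.cartesian_product case_prod_beta mult_ac)
  finally show ?thesis unfolding words_eq_seqs .
qed

lemma sum_norm_product:
  "(\<Sum>\<beta>\<in>A \<times> A'. (cmod (f (fst \<beta>) * g (snd \<beta>)))\<^sup>2) = (\<Sum>x\<in>A. (cmod (f x))\<^sup>2) * (\<Sum>y\<in>A'. (cmod (g y))\<^sup>2)"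
  by (simp add: sum_product sum.cartesian_product case_prod_beta norm_mult power_mult_distrib)

lemma Re_overlap_le:
  assumes "t + l \<le> n"
  shows "Re (overlap d n t l f g) \<le> (\<Sum>x\<in>seqs {..<d} n. (cmod (f x))\<^sup>2) * (\<Sum>y\<in>seqs {..<d} n. (cmod (g y))\<^sup>2)"
  unfolding overlap_def sum_norm_product[symmetric]
  by (rule involution_polarization(2)[where H = "\<lambda>\<beta>. f (fst \<beta>) * g (snd \<beta>)"])
     (use swap_mid_closed[OF assms] swap_mid_swap_mid[OF assms] in auto)

subsection \<open>Expected purity\<close>

lemma sum_row_index:
  fixes f :: "nat \<Rightarrow> 'a::comm_monoid_add"
  shows "(\<Sum>a<D. \<Sum>b<d. f (a * d + b)) = (\<Sum>r<D * d. f r)"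
proof -
  have "(\<Sum>b<d. f (a * d + b)) = (\<Sum>r\<in>{a * d..<a * d + d}. f r)" for a
    using sum.shift_bounds_nat_ivl[of f 0 "a * d" d] by (simp add: add.commute atLeast0LessThan)
  then show ?thesis by (simp add: sum.nat_group)
qed

lemma unitary_sum_norm:
  assumes U: "unitary_mat M U" and C: "finite C" "inj_on h C" "h ` C \<subseteq> {..<M}"
  shows "(\<Sum>r<M. (cmod (\<Sum>c\<in>C. U r (h c) * x c))\<^sup>2) = (\<Sum>c\<in>C. (cmod (x c))\<^sup>2)"
proof -
  have "complex_of_real (\<Sum>r<M. (cmod (\<Sum>c\<in>C. U r (h c) * x c))\<^sup>2) =
     (\<Sum>r<M. \<Sum>c\<in>C. \<Sum>c'\<in>C. x c * cnj (x c') * (U r (h c) * cnj (U r (h c'))))"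
    by (simp add: of_real_cmod_square sum_product) (simp add: algebra_simps)
  also have "\<dots> = (\<Sum>c\<in>C. \<Sum>c'\<in>C. x c * cnj (x c') * (\<Sum>r<M. U r (h c) * cnj (U r (h c'))))"
    unfolding sum_distrib_left by (rule sum_rotate)
  also have "\<dots> = (\<Sum>c\<in>C. \<Sum>c'\<in>C. if c = c' then x c * cnj (x c) else 0)"
  proof (intro sum.cong refl)
    fix c c' assume c: "c \<in> C" "c' \<in> C"
    have "(\<Sum>r<M. U r (h c) * cnj (U r (h c'))) = (if h c = h c' then 1 else 0)"
      by (rule unitary_mat_cols[OF U]) (use c C in auto)
    also have "(h c = h c') = (c = c')" using c C by (auto dest: inj_onD)
    finally show "x c * cnj (x c') * (\<Sum>r<M. U r (h c) * cnj (U r (h c'))) = (if c = c' then x c * cnj (x c) else 0)"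
      by simp
  qed
  also have "\<dots> = complex_of_real (\<Sum>c\<in>C. (cmod (x c))\<^sup>2)" using C by (simp add: of_real_cmod_square)
  finally show ?thesis unfolding of_real_eq_iff .
qed

text \<open>The columns \<open>c * d\<close> of \<open>U\<close> form an isometry from dimension
  \<open>D\<close> into dimension \<open>D * d\<close>. Each step of the circuit applies it once,
  and the new output letter stays untouched afterwards.\<close>

lemma amp_norm:
  assumes U: "unitary_mat (D * d) U" and d: "0 < d"
  shows "(\<Sum>a<D. \<Sum>bs\<in>seqs {..<d} n. (cmod (\<Sum>i<D. amp D d U a bs i * x i))\<^sup>2) = (\<Sum>i<D. (cmod (x i))\<^sup>2)"
proof (induction n)
  case 0
  have "(\<Sum>i<D. amp D d U a [] i * x i) = x a" if "a < D" for a
  proof -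
    have "(\<Sum>i<D. amp D d U a [] i * x i) = (\<Sum>i<D. if i = a then x a else 0)"
      by (intro sum.cong) auto
    then show ?thesis using that by simp
  qed
  then show ?case by simp
next
  case (Suc n)
  define y where "y = (\<lambda>c bs. \<Sum>i<D. amp D d U c bs i * x i)"
  have step: "(\<Sum>i<D. amp D d U a (b # bs) i * x i) = (\<Sum>c<D. U (a * d + b) (c * d) * y c bs)" for a b bs
    unfolding y_def sum_distrib_left by (simp add: sum_distrib_right mult.assoc) (rule sum.swap)
  have "(\<Sum>a<D. \<Sum>bs\<in>seqs {..<d} (Suc n). (cmod (\<Sum>i<D. amp D d U a bs i * x i))\<^sup>2)
     = (\<Sum>a<D. \<Sum>b<d. \<Sum>bs\<in>seqs {..<d} n. (cmod (\<Sum>c<D. U (a * d + b) (c * d) * y c bs))\<^sup>2)"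
    unfolding sum_seqs_Suc step ..
  also have "\<dots> = (\<Sum>r<D * d. \<Sum>bs\<in>seqs {..<d} n. (cmod (\<Sum>c<D. U r (c * d) * y c bs))\<^sup>2)"
    by (rule sum_row_index)
  also have "\<dots> = (\<Sum>bs\<in>seqs {..<d} n. \<Sum>r<D * d. (cmod (\<Sum>c<D. U r (c * d) * y c bs))\<^sup>2)"
    by (rule sum.swap)
  also have "\<dots> = (\<Sum>bs\<in>seqs {..<d} n. \<Sum>c<D. (cmod (y c bs))\<^sup>2)"
    by (intro sum.cong refl unitary_sum_norm[OF U]) (use d in \<open>auto intro: inj_onI\<close>)
  also have "\<dots> = (\<Sum>c<D. \<Sum>bs\<in>seqs {..<d} n. (cmod (y c bs))\<^sup>2)" by (rule sum.swap)
  also have "\<dots> = (\<Sum>i<D. (cmod (x i))\<^sup>2)" unfolding y_def by (rule Suc.IH)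
  finally show ?case .
qed

lemma amp_norm_column:
  assumes U: "unitary_mat (D * d) U" and d: "0 < d" and i: "i < D"
  shows "(\<Sum>a<D. \<Sum>bs\<in>seqs {..<d} n. (cmod (amp D d U a bs i))\<^sup>2) = 1"
proof -
  have "(\<Sum>k<D. amp D d U a bs k * (if k = i then 1 else 0)) = amp D d U a bs i" for a bs
    using i by (simp add: if_distrib[of "\<lambda>x. _ * x"] cong: if_cong)
  then have "(\<Sum>a<D. \<Sum>bs\<in>seqs {..<d} n. (cmod (amp D d U a bs i))\<^sup>2) = (\<Sum>k<D. (cmod (if k = i then 1 else 0))\<^sup>2)"
    using amp_norm[OF U d, where n = n and x = "\<lambda>k. if k = i then 1 else 0"] by simp
  also have "\<dots> = (\<Sum>k<D. if k = i then 1 else 0)" by (intro sum.cong) auto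
  finally show ?thesis using i by simp
qed

lemma bmeas_Re: "bmeas M S f \<Longrightarrow> (\<lambda>x. Re (f x)) \<in> borel_measurable M"
  unfolding bmeas_def using measurable_compose[OF _ borel_measurable_Re] by blast

lemma bmeas_amp [intro]:
  assumes "\<And>i j. bmeas \<mu> S (\<lambda>x. U x i j)"
  shows "bmeas \<mu> S (\<lambda>x. amp D d (U x) a bs i)"
proof (induction bs arbitrary: a)
  case (Cons b bs)
  then show ?case unfolding amp.simps by (intro bmeas_sum bmeas_mult assms)
qed simp

text \<open>Here \<open>y = N ^ 3 / D\<close> satisfies \<open>y \<le> 1\<close>, because 9 n^3 is
  at most n^5 and hence at most \<open>D\<close>. Thus exp y is at most 1 + 2y, which bounds the
  normalization ratio \<open>u\<close> by 1 + 2y and, with Bernoulli, the relative collision term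
  \<open>X\<close> by 3y. The error in (1 + 2y)(1 + d^-l + 6y) has the coefficients 6 + 2 + 2 + 12 =
  22.\<close>

lemma purity_numeric:
  fixes D d n l :: nat
  assumes d: "2 \<le> d" and n: "3 \<le> n" and D: "n ^ 5 \<le> D"
  defines "N \<equiv> 2 * n"
  shows "(real D ^ N * (real d ^ N + real d ^ N / real d ^ l) + 2 * real d ^ N * ((real D + real N ^ 2) ^ N - (real D - real N) ^ N))
       / real (D * d - N) ^ N - 1 \<le> 1 / real d ^ l + 22 * (real N ^ 3 / real D)"
proof -
  define y where "y = real N ^ 3 / real D"
  have n3: "3 * 3 * n ^ 3 \<le> n * n * n ^ 3" using n by (intro mult_le_mono) auto
  have "n * n * n ^ 3 = n ^ 5" by (simp add: power_numeral_reduce)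
  then have D9: "9 * n ^ 3 \<le> D" using n3 D by simp
  have n1: "n \<le> n ^ 3" by (rule self_le_power) (use n in auto)
  have D0: "0 < D" using D9 n by (metis (no_types) gr0I le_zero_eq mult_eq_0_iff n1 not_numeral_le_zero zero_neq_numeral)
  have ND: "N \<le> D" using D9 n1 unfolding N_def by linarith
  have N1: "1 \<le> N" using n unfolding N_def by simp
  have y01: "0 \<le> y" "y \<le> 1"
  proof -
    have "N ^ 3 \<le> D" using D9 unfolding N_def by (simp add: power_mult_distrib)
    then have "real N ^ 3 \<le> real D" by (metis of_nat_le_iff of_nat_power)
    then show "0 \<le> y" "y \<le> 1" using D0 unfolding y_def by auto
  qed
  have ey: "exp y \<le> 1 + 2 * y"
  proof -
    have "exp y \<le> 1 + y + y\<^sup>2" by (rule exp_bound) (use y01 in auto)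
    moreover have "y\<^sup>2 \<le> y" using y01 by (simp add: power2_eq_square mult_left_le)
    ultimately show ?thesis by simp
  qed
  have N2: "real N ^ 2 / real D \<le> y"
    unfolding y_def using N1 D0 by (intro divide_right_mono power_increasing) auto
  have pow_exp: "(1 + x) ^ N \<le> exp (real N * x)" if "0 \<le> x" for x :: real
    using power_mono[OF exp_ge_add_one_self, of x N] that by (simp add: exp_of_nat_mult)
  define m where "m = real (D * d - N)"
  have m: "m = real D * real d - real N"
    unfolding m_def using ND d by (subst of_nat_diff) (auto intro: order_trans[OF ND])
  have mD: "real D \<le> m"
  proof -
    have "real D * 2 \<le> real D * real d" using d by (intro mult_left_mono) auto
    then show ?thesis unfolding m using ND by linarith
  qed
  have m0: "0 < m" using mD D0 by simp
  define u where "u = (real D * real d) ^ N / m ^ N"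
  have u0: "0 \<le> u" unfolding u_def using m0 by simp
  have uy: "u \<le> 1 + 2 * y"
  proof -
    have "u = (1 + real N / m) ^ N"
      unfolding u_def power_divide[symmetric] using m0 m by (simp add: field_simps)
    also have "\<dots> \<le> exp (real N * (real N / m))" by (rule pow_exp) (use m0 in auto)
    also have "real N * (real N / m) \<le> real N ^ 2 / real D"
      using mD D0 by (simp add: power2_eq_square divide_left_mono)
    finally have "u \<le> exp y" using N2 by (meson exp_le_cancel_iff order_trans)
    then show ?thesis using ey by simp
  qed
  define X where "X = (1 + real N ^ 2 / real D) ^ N - (1 - real N / real D) ^ N"
  have X3: "X \<le> 3 * y"
  proof -
    have "(1 + real N ^ 2 / real D) ^ N \<le> exp (real N * (real N ^ 2 / real D))"
      by (rule pow_exp) auto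
    also have "real N * (real N ^ 2 / real D) = y" unfolding y_def by (simp add: power_numeral_reduce)
    finally have 1: "(1 + real N ^ 2 / real D) ^ N \<le> 1 + 2 * y" using ey by simp
    have "1 + real N * (- (real N / real D)) \<le> (1 + - (real N / real D)) ^ N"
      by (rule Bernoulli_inequality) (use ND D0 in auto)
    then have "1 - y \<le> (1 - real N / real D) ^ N" using N2 by (simp add: power2_eq_square)
    then show ?thesis using 1 unfolding X_def by simp
  qed
  have XD: "(real D + real N ^ 2) ^ N - (real D - real N) ^ N = real D ^ N * X"
  proof -
    have e: "real D + real N ^ 2 = real D * (1 + real N ^ 2 / real D)" "real D - real N = real D * (1 - real N / real D)"
      using D0 by (auto simp: field_simps)
    show ?thesis unfolding X_def e power_mult_distrib right_diff_distrib[of "real D ^ N"] ..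
  qed
  have q: "0 \<le> 1 / real d ^ l" "1 / real d ^ l \<le> 1" using d by (auto simp: one_le_power)
  have "(real D ^ N * (real d ^ N + real d ^ N / real d ^ l) + 2 * real d ^ N * ((real D + real N ^ 2) ^ N - (real D - real N) ^ N)) / m ^ N
     = u * (1 + 1 / real d ^ l + 2 * X)"
    unfolding XD u_def by (simp add: power_mult_distrib field_simps)
  also have "\<dots> \<le> u * (1 + 1 / real d ^ l + 6 * y)" using X3 u0 by (intro mult_left_mono) auto
  also have "\<dots> \<le> (1 + 2 * y) * (1 + 1 / real d ^ l + 6 * y)"
    using uy q y01 by (intro mult_right_mono) auto
  also have "\<dots> = 1 + 1 / real d ^ l + 6 * y + 2 * y + 2 * (y * (1 / real d ^ l)) + 12 * (y * y)"
    by (simp add: algebra_simps)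
  also have "\<dots> \<le> 1 + 1 / real d ^ l + 22 * y"
  proof -
    have "y * (1 / real d ^ l) \<le> y" using q y01 by (intro mult_left_le) auto
    moreover have "y * y \<le> y" using y01 by (intro mult_left_le) auto
    ultimately show ?thesis by linarith
  qed
  finally show ?thesis unfolding m_def y_def by simp
qed

text \<open>For unitary \<open>U\<close> the outgoing state has norm exactly 1, so the overlap sum
  equals half the symmetrized square minus 1. The swap moment bound has main part 2 (1 + d^-l), and
  after halving the subtracted 1 cancels the leading term.\<close>

lemma expected_overlap_le:
  assumes h: "is_haar (D * d) \<mu>" and i: "i < D" "i' < D" and d: "2 \<le> d" and n: "3 \<le> n" and D: "n ^ 5 \<le> D"
    and tl: "t + l \<le> n"
  shows "(\<integral>U. (\<Sum>a<D. \<Sum>a'<D. Re (overlap d n t l (\<lambda>bs. amp D d U a bs i) (\<lambda>bs. amp D d U a' bs i'))) \<partial>\<mu>)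
     \<le> 1 / real d ^ l + 22 * (real (2 * n) ^ 3 / real D)"
proof -
  note hd = is_haarD[OF h]
  interpret prob_space \<mu> by fact
  let ?B = "seqs {..<d} n \<times> seqs {..<d} n"
  let ?\<sigma> = "swap_mid t l"
  define F where "F = (\<lambda>a a' \<beta> U. (cmod (pair_amp D d U a a' i i' \<beta> + pair_amp D d U a a' i i' (?\<sigma> \<beta>)))\<^sup>2)"
  let ?R = "\<lambda>U. \<Sum>a<D. \<Sum>a'<D. Re (overlap d n t l (\<lambda>bs. amp D d U a bs i) (\<lambda>bs. amp D d U a' bs i'))"
  let ?F = "\<lambda>U. \<Sum>a<D. \<Sum>a'<D. \<Sum>\<beta>\<in>?B. F a a' \<beta> U"
  have intF: "integrable \<mu> (F a a' \<beta>)" for a a' \<beta>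
    unfolding F_def pair_amp_def
    by (rule bmeas_norm_square_integrable[OF hd(1) _ hd(3)]) (intro bmeas_add bmeas_mult bmeas_amp bmeas_entry hd(2))
  have d0: "0 < d" using d by simp
  have "3 \<le> n ^ 4" using self_le_power[of n 4] n by linarith
  then have "n * 3 \<le> n * n ^ 4" by (rule mult_le_mono2)
  also have "n * n ^ 4 = n ^ 5" by (simp add: power_numeral_reduce)
  finally have n5: "n * 3 \<le> n ^ 5" .
  have "2 * n < D * d"
  proof -
    have "2 * n < D" using n5 D n by linarith
    also have "D \<le> D * d" using d by simp
    finally show ?thesis .
  qed
  then have swap: "(\<Sum>a<D. \<Sum>a'<D. \<Sum>\<beta>\<in>?B. \<integral>U. F a a' \<beta> U \<partial>\<mu>)
    \<le> 2 * (real D ^ (2 * n) * (real d ^ (2 * n) + card {\<beta> \<in> ?B. ?\<sigma> \<beta> = \<beta>}) + 2 * real d ^ (2 * n) * collision_sum D (2 * n))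
       / real (D * d - 2 * n) ^ (2 * n)"
    unfolding F_def by (intro swap_moment_le h d0 i swap_mid_closed[OF tl] swap_mid_swap_mid[OF tl])
  have pos: "0 < real (D * d - 2 * n)" using \<open>2 * n < D * d\<close> by (simp only: of_nat_0_less_iff zero_less_diff)
  have "2 * n \<le> D"
    using n5 D by linarith
  then have coll: "collision_sum D (2 * n) \<le> (real D + real (2 * n) ^ 2) ^ (2 * n) - (real D - real (2 * n)) ^ (2 * n)"
    unfolding collision_sum_def by (rule sum_fact_weight_collision_le)
  have pointwise: "?R U
     = ?F U / 2 - 1" if U: "unitary_mat (D * d) U" for U
  proof -
    have "(\<Sum>\<beta>\<in>?B. F a a' \<beta> U) = 2 * ((\<Sum>bs\<in>seqs {..<d} n. (cmod (amp D d U a bs i))\<^sup>2) * (\<Sum>bs\<in>seqs {..<d} n. (cmod (amp D d U a' bs i'))\<^sup>2))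
        + 2 * Re (overlap d n t l (\<lambda>bs. amp D d U a bs i) (\<lambda>bs. amp D d U a' bs i'))" for a a'
      unfolding F_def overlap_def sum_norm_product[symmetric] pair_amp_def
      by (rule involution_polarization(1)[where H = "\<lambda>\<beta>. amp D d U a (fst \<beta>) i * amp D d U a' (snd \<beta>) i'"])
         (use swap_mid_closed[OF tl] swap_mid_swap_mid[OF tl] in auto)
    then have "?F U =
        2 * ((\<Sum>a<D. \<Sum>bs\<in>seqs {..<d} n. (cmod (amp D d U a bs i))\<^sup>2) * (\<Sum>a'<D. \<Sum>bs\<in>seqs {..<d} n. (cmod (amp D d U a' bs i'))\<^sup>2))
        + 2 * ?R U"
      by (simp only: sum.distrib sum_distrib_left[symmetric] sum_product)
    then have "?F U =
        2 + 2 * ?R U"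
      by (simp only: amp_norm_column[OF U d0 i(1)] amp_norm_column[OF U d0 i(2)] mult_1_right)
    then show ?thesis by linarith
  qed
  have "(\<integral>U. ?R U \<partial>\<mu>)
      = (\<integral>U. ?F U / 2 - 1 \<partial>\<mu>)"
  proof (rule integral_cong_AE)
    show "AE U in \<mu>. ?R U
       = ?F U / 2 - 1"
      using hd(3) by eventually_elim (use pointwise in auto)
    show "(\<lambda>U. ?F U / 2 - 1) \<in> borel_measurable \<mu>"
      using intF by (intro borel_measurable_integrable) auto
    have "bmeas \<mu> {U. unitary_mat (D * d) U} (\<lambda>U. \<Sum>a<D. \<Sum>a'<D. overlap d n t l (\<lambda>bs. amp D d U a bs i) (\<lambda>bs. amp D d U a' bs i'))"
      unfolding overlap_def by (intro bmeas_sum bmeas_mult bmeas_cnj bmeas_amp bmeas_entry hd(2))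
    from bmeas_Re[OF this] show "?R \<in> borel_measurable \<mu>"
      by (simp only: Re_sum)
  qed
  also have "\<dots> = (\<Sum>a<D. \<Sum>a'<D. \<Sum>\<beta>\<in>?B. \<integral>U. F a a' \<beta> U \<partial>\<mu>) / 2 - 1"
    using intF by (simp add: prob_space)
  also have "\<dots> \<le> (real D ^ (2 * n) * (real d ^ (2 * n) + card {\<beta> \<in> ?B. ?\<sigma> \<beta> = \<beta>}) + 2 * real d ^ (2 * n) * collision_sum D (2 * n))
       / real (D * d - 2 * n) ^ (2 * n) - 1"
    using swap unfolding times_divide_eq_right[symmetric] by linarith
  also have "\<dots> \<le> (real D ^ (2 * n) * (real d ^ (2 * n) + real d ^ (2 * n) / real d ^ l)
        + 2 * real d ^ (2 * n) * ((real D + real (2 * n) ^ 2) ^ (2 * n) - (real D - real (2 * n)) ^ (2 * n)))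
       / real (D * d - 2 * n) ^ (2 * n) - 1"
    using card_swap_mid_fixed[OF tl d0] coll pos
    by (intro diff_right_mono divide_right_mono add_mono mult_left_mono) auto
  also have "\<dots> \<le> 1 / real d ^ l + 22 * (real (2 * n) ^ 3 / real D)"
    by (rule purity_numeric[OF d n D])
  finally show ?thesis .
qed

subsection \<open>Fourth moments of a column\<close>

text \<open>The moment bound is used in degree 2. One factor 2 bounds the row factorials, the other
  is Cauchy-Schwarz, because only \<open>(a, a')\<close> and \<open>(a', a)\<close> give the same
  monomial.\<close>

lemma column_moment_le:
  assumes h: "is_haar D \<mu>" and D: "2 < D" and e: "e < D"
  shows "(\<integral>V. (cmod (\<Sum>a<D. \<Sum>a'<D. \<Phi> a a' * (V a e * V a' e)))\<^sup>2 \<partial>\<mu>)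
     \<le> 4 / (real D - 2)\<^sup>2 * (\<Sum>a<D. \<Sum>a'<D. (cmod (\<Phi> a a'))\<^sup>2)"
proof -
  let ?P = "{..<D} \<times> {..<D}"
  define \<gamma> where "\<gamma> = (\<lambda>p :: nat \<times> nat. {#(fst p, e), (snd p, e)#})"
  define C where "C = (\<lambda>g. \<Sum>p\<in>{p \<in> ?P. \<gamma> p = g}. \<Phi> (fst p) (snd p))"
  have m: "monom_at V (\<gamma> p) = V (fst p) e * V (snd p) e" for V p unfolding \<gamma>_def by simp
  have "(\<Sum>a<D. \<Sum>a'<D. \<Phi> a a' * (V a e * V a' e)) = (\<Sum>g\<in>\<gamma> ` ?P. C g * monom_at V g)" for V
  proof -
    have "(\<Sum>a<D. \<Sum>a'<D. \<Phi> a a' * (V a e * V a' e)) = (\<Sum>p\<in>?P. \<Phi> (fst p) (snd p) * monom_at V (\<gamma> p))"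
      unfolding m by (simp add: sum.cartesian_product case_prod_beta)
    also have "\<dots> = (\<Sum>g\<in>\<gamma> ` ?P. \<Sum>p\<in>{p \<in> ?P. \<gamma> p = g}. \<Phi> (fst p) (snd p) * monom_at V (\<gamma> p))"
      by (rule sum.image_gen) auto
    also have "\<dots> = (\<Sum>g\<in>\<gamma> ` ?P. C g * monom_at V g)"
      unfolding C_def sum_distrib_right by (intro sum.cong refl) auto
    finally show ?thesis .
  qed
  then have "(\<integral>V. (cmod (\<Sum>a<D. \<Sum>a'<D. \<Phi> a a' * (V a e * V a' e)))\<^sup>2 \<partial>\<mu>)
      = (\<integral>V. (cmod (\<Sum>g\<in>\<gamma> ` ?P. C g * monom_at V g))\<^sup>2 \<partial>\<mu>)" by simp
  also have "\<dots> \<le> (\<Sum>g\<in>\<gamma> ` ?P. (\<Prod>r<D. fact (row_deg g r)) / real (D - 2) ^ 2 * (cmod (C g))\<^sup>2)"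
    by (rule haar_moment_le[OF h D]) (use e in \<open>auto simp: \<gamma>_def\<close>)
  also have "\<dots> \<le> (\<Sum>g\<in>\<gamma> ` ?P. 2 / (real D - 2)\<^sup>2 * (2 * (\<Sum>p\<in>{p \<in> ?P. \<gamma> p = g}. (cmod (\<Phi> (fst p) (snd p)))\<^sup>2)))"
  proof (intro sum_mono mult_mono)
    fix g assume "g \<in> \<gamma> ` ?P"
    then obtain p where p: "p \<in> ?P" "g = \<gamma> p" by auto
    have "(\<Prod>r<D. fact (row_deg g r) :: nat) \<le> fact (\<Sum>r<D. row_deg g r)"
      by (rule prod_fact_le_fact_sum) simp
    also have "(\<Sum>r<D. row_deg g r) = 2"
    proof -
      have "(\<Sum>r<D. row_deg g r) = size g" by (rule size_rows) (use p in \<open>auto simp: \<gamma>_def\<close>)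
      then show ?thesis unfolding p(2) by (simp add: \<gamma>_def)
    qed
    finally have "real (\<Prod>r<D. fact (row_deg g r)) \<le> real 2" by (intro of_nat_mono) (simp add: numeral_2_eq_2)
    then have "(\<Prod>r<D. fact (row_deg g r) :: real) \<le> 2" by simp
    moreover have "real (D - 2) = real D - 2" using D by (simp add: of_nat_diff)
    ultimately show "(\<Prod>r<D. fact (row_deg g r)) / real (D - 2) ^ 2 \<le> 2 / (real D - 2)\<^sup>2"
      by (simp add: divide_right_mono)
    have sub: "{p' \<in> ?P. \<gamma> p' = g} \<subseteq> {p, (snd p, fst p)}"
      unfolding p(2) \<gamma>_def by (auto simp: add_eq_conv_ex)
    have "card {p' \<in> ?P. \<gamma> p' = g} \<le> card {p, (snd p, fst p)}" by (rule card_mono[OF _ sub]) simp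
    also have "\<dots> \<le> 2" by (simp add: card_insert_if)
    finally have "real (card {p' \<in> ?P. \<gamma> p' = g}) \<le> 2" by simp
    then have "real (card {p' \<in> ?P. \<gamma> p' = g}) * (\<Sum>p\<in>{p \<in> ?P. \<gamma> p = g}. (cmod (\<Phi> (fst p) (snd p)))\<^sup>2)
       \<le> 2 * (\<Sum>p\<in>{p \<in> ?P. \<gamma> p = g}. (cmod (\<Phi> (fst p) (snd p)))\<^sup>2)"
      by (intro mult_right_mono sum_nonneg) auto
    then show "(cmod (C g))\<^sup>2 \<le> 2 * (\<Sum>p\<in>{p \<in> ?P. \<gamma> p = g}. (cmod (\<Phi> (fst p) (snd p)))\<^sup>2)"
      unfolding C_def using cmod_sum_square_le[of "\<lambda>p. \<Phi> (fst p) (snd p)"] order_trans by blast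
  qed auto
  also have "\<dots> = 4 / (real D - 2)\<^sup>2 * (\<Sum>g\<in>\<gamma> ` ?P. \<Sum>p\<in>{p \<in> ?P. \<gamma> p = g}. (cmod (\<Phi> (fst p) (snd p)))\<^sup>2)"
    by (simp add: sum_distrib_left)
  also have "(\<Sum>g\<in>\<gamma> ` ?P. \<Sum>p\<in>{p \<in> ?P. \<gamma> p = g}. (cmod (\<Phi> (fst p) (snd p)))\<^sup>2) = (\<Sum>p\<in>?P. (cmod (\<Phi> (fst p) (snd p)))\<^sup>2)"
    by (rule sum.image_gen[symmetric]) auto
  also have "\<dots> = (\<Sum>a<D. \<Sum>a'<D. (cmod (\<Phi> a a'))\<^sup>2)"
    by (simp add: sum.cartesian_product case_prod_beta)
  finally show ?thesis .
qed

subsection \<open>The circuit in terms of path amplitudes\<close>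

lemma idxs_eq: "idxs D d n = {..<D} \<times> seqs {..<d} n"
  unfolding idxs_def seqs_def by auto

lemma sum_idxs: "(\<Sum>x\<in>idxs D d n. f x) = (\<Sum>a<D. \<Sum>bs\<in>seqs {..<d} n. f (a, bs))"
  unfolding idxs_eq by (simp add: sum.cartesian_product)

text \<open>Downward induction on the first factor included. Factors from \<open>k\<close> on leave
  the first \<open>k\<close> B systems in state 0, which is the condition on the letters before
  \<open>k\<close>.\<close>

lemma circuit_suffix:
  assumes a0: "a0 < D" and d: "0 < d"
  shows "k \<le> n \<Longrightarrow> a < D \<Longrightarrow> bs \<in> seqs {..<d} n \<Longrightarrow>
    foldr (\<lambda>k M. opmul (idxs D d n) (U_on d U k) M) [k..<n] idop (a, bs) (a0, replicate n 0)
      = (if \<forall>j<k. bs ! j = 0 then amp D d U a (drop k bs) a0 else 0)"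
proof (induction arbitrary: a bs rule: inc_induct)
  case base
  then have "(bs = replicate n 0) = (\<forall>j<n. bs ! j = 0)"
    unfolding seqs_def by (auto simp: list_eq_iff_nth_eq)
  then show ?case using base unfolding idop_def seqs_def by auto
next
  case (step k)
  let ?f = "\<lambda>k. foldr (\<lambda>k M. opmul (idxs D d n) (U_on d U k) M) [k..<n] idop"
  have l: "length bs = n" "set bs \<subseteq> {..<d}" using step.prems unfolding seqs_def by auto
  have inS: "bs[k := 0] \<in> seqs {..<d} n"
    using l d set_update_subset_insert[of bs k 0] unfolding seqs_def by auto
  have "?f k (a, bs) (a0, replicate n 0) = (\<Sum>a'<D. \<Sum>bs'\<in>seqs {..<d} n. U_on d U k (a, bs) (a', bs') * ?f (Suc k) (a', bs') (a0, replicate n 0))"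
    using step.hyps by (subst upt_conv_Cons) (simp_all add: opmul_def sum_idxs)
  also have "\<dots> = (\<Sum>a'<D. \<Sum>bs'\<in>seqs {..<d} n. if bs' = bs[k := 0]
      then (if \<forall>j<k. bs ! j = 0 then U (a * d + bs ! k) (a' * d) * amp D d U a' (drop (Suc k) bs) a0 else 0) else 0)"
  proof (intro sum.cong refl)
    fix a' bs' assume a': "a' \<in> {..<D}" and bs': "bs' \<in> seqs {..<d} n"
    have l': "length bs' = n" using bs' unfolding seqs_def by auto
    have IH: "?f (Suc k) (a', bs') (a0, replicate n 0) = (if \<forall>j<Suc k. bs' ! j = 0 then amp D d U a' (drop (Suc k) bs') a0 else 0)"
      by (rule step.IH) (use a' bs' in auto)
    \<comment> \<open>Only one intermediate word contributes: the factor at \<open>k\<close> changes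
      no other letter, and the later factors deliver a 0 at position \<open>k\<close>.\<close>
    have eq: "((\<forall>j<n. j \<noteq> k \<longrightarrow> bs ! j = bs' ! j) \<and> (\<forall>j<Suc k. bs' ! j = 0)) = (bs' = bs[k := 0] \<and> (\<forall>j<k. bs ! j = 0))"
    proof
      assume A: "(\<forall>j<n. j \<noteq> k \<longrightarrow> bs ! j = bs' ! j) \<and> (\<forall>j<Suc k. bs' ! j = 0)"
      have "bs' = bs[k := 0]"
      proof (rule nth_equalityI)
        fix j assume "j < length bs'"
        then show "bs' ! j = bs[k := 0] ! j" using A l l' by (cases "j = k") auto
      qed (use l l' in simp)
      moreover have "\<forall>j<k. bs ! j = 0" using A step.hyps by auto
      ultimately show "bs' = bs[k := 0] \<and> (\<forall>j<k. bs ! j = 0)" ..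
    next
      assume A: "bs' = bs[k := 0] \<and> (\<forall>j<k. bs ! j = 0)"
      then show "(\<forall>j<n. j \<noteq> k \<longrightarrow> bs ! j = bs' ! j) \<and> (\<forall>j<Suc k. bs' ! j = 0)"
        using l step.hyps by (auto simp: nth_list_update)
    qed
    show "U_on d U k (a, bs) (a', bs') * ?f (Suc k) (a', bs') (a0, replicate n 0) =
       (if bs' = bs[k := 0] then (if \<forall>j<k. bs ! j = 0 then U (a * d + bs ! k) (a' * d) * amp D d U a' (drop (Suc k) bs) a0 else 0) else 0)"
    proof (cases "(\<forall>j<n. j \<noteq> k \<longrightarrow> bs ! j = bs' ! j) \<and> (\<forall>j<Suc k. bs' ! j = 0)")
      case True
      then have e: "bs' = bs[k := 0]" "\<forall>j<k. bs ! j = 0" using eq by auto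
      have "bs' ! k = 0" using True by auto
      then have "U_on d U k (a, bs) (a', bs') = U (a * d + bs ! k) (a' * d)"
        using True l l' unfolding U_on_def by simp
      moreover have "drop (Suc k) bs' = drop (Suc k) bs" unfolding e(1) by simp
      moreover have "?f (Suc k) (a', bs') (a0, replicate n 0) = amp D d U a' (drop (Suc k) bs') a0"
        unfolding IH using True by argo
      ultimately show ?thesis using e by argo
    next
      case False
      then have "U_on d U k (a, bs) (a', bs') = 0 \<or> ?f (Suc k) (a', bs') (a0, replicate n 0) = 0"
      proof (cases "\<forall>j<n. j \<noteq> k \<longrightarrow> bs ! j = bs' ! j")
        case True
        then have "\<not> (\<forall>j<Suc k. bs' ! j = 0)" using False by blast
        then show ?thesis unfolding IH by argo
      next
        case False
        then show ?thesis unfolding U_on_def using l by auto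
      qed
      then have "U_on d U k (a, bs) (a', bs') * ?f (Suc k) (a', bs') (a0, replicate n 0) = 0" by auto
      moreover have "\<not> (bs' = bs[k := 0] \<and> (\<forall>j<k. bs ! j = 0))" using False eq by blast
      ultimately show ?thesis by auto
    qed
  qed
  also have "\<dots> = (\<Sum>a'<D. if \<forall>j<k. bs ! j = 0 then U (a * d + bs ! k) (a' * d) * amp D d U a' (drop (Suc k) bs) a0 else 0)"
    using inS by (intro sum.cong refl) simp
  also have "\<dots> = (if \<forall>j<k. bs ! j = 0 then amp D d U a (bs ! k # drop (Suc k) bs) a0 else 0)"
  proof (cases "\<forall>j<k. bs ! j = 0")
    case False
    then show ?thesis by (simp only: if_False sum.neutral_const)
  qed simp
  also have "bs ! k # drop (Suc k) bs = drop k bs"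
    using l step.hyps by (intro Cons_nth_drop_Suc) auto
  finally show ?case .
qed

lemma circuit_amp:
  assumes "a0 < D" "0 < d" "a < D" "bs \<in> seqs {..<d} n"
  shows "circuit D d n U (a, bs) (a0, replicate n 0) = amp D d U a bs a0"
  unfolding circuit_def using circuit_suffix[OF assms(1,2), of 0 n a bs U] assms by simp

section \<open>Spectral expansion of the final state\<close>

definition psi :: "nat \<Rightarrow> nat \<Rightarrow> cmat \<Rightarrow> cmat \<Rightarrow> nat \<Rightarrow> nat \<Rightarrow> nat list \<Rightarrow> complex" where
  "psi D d U W i a bs = (\<Sum>k<D. amp D d U a bs k * W k i)"

text \<open>\<open>psi\<close> is the circuit applied to column \<open>i\<close> of \<open>W\<close>
  with all B systems in state 0; \<open>phi\<close> is its partial inner product on A with column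
  \<open>e\<close> of \<open>V\<close>. Since these columns are eigenvectors of \<open>R\<close> and
  \<open>L\<close>, the state \<open>rho_l\<close> is the combination of the reduced operators of
  the \<open>phi\<close> with coefficients \<open>lam e\<close> times
  \<open>\<omega> i\<close>.\<close>

definition phi :: "nat \<Rightarrow> nat \<Rightarrow> cmat \<Rightarrow> cmat \<Rightarrow> cmat \<Rightarrow> nat \<Rightarrow> nat \<Rightarrow> nat list \<Rightarrow> complex" where
  "phi D d V U W e i bs = (\<Sum>a<D. cnj (V a e) * psi D d U W i a bs)"

abbreviation (input) conj_diag :: "nat \<Rightarrow> cmat \<Rightarrow> (nat \<Rightarrow> real) \<Rightarrow> cmat" where
  "conj_diag D V lam \<equiv> mmul D V (mmul D (mdiag D (\<lambda>i. complex_of_real (lam i))) (madj V))"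

lemma conj_diag_entry:
  assumes "a < D" "b < D"
  shows "conj_diag D V lam a b = (\<Sum>e<D. complex_of_real (lam e) * (V a e * cnj (V b e)))"
proof -
  have "mmul D (mdiag D (\<lambda>i. complex_of_real (lam i))) (madj V) e b = complex_of_real (lam e) * cnj (V b e)" if "e < D" for e
  proof -
    have "(\<Sum>k<D. mdiag D (\<lambda>i. complex_of_real (lam i)) e k * madj V k b) = (\<Sum>k<D. if k = e then complex_of_real (lam e) * cnj (V b e) else 0)"
      using that by (intro sum.cong refl) (auto simp: mdiag_def madj_def)
    then show ?thesis using that assms unfolding mmul_def by simp
  qed
  then show ?thesis using assms unfolding mmul_def[of D V] by (simp add: mult_ac)
qed

lemma rho_l_entry:
  assumes d: "0 < d" and n: "n = 2 * t + l" and c: "c \<in> words d l" "c' \<in> words d l"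
  shows "rho_l D d t l L U R c c' = (\<Sum>bs\<in>{bs \<in> seqs {..<d} n. mid t l bs = c}. \<Sum>a<D. \<Sum>a'<D. L a a' *
      (\<Sum>k<D. \<Sum>k'<D. amp D d U a' bs k * R k k' * cnj (amp D d U a (ins t l bs c') k')))"
proof -
  let ?I = "idxs D d n" and ?X = "circuit D d n U" and ?z = "replicate n 0 :: nat list"
  let ?S = "seqs {..<d} n"
  have zS: "?z \<in> ?S" using d unfolding seqs_def by auto
  have inner: "opmul ?I ?X (opmul ?I (init_state n R) (opadj ?X)) (a', bs) (a, bs2)
     = (\<Sum>k<D. \<Sum>k'<D. amp D d U a' bs k * R k k' * cnj (amp D d U a bs2 k'))"
    if "a' < D" "a < D" "bs \<in> ?S" "bs2 \<in> ?S" for a a' bs bs2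
  proof -
    have i: "opmul ?I (init_state n R) (opadj ?X) (k, bk) (a, bs2) =
        (if bk = ?z then (\<Sum>k'<D. R k k' * cnj (amp D d U a bs2 k')) else 0)" for k bk
    proof -
      have "opmul ?I (init_state n R) (opadj ?X) (k, bk) (a, bs2) =
         (\<Sum>k'<D. \<Sum>b\<in>?S. if b = ?z then (if bk = ?z then R k k' * cnj (?X (a, bs2) (k', ?z)) else 0) else 0)"
        unfolding opmul_def sum_idxs init_state_def opadj_def by (intro sum.cong refl) auto
      also have "\<dots> = (\<Sum>k'<D. if bk = ?z then R k k' * cnj (?X (a, bs2) (k', ?z)) else 0)"
        using zS by simp
      also have "\<dots> = (if bk = ?z then (\<Sum>k'<D. R k k' * cnj (amp D d U a bs2 k')) else 0)"
        using that d by (auto simp: circuit_amp)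
      finally show ?thesis .
    qed
    have "opmul ?I ?X (opmul ?I (init_state n R) (opadj ?X)) (a', bs) (a, bs2)
      = (\<Sum>k<D. \<Sum>b\<in>?S. if b = ?z then ?X (a', bs) (k, ?z) * (\<Sum>k'<D. R k k' * cnj (amp D d U a bs2 k')) else 0)"
      unfolding opmul_def[of ?I ?X] sum_idxs i by (intro sum.cong refl) auto
    also have "\<dots> = (\<Sum>k<D. amp D d U a' bs k * (\<Sum>k'<D. R k k' * cnj (amp D d U a bs2 k')))"
      using zS that d by (simp add: circuit_amp)
    finally show ?thesis by (simp add: sum_distrib_left mult.assoc)
  qed
  have tl: "t + l \<le> n" using n by simp
  have outer: "opmul ?I (on_A L) (opmul ?I ?X (opmul ?I (init_state n R) (opadj ?X))) (a, bs) (a, bs2)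
    = (\<Sum>a'<D. L a a' * (\<Sum>k<D. \<Sum>k'<D. amp D d U a' bs k * R k k' * cnj (amp D d U a bs2 k')))"
    if "a < D" "bs \<in> ?S" "bs2 \<in> ?S" for a bs bs2
  proof -
    have "opmul ?I (on_A L) (opmul ?I ?X (opmul ?I (init_state n R) (opadj ?X))) (a, bs) (a, bs2)
      = (\<Sum>a'<D. \<Sum>b\<in>?S. if b = bs then L a a' * opmul ?I ?X (opmul ?I (init_state n R) (opadj ?X)) (a', bs) (a, bs2) else 0)"
      unfolding opmul_def[of ?I "on_A L"] unfolding sum_idxs on_A_def by (intro sum.cong refl) auto
    then show ?thesis using that by (simp add: inner)
  qed
  have "rho_l D d t l L U R c c' = (\<Sum>(a, bs)\<in>{..<D} \<times> {bs \<in> ?S. mid t l bs = c}.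
      opmul ?I (on_A L) (opmul ?I ?X (opmul ?I (init_state n R) (opadj ?X))) (a, bs) (a, ins t l bs c'))"
    unfolding rho_l_def Let_def ptrace_mid_def n[symmetric] mid_def ins_def idxs_eq
    by (intro sum.cong) auto
  also have "\<dots> = (\<Sum>a<D. \<Sum>bs\<in>{bs \<in> ?S. mid t l bs = c}.
      opmul ?I (on_A L) (opmul ?I ?X (opmul ?I (init_state n R) (opadj ?X))) (a, bs) (a, ins t l bs c'))"
    by (simp add: sum.cartesian_product)
  also have "\<dots> = (\<Sum>a<D. \<Sum>bs\<in>{bs \<in> ?S. mid t l bs = c}. \<Sum>a'<D. L a a' *
      (\<Sum>k<D. \<Sum>k'<D. amp D d U a' bs k * R k k' * cnj (amp D d U a (ins t l bs c') k')))"
    using c(2) ins_in_words[OF tl] unfolding words_eq_seqs by (intro sum.cong refl outer) auto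
  finally show ?thesis by (subst sum.swap)
qed

lemma rho_l_reduced:
  assumes d: "0 < d" and n: "n = 2 * t + l" and c: "c \<in> words d l" "c' \<in> words d l"
  shows "rho_l D d t l (conj_diag D V lam) U (conj_diag D W \<omega>) c c' =
    (\<Sum>e<D. \<Sum>i<D. complex_of_real (lam e) * complex_of_real (\<omega> i) * reduced d n t l (phi D d V U W e i) c c')"
proof -
  let ?T = "{bs \<in> seqs {..<d} n. mid t l bs = c}"
  let ?l = "\<lambda>e. complex_of_real (lam e)" and ?w = "\<lambda>i. complex_of_real (\<omega> i)"
  let ?f = "\<lambda>e i bs. phi D d V U W e i bs * cnj (phi D d V U W e i (ins t l bs c'))"
  let ?g = "\<lambda>i a a' bs. psi D d U W i a' bs * cnj (psi D d U W i a (ins t l bs c'))"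
  have R: "(\<Sum>k<D. \<Sum>k'<D. x k * conj_diag D W \<omega> k k' * cnj (y k')) =
     (\<Sum>i<D. ?w i * ((\<Sum>k<D. x k * W k i) * cnj (\<Sum>k<D. y k * W k i)))" for x y
  proof -
    have "(\<Sum>k<D. \<Sum>k'<D. x k * conj_diag D W \<omega> k k' * cnj (y k')) =
       (\<Sum>k<D. \<Sum>k'<D. \<Sum>i<D. ?w i * (x k * W k i * cnj (y k' * W k' i)))"
      by (intro sum.cong refl) (simp add: conj_diag_entry sum_distrib_left sum_distrib_right mult_ac)
    also have "\<dots> = (\<Sum>i<D. \<Sum>k<D. \<Sum>k'<D. ?w i * (x k * W k i * cnj (y k' * W k' i)))"
      by (rule sum_rotate[symmetric])
    finally show ?thesis by (simp only: cnj_sum sum_product) (simp only: sum_distrib_left)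
  qed
  have L: "(\<Sum>a<D. \<Sum>a'<D. conj_diag D V lam a a' * (x a' * cnj (y a))) =
     (\<Sum>e<D. ?l e * ((\<Sum>a<D. cnj (V a e) * x a) * cnj (\<Sum>a<D. cnj (V a e) * y a)))" for x y
  proof -
    have "(\<Sum>a<D. \<Sum>a'<D. conj_diag D V lam a a' * (x a' * cnj (y a))) =
       (\<Sum>a<D. \<Sum>a'<D. \<Sum>e<D. ?l e * (cnj (V a' e) * x a' * cnj (cnj (V a e) * y a)))"
      by (intro sum.cong refl) (simp add: conj_diag_entry sum_distrib_left sum_distrib_right mult_ac)
    also have "\<dots> = (\<Sum>e<D. \<Sum>a<D. \<Sum>a'<D. ?l e * (cnj (V a' e) * x a' * cnj (cnj (V a e) * y a)))"
      by (rule sum_rotate[symmetric])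
    also have "\<dots> = (\<Sum>e<D. \<Sum>a'<D. \<Sum>a<D. ?l e * (cnj (V a' e) * x a' * cnj (cnj (V a e) * y a)))"
      by (rule sum.cong[OF refl], rule sum.swap)
    finally show ?thesis by (simp only: cnj_sum sum_product) (simp only: sum_distrib_left)
  qed
  have "rho_l D d t l (conj_diag D V lam) U (conj_diag D W \<omega>) c c' =
    (\<Sum>bs\<in>?T. \<Sum>a<D. \<Sum>a'<D. conj_diag D V lam a a' * (\<Sum>i<D. ?w i * ?g i a a' bs))"
    unfolding rho_l_entry[OF assms] R psi_def ..
  also have "\<dots> = (\<Sum>bs\<in>?T. \<Sum>a<D. \<Sum>a'<D. \<Sum>i<D. ?w i * (conj_diag D V lam a a' * ?g i a a' bs))"
    unfolding sum_distrib_left by (simp add: mult_ac)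
  also have "\<dots> = (\<Sum>bs\<in>?T. \<Sum>i<D. \<Sum>a<D. \<Sum>a'<D. ?w i * (conj_diag D V lam a a' * ?g i a a' bs))"
    by (rule sum.cong[OF refl], rule sum_rotate[symmetric])
  also have "\<dots> = (\<Sum>bs\<in>?T. \<Sum>i<D. ?w i * (\<Sum>e<D. ?l e * ?f e i bs))"
    unfolding sum_distrib_left[symmetric] L phi_def ..
  also have "\<dots> = (\<Sum>bs\<in>?T. \<Sum>i<D. \<Sum>e<D. ?l e * ?w i * ?f e i bs)"
    unfolding sum_distrib_left by (simp add: mult_ac)
  also have "\<dots> = (\<Sum>bs\<in>?T. \<Sum>e<D. \<Sum>i<D. ?l e * ?w i * ?f e i bs)"
    by (rule sum.cong[OF refl], rule sum.swap)
  also have "\<dots> = (\<Sum>e<D. \<Sum>i<D. \<Sum>bs\<in>?T. ?l e * ?w i * ?f e i bs)"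
    by (rule sum_rotate)
  finally show ?thesis unfolding reduced_def sum_distrib_left .
qed

text \<open>This isolates the spectrum of \<open>L\<close> as a quadratic form in
  \<open>lam\<close>, so that the average over the cube needs only second moments of the
  coordinates.\<close>

lemma tr_sq_rho_l:
  assumes d: "0 < d" and n: "n = 2 * t + l"
  shows "tr_sq d l (rho_l D d t l (conj_diag D V lam) U (conj_diag D W \<omega>)) =
    (\<Sum>e<D. \<Sum>e'<D. complex_of_real (lam e * lam e') *
       (\<Sum>i<D. \<Sum>i'<D. complex_of_real (\<omega> i * \<omega> i') * overlap d n t l (phi D d V U W e i) (phi D d V U W e' i')))"
proof -
  let ?W = "words d l" and ?P = "{..<D} \<times> {..<D}"
  let ?c = "\<lambda>p. complex_of_real (lam (fst p)) * complex_of_real (\<omega> (snd p))"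
  let ?r = "\<lambda>p. reduced d n t l (phi D d V U W (fst p) (snd p))"
  have tl: "t + l \<le> n" using n by simp
  have "tr_sq d l (rho_l D d t l (conj_diag D V lam) U (conj_diag D W \<omega>)) =
     (\<Sum>c\<in>?W. \<Sum>c'\<in>?W. (\<Sum>p\<in>?P. ?c p * ?r p c c') * (\<Sum>q\<in>?P. ?c q * ?r q c' c))"
    unfolding tr_sq_def by (intro sum.cong refl) (simp add: rho_l_reduced[OF d n] sum.cartesian_product case_prod_beta)
  also have "\<dots> = (\<Sum>c\<in>?W. \<Sum>c'\<in>?W. \<Sum>p\<in>?P. \<Sum>q\<in>?P. ?c p * ?c q * (?r p c c' * ?r q c' c))"
    unfolding sum_product by (simp add: mult_ac)
  also have "\<dots> = (\<Sum>c\<in>?W. \<Sum>p\<in>?P. \<Sum>q\<in>?P. \<Sum>c'\<in>?W. ?c p * ?c q * (?r p c c' * ?r q c' c))"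
    by (rule sum.cong[OF refl], rule sum_rotate)
  also have "\<dots> = (\<Sum>p\<in>?P. \<Sum>q\<in>?P. \<Sum>c\<in>?W. \<Sum>c'\<in>?W. ?c p * ?c q * (?r p c c' * ?r q c' c))"
    by (rule sum_rotate)
  also have "\<dots> = (\<Sum>p\<in>?P. \<Sum>q\<in>?P. ?c p * ?c q * overlap d n t l (phi D d V U W (fst p) (snd p)) (phi D d V U W (fst q) (snd q)))"
    unfolding sum_distrib_left[symmetric] trace_reduced[OF tl] ..
  also have "\<dots> = (\<Sum>e<D. \<Sum>i<D. \<Sum>e'<D. \<Sum>i'<D. complex_of_real (lam e * lam e') * (complex_of_real (\<omega> i * \<omega> i') * overlap d n t l (phi D d V U W e i) (phi D d V U W e' i')))"
    by (simp add: sum.cartesian_product' mult_ac)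
  also have "\<dots> = (\<Sum>e<D. \<Sum>e'<D. \<Sum>i<D. \<Sum>i'<D. complex_of_real (lam e * lam e') * (complex_of_real (\<omega> i * \<omega> i') * overlap d n t l (phi D d V U W e i) (phi D d V U W e' i')))"
    by (rule sum.cong[OF refl], rule sum.swap)
  finally show ?thesis unfolding sum_distrib_left .
qed

text \<open>Summing over an orthonormal basis in each slot takes traces over two copies of A, and a
  trace does not depend on the basis. This removes \<open>V\<close> from the purity term, and later
  \<open>W\<close> after it has been moved to the output side.\<close>

lemma sum_overlap_unitary:
  fixes D :: nat
  assumes K: "\<And>a b. a < D \<Longrightarrow> b < D \<Longrightarrow> (\<Sum>x<D. K x a * cnj (K x b)) = (if a = b then 1 else 0)"
  shows "(\<Sum>x<D. \<Sum>y<D. overlap d n t l (\<lambda>bs. \<Sum>a<D. K x a * f a bs) (\<lambda>bs. \<Sum>a<D. K y a * g a bs))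
    = (\<Sum>a<D. \<Sum>b<D. overlap d n t l (f a) (g b))"
proof -
  let ?B = "seqs {..<d} n \<times> seqs {..<d} n"
  have gen: "(\<Sum>x<D. \<Sum>y<D. overlap d n t l (F x) (G y)) =
    (\<Sum>\<beta>\<in>?B. (\<Sum>x<D. F x (fst \<beta>) * cnj (F x (fst (swap_mid t l \<beta>)))) * (\<Sum>y<D. G y (snd \<beta>) * cnj (G y (snd (swap_mid t l \<beta>)))))"
    for F G :: "nat \<Rightarrow> nat list \<Rightarrow> complex"
    unfolding overlap_def sum_product by (subst sum_rotate) (simp add: mult_ac)
  have c: "(\<Sum>x<D. (\<Sum>a<D. K x a * h a u) * cnj (\<Sum>a<D. K x a * h a v)) = (\<Sum>a<D. h a u * cnj (h a v))"
    for h :: "nat \<Rightarrow> nat list \<Rightarrow> complex" and u v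
  proof -
    have "(\<Sum>x<D. (\<Sum>a<D. K x a * h a u) * cnj (\<Sum>a<D. K x a * h a v)) =
       (\<Sum>x<D. \<Sum>a<D. \<Sum>b<D. h a u * cnj (h b v) * (K x a * cnj (K x b)))"
      by (simp add: sum_product mult_ac)
    also have "\<dots> = (\<Sum>a<D. \<Sum>b<D. h a u * cnj (h b v) * (\<Sum>x<D. K x a * cnj (K x b)))"
      unfolding sum_distrib_left by (rule sum_rotate)
    also have "\<dots> = (\<Sum>a<D. \<Sum>b<D. if a = b then h a u * cnj (h a v) else 0)"
      using K by (intro sum.cong refl) auto
    finally show ?thesis by simp
  qed
  show ?thesis unfolding gen c ..
qed

section \<open>Moving \<open>W\<close> into \<open>U\<close>: multiplication by \<open>W\<close>
  tensor the identity\<close>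

definition lift_A :: "nat \<Rightarrow> nat \<Rightarrow> cmat \<Rightarrow> cmat" where
  "lift_A D d W = (\<lambda>r s. if r < D * d \<and> s < D * d \<and> r mod d = s mod d then W (r div d) (s div d) else 0)"

lemma lift_A_entry:
  assumes "b < d" "b' < d" "a < D" "a' < D"
  shows "lift_A D d W (a * d + b) (a' * d + b') = (if b = b' then W a a' else 0)"
  using assms index_less[of a D b d] index_less[of a' D b' d] unfolding lift_A_def by auto

lemma mmul_lift_A_left:
  assumes "a < D" "b < d" "s < D * d"
  shows "mmul (D * d) (lift_A D d W) U (a * d + b) s = (\<Sum>c<D. W a c * U (c * d + b) s)"
proof -
  have "(\<Sum>k<D * d. lift_A D d W (a * d + b) k * U k s) = (\<Sum>c<D. \<Sum>b'<d. lift_A D d W (a * d + b) (c * d + b') * U (c * d + b') s)"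
    by (rule sum_row_index[symmetric])
  also have "\<dots> = (\<Sum>c<D. \<Sum>b'<d. if b' = b then W a c * U (c * d + b) s else 0)"
    using assms by (intro sum.cong refl) (auto simp: lift_A_entry)
  finally show ?thesis using assms index_less[OF assms(1,2)] unfolding mmul_def by simp
qed

lemma mmul_lift_A_right:
  assumes "a < D" "b < d" "r < D * d"
  shows "mmul (D * d) U (lift_A D d W) r (a * d + b) = (\<Sum>c<D. U r (c * d + b) * W c a)"
proof -
  have "(\<Sum>k<D * d. U r k * lift_A D d W k (a * d + b)) = (\<Sum>c<D. \<Sum>b'<d. U r (c * d + b') * lift_A D d W (c * d + b') (a * d + b))"
    by (rule sum_row_index[symmetric])
  also have "\<dots> = (\<Sum>c<D. \<Sum>b'<d. if b' = b then U r (c * d + b) * W c a else 0)"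
    using assms by (intro sum.cong refl) (auto simp: lift_A_entry)
  finally show ?thesis using assms index_less[OF assms(1,2)] unfolding mmul_def by simp
qed

lemma unitary_lift_A:
  assumes W: "unitary_mat D W" and d: "0 < d"
  shows "unitary_mat (D * d) (lift_A D d W)"
proof -
  have "(\<Sum>k<D * d. lift_A D d W r k * cnj (lift_A D d W s k)) = (if r = s then 1 else 0)"
    if rs: "r < D * d" "s < D * d" for r s
  proof -
    have rd: "r div d < D" "s div d < D" "r mod d < d" "s mod d < d"
      using rs d by (auto simp: less_mult_imp_div_less)
    have r: "r = r div d * d + r mod d" and s: "s = s div d * d + s mod d" by simp_all
    have "(\<Sum>k<D * d. lift_A D d W r k * cnj (lift_A D d W s k)) =
       (\<Sum>c<D. \<Sum>b<d. lift_A D d W (r div d * d + r mod d) (c * d + b) * cnj (lift_A D d W (s div d * d + s mod d) (c * d + b)))"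
      unfolding r[symmetric] s[symmetric] by (rule sum_row_index[symmetric])
    also have "\<dots> = (\<Sum>c<D. \<Sum>b<d. if b = r mod d then (if r mod d = s mod d then W (r div d) c * cnj (W (s div d) c) else 0) else 0)"
    proof (intro sum.cong refl)
      fix c b assume "c \<in> {..<D}" "b \<in> {..<d}"
      then show "lift_A D d W (r div d * d + r mod d) (c * d + b) * cnj (lift_A D d W (s div d * d + s mod d) (c * d + b)) =
        (if b = r mod d then (if r mod d = s mod d then W (r div d) c * cnj (W (s div d) c) else 0) else 0)"
        using rd by (subst (1 2) lift_A_entry) auto
    qed
    also have "\<dots> = (if r mod d = s mod d then (\<Sum>c<D. W (r div d) c * cnj (W (s div d) c)) else 0)"
      using rd by simp
    also have "\<dots> = (if r = s then 1 else 0)"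
    proof (cases "r = s")
      case True
      then show ?thesis using unitary_matD[OF W rd(1) rd(1)] by simp
    next
      case False
      then have "r mod d = s mod d \<Longrightarrow> r div d \<noteq> s div d" using r s by metis
      then show ?thesis using False unitary_matD[OF W rd(1,2)] by auto
    qed
    finally show ?thesis .
  qed
  then show ?thesis unfolding unitary_mat_def by (auto simp: lift_A_def)
qed

text \<open>Conjugating the circuit by \<open>W\<close> on \<open>A\<close> makes the initial state diagonal.\<close>
lemma psi_lift_A:
  assumes W: "unitary_mat D W" and i: "i < D"
  shows "a < D \<Longrightarrow> set bs \<subseteq> {..<d} \<Longrightarrow> psi D d (mmul (D * d) (lift_A D d W) U) W i a bs =
    (\<Sum>c<D. W a c * amp D d (mmul (D * d) U (lift_A D d W)) c bs i)"
proof (induction bs arbitrary: a)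
  case Nil
  have "psi D d (mmul (D * d) (lift_A D d W) U) W i a [] = (\<Sum>k<D. if k = a then W a i else 0)"
    unfolding psi_def by (intro sum.cong) auto
  moreover have "(\<Sum>c<D. W a c * amp D d (mmul (D * d) U (lift_A D d W)) c [] i) = (\<Sum>c<D. if c = i then W a i else 0)"
    by (intro sum.cong) auto
  ultimately show ?case using Nil i by simp
next
  case (Cons b bs)
  let ?U = "mmul (D * d) (lift_A D d W) U" and ?U' = "mmul (D * d) U (lift_A D d W)"
  have b: "b < d" "0 < d" using Cons.prems by auto
  have "psi D d ?U W i a (b # bs) = (\<Sum>c<D. ?U (a * d + b) (c * d) * psi D d ?U W i c bs)"
    unfolding psi_def sum_distrib_left by (simp add: sum_distrib_right mult.assoc) (rule sum.swap)
  also have "\<dots> = (\<Sum>c<D. (\<Sum>a'<D. W a a' * U (a' * d + b) (c * d)) * (\<Sum>c'<D. W c c' * amp D d ?U' c' bs i))"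
    using Cons b index_less[of _ D 0 d] by (intro sum.cong refl) (auto simp: mmul_lift_A_left)
  also have "\<dots> = (\<Sum>c<D. \<Sum>a'<D. \<Sum>c'<D. W a a' * (U (a' * d + b) (c * d) * W c c' * amp D d ?U' c' bs i))"
    by (simp add: sum_product mult_ac)
  also have "\<dots> = (\<Sum>a'<D. \<Sum>c'<D. \<Sum>c<D. W a a' * (U (a' * d + b) (c * d) * W c c' * amp D d ?U' c' bs i))"
    by (rule sum_rotate)
  \<comment> \<open>Regrouping moves the lifted \<open>W\<close> of the following factor to the
    right of this \<open>U\<close>; a single \<open>W\<close> remains in front of the whole
    product.\<close>
  also have "\<dots> = (\<Sum>a'<D. W a a' * (\<Sum>c'<D. (\<Sum>c<D. U (a' * d + b) (c * d + 0) * W c c') * amp D d ?U' c' bs i))"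
    by (simp add: sum_distrib_left sum_distrib_right)
  also have "\<dots> = (\<Sum>a'<D. W a a' * (\<Sum>c'<D. ?U' (a' * d + b) (c' * d + 0) * amp D d ?U' c' bs i))"
    using b index_less[of _ D b d] by (intro sum.cong refl arg_cong2[where f = times]) (subst mmul_lift_A_right, auto)
  finally show ?case by simp
qed

text \<open>Left and right multiplication commute, so the pushforward is again left invariant. The
  moment estimates hold for any measure satisfying \<open>is_haar\<close>, and can therefore be
  applied to the pushforward itself.\<close>

lemma is_haar_right:
  assumes h: "is_haar N \<mu>" and X: "unitary_mat N X"
  shows "is_haar N (distr \<mu> borel (\<lambda>U. mmul N U X))"
proof -
  note hd = is_haarD[OF h]
  interpret prob_space \<mu> by fact
  have sp: "space \<mu> = UNIV" using sets_eq_imp_space_eq[OF hd(2)] by simp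
  have m: "(\<lambda>U. mmul N U X) \<in> measurable \<mu> borel"
    unfolding measurable_cong_sets[OF hd(2) refl] by measurable
  let ?\<nu> = "distr \<mu> borel (\<lambda>U. mmul N U X)"
  have ps: "prob_space ?\<nu>" using m by (rule prob_space_distr)
  have "{U. unitary_mat N U} \<in> sets borel"
    using h emeasure_notin_sets[of "{U. unitary_mat N U}" \<mu>] unfolding is_haar_def by auto
  then have "emeasure ?\<nu> {U. unitary_mat N U} = emeasure \<mu> {U. unitary_mat N (mmul N U X)}"
    using m by (subst emeasure_distr) (auto simp: sp vimage_def)
  also have "\<dots> = 1"
  proof -
    have meas: "{U. unitary_mat N (mmul N U X)} \<in> sets \<mu>"
      using measurable_sets[OF m \<open>{U. unitary_mat N U} \<in> sets borel\<close>] by (simp add: sp vimage_def)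
    have "AE U in \<mu>. U \<in> {U. unitary_mat N (mmul N U X)}"
      using hd(3) by eventually_elim (use X unitary_mat_mmul in auto)
    then show ?thesis using meas by (subst (asm) AE_in_set_eq_1) (auto simp: emeasure_eq_measure)
  qed
  finally have e: "emeasure ?\<nu> {U. unitary_mat N U} = 1" .
  have inv: "distr ?\<nu> borel (mmul N V) = ?\<nu>" if V: "unitary_mat N V" for V
  proof -
    have mV: "mmul N V \<in> measurable \<mu> borel"
      unfolding measurable_cong_sets[OF hd(2) refl] by measurable
    have "distr ?\<nu> borel (mmul N V) = distr \<mu> borel (mmul N V \<circ> (\<lambda>U. mmul N U X))"
      by (rule distr_distr[OF measurable_mmul_left m])
    also have "\<dots> = distr \<mu> borel ((\<lambda>U. mmul N U X) \<circ> mmul N V)"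
      by (simp add: comp_def mmul_assoc)
    also have "\<dots> = distr (distr \<mu> borel (mmul N V)) borel (\<lambda>U. mmul N U X)"
      by (rule distr_distr[OF measurable_mmul_right mV, symmetric])
    finally show ?thesis unfolding hd(4)[OF V] .
  qed
  show ?thesis unfolding is_haar_def using ps e inv by simp
qed

subsection \<open>Moments of the uniform distribution on the cube\<close>

lemma unit_interval_moment:
  shows "integrable (restrict_space lborel {0..1::real}) (\<lambda>x. x ^ k)"
    and "(\<integral>x. x ^ k \<partial>restrict_space lborel {0..1::real}) = 1 / real (Suc k)"
proof -
  have b: "has_bochner_integral lborel (\<lambda>x. x ^ k * indicator {0..1::real} x) (1 / real (Suc k))"
  proof -
    have "has_bochner_integral lborel (\<lambda>x. x ^ k * indicator {0..1::real} x)
        (1 ^ Suc k / real (Suc k) - 0 ^ Suc k / real (Suc k))"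
      by (rule has_bochner_integral_FTC_Icc_real) (auto intro!: derivative_eq_intros continuous_intros simp del: of_nat_Suc power_Suc)
    then show ?thesis by simp
  qed
  have s: "{0..1::real} \<inter> space lborel \<in> sets lborel" by simp
  show "integrable (restrict_space lborel {0..1::real}) (\<lambda>x. x ^ k)"
    using b unfolding integrable_restrict_space[OF s] has_bochner_integral_iff by (simp add: mult.commute)
  show "(\<integral>x. x ^ k \<partial>restrict_space lborel {0..1::real}) = 1 / real (Suc k)"
    using b unfolding integral_restrict_space[OF s] has_bochner_integral_iff by (simp add: mult.commute)
qed

text \<open>The means are 1/2 and the second moments 1/3; the diagonal excess is the variance 1/3 -
  1/4 = 1/12.\<close>

lemma cube_second_moment:
  assumes e: "e < D" "e' < D"
  shows "integrable (unif_cube D) (\<lambda>lam. lam e * lam e')"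
    and "(\<integral>lam. lam e * lam e' \<partial>unif_cube D) = 1 / 4 + (if e = e' then 1 / 12 else 0)"
proof -
  let ?M = "\<lambda>_ :: nat. restrict_space lborel {0..1::real}"
  have "emeasure lborel {0..1::real} = 1" by simp
  then have "prob_space (restrict_space lborel {0..1::real})"
    by (intro prob_spaceI) (simp add: emeasure_restrict_space space_restrict_space)
  then interpret prob_space "?M i" for i .
  interpret product_sigma_finite ?M by standard
  \<comment> \<open>Exponents that add up treat equal and different indices alike, as a product of
    one-dimensional moments.\<close>
  define k where "k = (\<lambda>i. (if i = e then 1 else 0) + (if i = e' then 1 else (0::nat)))"
  have p: "(\<Prod>i<D. lam i ^ k i) = lam e * lam e'" for lam :: "nat \<Rightarrow> real"
  proof -
    have "(\<Prod>i<D. lam i ^ k i) = (\<Prod>i<D. (if i = e then lam e else 1) * (if i = e' then lam e' else 1))"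
      unfolding k_def by (intro prod.cong refl) (auto simp: power2_eq_square)
    then show ?thesis using e by (simp add: prod.distrib)
  qed
  show "integrable (unif_cube D) (\<lambda>lam. lam e * lam e')"
    using product_integrable_prod[of "{..<D}" "\<lambda>i x. x ^ k i"] unit_interval_moment(1) unfolding unif_cube_def p by simp
  have "(\<integral>lam. lam e * lam e' \<partial>unif_cube D) = (\<Prod>i<D. 1 / real (Suc (k i)))"
    using product_integral_prod[of "{..<D}" "\<lambda>i x. x ^ k i"] unit_interval_moment unfolding unif_cube_def p by simp
  also have "\<dots> = 1 / 4 + (if e = e' then 1 / 12 else 0)"
  proof (cases "e = e'")
    case True
    have "(\<Prod>i<D. 1 / real (Suc (k i))) = (\<Prod>i<D. if i = e then 1 / 3 else 1)"
      using True unfolding k_def by (intro prod.cong refl) auto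
    then show ?thesis using True e by simp
  next
    case False
    have "(\<Prod>i<D. 1 / real (Suc (k i))) = (\<Prod>i<D. (if i = e then 1 / 2 else 1) * (if i = e' then 1 / 2 else 1))"
      using False unfolding k_def by (intro prod.cong refl) auto
    then show ?thesis using False e by (simp add: prod.distrib)
  qed
  finally show "(\<integral>lam. lam e * lam e' \<partial>unif_cube D) = 1 / 4 + (if e = e' then 1 / 12 else 0)" .
qed

lemma cube_quadratic_form:
  fixes c :: "nat \<Rightarrow> nat \<Rightarrow> complex"
  shows "(\<integral>lam. (\<Sum>e<D. \<Sum>e'<D. complex_of_real (lam e * lam e') * c e e') \<partial>unif_cube D) =
     (1 / 4) * (\<Sum>e<D. \<Sum>e'<D. c e e') + (1 / 12) * (\<Sum>e<D. c e e)"
proof -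
  have i: "integrable (unif_cube D) (\<lambda>lam. complex_of_real (lam e * lam e') * c e e')"
    and v: "(\<integral>lam. complex_of_real (lam e * lam e') * c e e' \<partial>unif_cube D) = (1 / 4 + (if e = e' then 1 / 12 else 0)) * c e e'"
    if "e < D" "e' < D" for e e'
  proof -
    have "integrable (unif_cube D) (\<lambda>lam. complex_of_real (lam e * lam e'))"
      by (intro integrable_of_real cube_second_moment that)
    then show "integrable (unif_cube D) (\<lambda>lam. complex_of_real (lam e * lam e') * c e e')"
      by (rule integrable_mult_left)
    have "(\<integral>lam. complex_of_real (lam e * lam e') * c e e' \<partial>unif_cube D) =
        complex_of_real (\<integral>lam. lam e * lam e' \<partial>unif_cube D) * c e e'"
      by (subst integral_mult_left_zero) (simp only: integral_complex_of_real)
    then show "(\<integral>lam. complex_of_real (lam e * lam e') * c e e' \<partial>unif_cube D) = (1 / 4 + (if e = e' then 1 / 12 else 0)) * c e e'"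
      unfolding cube_second_moment(2)[OF that] by (auto split: if_splits)
  qed
  have "(\<integral>lam. (\<Sum>e<D. \<Sum>e'<D. complex_of_real (lam e * lam e') * c e e') \<partial>unif_cube D) =
     (\<Sum>e<D. \<integral>lam. (\<Sum>e'<D. complex_of_real (lam e * lam e') * c e e') \<partial>unif_cube D)"
    using i by (intro Bochner_Integration.integral_sum Bochner_Integration.integrable_sum) auto
  also have "\<dots> = (\<Sum>e<D. \<Sum>e'<D. \<integral>lam. complex_of_real (lam e * lam e') * c e e' \<partial>unif_cube D)"
    using i by (intro sum.cong refl Bochner_Integration.integral_sum) auto
  also have "\<dots> = (\<Sum>e<D. \<Sum>e'<D. 1 / 4 * c e e' + (if e = e' then 1 / 12 * c e e else 0))"
    using v by (intro sum.cong refl) (auto simp: algebra_simps)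
  finally show ?thesis by (simp add: sum.distrib sum_distrib_left)
qed

subsection \<open>Iterated integrals\<close>

lemma bmeas_compose:
  assumes "bmeas M S f" "g \<in> measurable M' M" "\<And>x. x \<in> S' \<Longrightarrow> g x \<in> S"
  shows "bmeas M' S' (\<lambda>x. f (g x))"
proof -
  obtain B where "f \<in> borel_measurable M" "\<forall>x\<in>S. cmod (f x) \<le> B" using assms(1) unfolding bmeas_def by blast
  then show ?thesis using assms(2,3) by (intro bmeasI[where B = B] measurable_compose[of g M' M f]) auto
qed

lemma AE_pair_Times:
  assumes "prob_space M1" "prob_space M2" and S: "S1 \<in> sets M1" "S2 \<in> sets M2"
    and ae: "AE x in M1. x \<in> S1" "AE y in M2. y \<in> S2"
  shows "AE z in M1 \<Otimes>\<^sub>M M2. z \<in> S1 \<times> S2"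
proof -
  interpret M1: prob_space M1 by fact
  interpret M2: prob_space M2 by fact
  interpret pair_sigma_finite M1 M2 ..
  have "{z \<in> space (M1 \<Otimes>\<^sub>M M2). z \<in> S1 \<times> S2} = S1 \<times> S2"
    using sets.sets_into_space[OF S(1)] sets.sets_into_space[OF S(2)] by (auto simp: space_pair_measure)
  then show ?thesis
    using S ae by (intro AE_pair_measure) auto
qed

lemma integral_le_const_AE:
  fixes f :: "'a \<Rightarrow> real"
  assumes "prob_space M" "integrable M f" "AE x in M. f x \<le> c"
  shows "(\<integral>x. f x \<partial>M) \<le> c"
proof -
  interpret prob_space M by fact
  show ?thesis using integral_mono_AE[OF assms(2) integrable_const assms(3)] by (simp add: prob_space)
qed

text \<open>Together with \<open>integral_pair_le_snd\<close> this permits choosing which variable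
  is averaged first: \<open>U\<close> for the purity part, \<open>V\<close> for the fluctuation
  part.\<close>

lemma integral_pair_le_fst:
  fixes f :: "'a \<times> 'b \<Rightarrow> real"
  assumes "prob_space M1" "prob_space M2" and f: "integrable (M1 \<Otimes>\<^sub>M M2) f"
    and le: "AE x in M1. (\<integral>y. f (x, y) \<partial>M2) \<le> c"
  shows "(\<integral>z. f z \<partial>(M1 \<Otimes>\<^sub>M M2)) \<le> c"
proof -
  interpret M1: prob_space M1 by fact
  interpret M2: prob_space M2 by fact
  interpret pair_sigma_finite M1 M2 ..
  show ?thesis
    unfolding integral_fst'[OF f, symmetric]
    by (rule integral_le_const_AE[OF assms(1) integrable_fst'[OF f] le])
qed

lemma integral_pair_le_snd:
  fixes f :: "'a \<times> 'b \<Rightarrow> real"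
  assumes "prob_space M1" "prob_space M2" and f: "integrable (M1 \<Otimes>\<^sub>M M2) f"
    and le: "AE y in M2. (\<integral>x. f (x, y) \<partial>M1) \<le> c"
  shows "(\<integral>z. f z \<partial>(M1 \<Otimes>\<^sub>M M2)) \<le> c"
proof -
  interpret M1: prob_space M1 by fact
  interpret M2: prob_space M2 by fact
  interpret pair_sigma_finite M1 M2 ..
  have f': "integrable (M1 \<Otimes>\<^sub>M M2) (case_prod (\<lambda>x y. f (x, y)))" using f by simp
  have "(\<integral>z. f z \<partial>(M1 \<Otimes>\<^sub>M M2)) = (\<integral>y. (\<integral>x. f (x, y) \<partial>M1) \<partial>M2)"
    using integral_snd[OF f'] by simp
  also have "\<dots> \<le> c"
    by (rule integral_le_const_AE[OF assms(2) integrable_snd[OF f'] le])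
  finally show ?thesis .
qed

lemma bmeas_psi [intro]:
  assumes "\<And>i j. bmeas M S (\<lambda>x. U x i j)" "\<And>i j. bmeas M S (\<lambda>x. W x i j)"
  shows "bmeas M S (\<lambda>x. psi D d (U x) (W x) i a bs)"
  unfolding psi_def by (intro bmeas_sum bmeas_mult bmeas_amp assms)

lemma bmeas_phi [intro]:
  assumes "\<And>i j. bmeas M S (\<lambda>x. V x i j)" "\<And>i j. bmeas M S (\<lambda>x. U x i j)" "\<And>i j. bmeas M S (\<lambda>x. W x i j)"
  shows "bmeas M S (\<lambda>x. phi D d (V x) (U x) (W x) e i bs)"
  unfolding phi_def by (intro bmeas_sum bmeas_mult bmeas_cnj bmeas_psi assms)

lemma bmeas_overlap [intro]:
  assumes "\<And>bs. bmeas M S (\<lambda>x. f x bs)" "\<And>bs. bmeas M S (\<lambda>x. g x bs)"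
  shows "bmeas M S (\<lambda>x. overlap d n t l (f x) (g x))"
  unfolding overlap_def by (intro bmeas_sum bmeas_mult bmeas_cnj assms)

lemma overlap_cong:
  assumes tl: "t + l \<le> n" and "\<And>bs. bs \<in> seqs {..<d} n \<Longrightarrow> f bs = f' bs" "\<And>bs. bs \<in> seqs {..<d} n \<Longrightarrow> g bs = g' bs"
  shows "overlap d n t l f g = overlap d n t l f' g'"
  unfolding overlap_def
proof (intro sum.cong refl)
  fix \<beta> assume "\<beta> \<in> seqs {..<d} n \<times> seqs {..<d} n"
  moreover from this have "swap_mid t l \<beta> \<in> seqs {..<d} n \<times> seqs {..<d} n" by (rule swap_mid_closed[OF tl])
  ultimately show "f (fst \<beta>) * g (snd \<beta>) * cnj (f (fst (swap_mid t l \<beta>)) * g (snd (swap_mid t l \<beta>))) =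
     f' (fst \<beta>) * g' (snd \<beta>) * cnj (f' (fst (swap_mid t l \<beta>)) * g' (snd (swap_mid t l \<beta>)))"
    using assms(2,3) by (simp add: mem_Times_iff)
qed

section \<open>Bounding the two parts of the spectral average and assembling them\<close>

text \<open>The two parts of the average over the spectrum of \<open>L\<close>: the purity for \<open>L = 1\<close>, and an upper bound
  for the contribution of the fluctuations of the spectrum.\<close>
definition purity_part :: "nat \<Rightarrow> nat \<Rightarrow> nat \<Rightarrow> nat \<Rightarrow> nat \<Rightarrow> (nat \<Rightarrow> real) \<Rightarrow> cmat \<Rightarrow> cmat \<Rightarrow> complex" where
  "purity_part D d n t l \<omega> U W = (\<Sum>i<D. \<Sum>i'<D. complex_of_real (\<omega> i * \<omega> i') *
     (\<Sum>a<D. \<Sum>a'<D. overlap d n t l (psi D d U W i a) (psi D d U W i' a')))"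

definition fluct_part :: "nat \<Rightarrow> nat \<Rightarrow> nat \<Rightarrow> (nat \<Rightarrow> real) \<Rightarrow> cmat \<Rightarrow> cmat \<Rightarrow> cmat \<Rightarrow> real" where
  "fluct_part D d n \<omega> V U W = (\<Sum>e<D. \<Sum>i<D. \<Sum>i'<D. \<omega> i * \<omega> i' *
     (\<Sum>\<beta>\<in>seqs {..<d} n \<times> seqs {..<d} n. (cmod (phi D d V U W e i (fst \<beta>) * phi D d V U W e i' (snd \<beta>)))\<^sup>2))"

text \<open>In the term with weight 1/4 both eigenvector indices are summed freely, so completeness
  of the columns of \<open>V\<close> removes \<open>V\<close>. In the term with weight 1/12 the
  indices coincide, and the overlap is bounded by the product of the squared norms; nonnegativity of
  \<open>\<omega>\<close> preserves the inequality.\<close>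

lemma spectrum_average_le:
  assumes d: "0 < d" and n: "n = 2 * t + l" and V: "unitary_mat D V" and \<omega>: "\<And>i. i < D \<Longrightarrow> 0 \<le> \<omega> i"
  shows "Re (\<integral>lam. tr_sq d l (rho_l D d t l (conj_diag D V lam) U (conj_diag D W \<omega>)) \<partial>unif_cube D)
    \<le> Re (purity_part D d n t l \<omega> U W) / 4 + fluct_part D d n \<omega> V U W / 12"
proof -
  have tl: "t + l \<le> n" using n by simp
  define Q where "Q = (\<lambda>e e'. \<Sum>i<D. \<Sum>i'<D. complex_of_real (\<omega> i * \<omega> i') * overlap d n t l (phi D d V U W e i) (phi D d V U W e' i'))"
  have "(\<Sum>e<D. \<Sum>e'<D. Q e e') = (\<Sum>i<D. \<Sum>i'<D. \<Sum>e<D. \<Sum>e'<D. complex_of_real (\<omega> i * \<omega> i') * overlap d n t l (phi D d V U W e i) (phi D d V U W e' i'))"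
  proof -
    have "(\<Sum>e<D. \<Sum>e'<D. Q e e') = (\<Sum>e<D. \<Sum>i<D. \<Sum>i'<D. \<Sum>e'<D. complex_of_real (\<omega> i * \<omega> i') * overlap d n t l (phi D d V U W e i) (phi D d V U W e' i'))"
      unfolding Q_def by (rule sum.cong[OF refl], rule sum_rotate)
    also have "\<dots> = (\<Sum>i<D. \<Sum>i'<D. \<Sum>e<D. \<Sum>e'<D. complex_of_real (\<omega> i * \<omega> i') * overlap d n t l (phi D d V U W e i) (phi D d V U W e' i'))"
      by (rule sum_rotate)
    finally show ?thesis .
  qed
  also have "\<dots> = purity_part D d n t l \<omega> U W"
  proof -
    have "(\<Sum>e<D. \<Sum>e'<D. overlap d n t l (phi D d V U W e i) (phi D d V U W e' i')) =
       (\<Sum>a<D. \<Sum>a'<D. overlap d n t l (psi D d U W i a) (psi D d U W i' a'))" for i i'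
      unfolding phi_def[abs_def]
    proof (rule sum_overlap_unitary)
      fix a b assume "a < D" "b < D"
      then show "(\<Sum>x<D. cnj (V a x) * cnj (cnj (V b x))) = (if a = b then 1 else 0)"
        using unitary_matD[OF V, of b a] by (simp add: mult.commute eq_commute)
    qed
    then show ?thesis unfolding purity_part_def sum_distrib_left[symmetric] by simp
  qed
  finally have Q1: "(\<Sum>e<D. \<Sum>e'<D. Q e e') = purity_part D d n t l \<omega> U W" .
  have "Re (\<Sum>e<D. Q e e) = (\<Sum>e<D. \<Sum>i<D. \<Sum>i'<D. \<omega> i * \<omega> i' * Re (overlap d n t l (phi D d V U W e i) (phi D d V U W e i')))"
    unfolding Q_def by (simp del: of_real_mult)
  also have "\<dots> \<le> fluct_part D d n \<omega> V U W"
    unfolding fluct_part_def using \<omega> Re_overlap_le[OF tl]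
    by (intro sum_mono mult_left_mono) (auto simp: sum_norm_product)
  finally have Q2: "Re (\<Sum>e<D. Q e e) \<le> fluct_part D d n \<omega> V U W" .
  have "(\<integral>lam. tr_sq d l (rho_l D d t l (conj_diag D V lam) U (conj_diag D W \<omega>)) \<partial>unif_cube D)
     = (1 / 4) * (\<Sum>e<D. \<Sum>e'<D. Q e e') + (1 / 12) * (\<Sum>e<D. Q e e)"
    unfolding tr_sq_rho_l[OF d n] Q_def by (rule cube_quadratic_form)
  then show ?thesis using Q2 unfolding Q1 by (simp add: Re_divide_numeral)
qed

text \<open>Translating \<open>U\<close> on the left by \<open>W\<close> tensor the identity turns
  the circuit into one that starts in basis state \<open>i\<close>, driven by \<open>U\<close>
  multiplied by the same matrix on the right. The remaining \<open>W\<close> on the output of A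
  drops out of the trace, and the overlap bound is averaged with the weights
  \<open>\<omega> i * \<omega> i'\<close> of total mass 1.\<close>

lemma purity_part_haar_le:
  assumes h: "is_haar (D * d) \<mu>" and W: "unitary_mat D W" and d: "2 \<le> d" and n: "3 \<le> n" and D: "n ^ 5 \<le> D"
    and tl: "t + l \<le> n" and \<omega>: "\<And>i. i < D \<Longrightarrow> 0 \<le> \<omega> i" "(\<Sum>i<D. \<omega> i) = 1"
  shows "(\<integral>U. Re (purity_part D d n t l \<omega> U W) \<partial>\<mu>) \<le> 1 / real d ^ l + 22 * (real (2 * n) ^ 3 / real D)"
proof -
  note hd = is_haarD[OF h]
  define X where "X = lift_A D d W"
  have X: "unitary_mat (D * d) X" unfolding X_def by (rule unitary_lift_A[OF W]) (use d in auto)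
  define \<nu> where "\<nu> = distr \<mu> borel (\<lambda>U. mmul (D * d) U X)"
  have h\<nu>: "is_haar (D * d) \<nu>" unfolding \<nu>_def by (rule is_haar_right[OF h X])
  note h\<nu>d = is_haarD[OF h\<nu>]
  define G where "G = (\<lambda>i i' U. \<Sum>a<D. \<Sum>a'<D. Re (overlap d n t l (\<lambda>bs. amp D d U a bs i) (\<lambda>bs. amp D d U a' bs i')))"
  have "bmeas \<mu> {U. unitary_mat (D * d) U} (\<lambda>U. purity_part D d n t l \<omega> U W)"
    unfolding purity_part_def
    by (intro bmeas_sum bmeas_mult bmeas_const bmeas_overlap bmeas_psi bmeas_entry hd(2))
  then have intP: "integrable \<mu> (\<lambda>U. Re (purity_part D d n t l \<omega> U W))"
    by (intro integrable_Re bmeas_integrable[OF hd(1) _ hd(3)])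
  have bG: "bmeas \<nu> {U. unitary_mat (D * d) U} (\<lambda>U. \<Sum>a<D. \<Sum>a'<D. overlap d n t l (\<lambda>bs. amp D d U a bs i) (\<lambda>bs. amp D d U a' bs i'))" for i i'
    by (intro bmeas_sum bmeas_overlap bmeas_amp bmeas_entry h\<nu>d(2))
  have intG: "integrable \<nu> (G i i')" for i i'
    using integrable_Re[OF bmeas_integrable[OF h\<nu>d(1) bG h\<nu>d(3)]] unfolding G_def by simp
  have shift: "Re (purity_part D d n t l \<omega> (mmul (D * d) X U) W) = (\<Sum>i<D. \<Sum>i'<D. \<omega> i * \<omega> i' * G i i' (mmul (D * d) U X))" for U
  proof -
    have "(\<Sum>a<D. \<Sum>a'<D. overlap d n t l (psi D d (mmul (D * d) X U) W i a) (psi D d (mmul (D * d) X U) W i' a')) =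
       (\<Sum>a<D. \<Sum>a'<D. overlap d n t l (\<lambda>bs. amp D d (mmul (D * d) U X) a bs i) (\<lambda>bs. amp D d (mmul (D * d) U X) a' bs i'))"
      if "i < D" "i' < D" for i i'
    proof -
      have "(\<Sum>a<D. \<Sum>a'<D. overlap d n t l (psi D d (mmul (D * d) X U) W i a) (psi D d (mmul (D * d) X U) W i' a')) =
        (\<Sum>a<D. \<Sum>a'<D. overlap d n t l (\<lambda>bs. \<Sum>c<D. W a c * amp D d (mmul (D * d) U X) c bs i) (\<lambda>bs. \<Sum>c<D. W a' c * amp D d (mmul (D * d) U X) c bs i'))"
        using that unfolding X_def
        by (intro sum.cong refl overlap_cong[OF tl] psi_lift_A[OF W]) (auto simp: seqs_def)
      also have "\<dots> = (\<Sum>a<D. \<Sum>a'<D. overlap d n t l (\<lambda>bs. amp D d (mmul (D * d) U X) a bs i) (\<lambda>bs. amp D d (mmul (D * d) U X) a' bs i'))"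
        by (rule sum_overlap_unitary[where K = W and f = "\<lambda>a bs. amp D d (mmul (D * d) U X) a bs i"
              and g = "\<lambda>a bs. amp D d (mmul (D * d) U X) a bs i'"]) (rule unitary_mat_cols[OF W])
      finally show ?thesis .
    qed
    then show ?thesis unfolding purity_part_def G_def by (simp del: of_real_mult)
  qed
  have "(\<integral>U. Re (purity_part D d n t l \<omega> U W) \<partial>\<mu>) = (\<integral>U. Re (purity_part D d n t l \<omega> (mmul (D * d) X U) W) \<partial>\<mu>)"
    by (rule haar_shift(2)[OF h X intP, symmetric])
  also have "\<dots> = (\<integral>U. (\<Sum>i<D. \<Sum>i'<D. \<omega> i * \<omega> i' * G i i' U) \<partial>\<nu>)"
    unfolding shift \<nu>_def
  proof (rule integral_distr[symmetric])
    show "(\<lambda>U. mmul (D * d) U X) \<in> measurable \<mu> borel"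
      unfolding measurable_cong_sets[OF hd(2) refl] by measurable
    have "(\<lambda>U. \<Sum>i<D. \<Sum>i'<D. \<omega> i * \<omega> i' * G i i' U) \<in> borel_measurable \<nu>"
      using intG by (intro borel_measurable_integrable) auto
    then show "(\<lambda>U. \<Sum>i<D. \<Sum>i'<D. \<omega> i * \<omega> i' * G i i' U) \<in> borel_measurable borel"
      by (simp add: measurable_cong_sets[OF h\<nu>d(2) refl])
  qed
  also have "\<dots> = (\<Sum>i<D. \<Sum>i'<D. \<omega> i * \<omega> i' * (\<integral>U. G i i' U \<partial>\<nu>))"
    using intG by simp
  also have "\<dots> \<le> (\<Sum>i<D. \<Sum>i'<D. \<omega> i * \<omega> i' * (1 / real d ^ l + 22 * (real (2 * n) ^ 3 / real D)))"
    unfolding G_def using \<omega>(1)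
    by (intro sum_mono mult_left_mono expected_overlap_le[OF h\<nu> _ _ d n D tl]) auto
  also have "\<dots> = (\<Sum>i<D. \<omega> i) * (\<Sum>i<D. \<omega> i) * (1 / real d ^ l + 22 * (real (2 * n) ^ 3 / real D))"
    by (simp only: sum_product) (simp only: sum_distrib_right)
  finally show ?thesis unfolding \<omega>(2) by simp
qed

text \<open>For fixed \<open>U\<close> and \<open>W\<close> the vectors \<open>psi\<close> are
  normalized, so the column moment bound gives at most 4 / (D - 2)^2 for each \<open>e\<close>; the
  \<open>D\<close> eigenvectors together contribute the stated order \<open>1 / D\<close>.\<close>

lemma fluct_part_haar_le:
  assumes h: "is_haar D \<mu>" and U: "unitary_mat (D * d) U" and W: "unitary_mat D W" and d: "0 < d" and D: "2 < D"
    and \<omega>: "\<And>i. i < D \<Longrightarrow> 0 \<le> \<omega> i" "(\<Sum>i<D. \<omega> i) = 1"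
  shows "(\<integral>V. fluct_part D d n \<omega> V U W \<partial>\<mu>) \<le> 4 * real D / (real D - 2)\<^sup>2"
proof -
  note hd = is_haarD[OF h]
  let ?B = "seqs {..<d} n \<times> seqs {..<d} n"
  let ?y = "\<lambda>i i' a a' \<beta>. psi D d U W i a (fst \<beta>) * psi D d U W i' a' (snd \<beta>)"
  define F where "F = (\<lambda>e i i' \<beta> V. (cmod (phi D d V U W e i (fst \<beta>) * phi D d V U W e i' (snd \<beta>)))\<^sup>2)"
  have bF: "bmeas \<mu> {V. unitary_mat D V} (\<lambda>V. phi D d V U W e i (fst \<beta>) * phi D d V U W e i' (snd \<beta>))" for e i i' \<beta>
    by (intro bmeas_mult bmeas_phi bmeas_entry bmeas_const hd(2))
  have intF: "integrable \<mu> (F e i i' \<beta>)" for e i i' \<beta>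
    unfolding F_def by (rule bmeas_norm_square_integrable[OF hd(1) bF hd(3)])
  have norm1: "(\<Sum>a<D. \<Sum>bs\<in>seqs {..<d} n. (cmod (psi D d U W i a bs))\<^sup>2) = 1" if "i < D" for i
  proof -
    have "complex_of_real (\<Sum>k<D. (cmod (W k i))\<^sup>2) = 1"
      using unitary_mat_cols[OF W that that] by (simp add: of_real_cmod_square)
    then have "(\<Sum>k<D. (cmod (W k i))\<^sup>2) = 1" using of_real_eq_1_iff by blast
    then show ?thesis unfolding psi_def amp_norm[OF U d] .
  qed
  have one: "(\<integral>V. F e i i' \<beta> V \<partial>\<mu>) \<le> 4 / (real D - 2)\<^sup>2 * (\<Sum>a<D. \<Sum>a'<D. (cmod (?y i i' a a' \<beta>))\<^sup>2)"
    if e: "e < D" for e i i' \<beta>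
  proof -
    \<comment> \<open>Conjugation does not change the modulus and yields a polynomial in column
      \<open>e\<close> of \<open>V\<close> free of conjugates, as the moment bound requires.\<close>
    have "F e i i' \<beta> V = (cmod (\<Sum>a<D. \<Sum>a'<D. cnj (?y i i' a a' \<beta>) * (V a e * V a' e)))\<^sup>2" for V
    proof -
      have "phi D d V U W e i (fst \<beta>) * phi D d V U W e i' (snd \<beta>) =
         cnj (\<Sum>a<D. \<Sum>a'<D. cnj (?y i i' a a' \<beta>) * (V a e * V a' e))"
        unfolding phi_def sum_product by (simp add: mult_ac)
      then show ?thesis unfolding F_def by (simp only: complex_mod_cnj)
    qed
    then show ?thesis
      using column_moment_le[OF h D e, of "\<lambda>a a'. cnj (?y i i' a a' \<beta>)"]
      by (simp only: complex_mod_cnj)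
  qed
  have total: "(\<Sum>\<beta>\<in>?B. \<Sum>a<D. \<Sum>a'<D. (cmod (?y i i' a a' \<beta>))\<^sup>2) = 1"
    if i: "i < D" "i' < D" for i i'
  proof -
    have "(\<Sum>\<beta>\<in>?B. \<Sum>a<D. \<Sum>a'<D. (cmod (?y i i' a a' \<beta>))\<^sup>2)
      = (\<Sum>a<D. \<Sum>a'<D. \<Sum>\<beta>\<in>?B. (cmod (?y i i' a a' \<beta>))\<^sup>2)"
      by (rule sum_rotate)
    also have "\<dots> = (\<Sum>a<D. \<Sum>bs\<in>seqs {..<d} n. (cmod (psi D d U W i a bs))\<^sup>2) * (\<Sum>a'<D. \<Sum>bs\<in>seqs {..<d} n. (cmod (psi D d U W i' a' bs))\<^sup>2)"
      unfolding sum_norm_product by (simp only: sum_product)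
    finally show ?thesis using norm1 i by simp
  qed
  have "fluct_part D d n \<omega> V U W = (\<Sum>e<D. \<Sum>i<D. \<Sum>i'<D. \<omega> i * \<omega> i' * (\<Sum>\<beta>\<in>?B. F e i i' \<beta> V))" for V
    unfolding fluct_part_def F_def ..
  then have "(\<integral>V. fluct_part D d n \<omega> V U W \<partial>\<mu>) = (\<Sum>e<D. \<Sum>i<D. \<Sum>i'<D. \<omega> i * \<omega> i' * (\<Sum>\<beta>\<in>?B. \<integral>V. F e i i' \<beta> V \<partial>\<mu>))"
    using intF by simp
  also have "\<dots> \<le> (\<Sum>e<D. \<Sum>i<D. \<Sum>i'<D. \<omega> i * \<omega> i' * (4 / (real D - 2)\<^sup>2))"
  proof (intro sum_mono mult_left_mono)
    fix e i i' assume e: "e \<in> {..<D}" and i: "i \<in> {..<D}" "i' \<in> {..<D}"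
    have "(\<Sum>\<beta>\<in>?B. \<integral>V. F e i i' \<beta> V \<partial>\<mu>) \<le> (\<Sum>\<beta>\<in>?B. 4 / (real D - 2)\<^sup>2 * (\<Sum>a<D. \<Sum>a'<D. (cmod (?y i i' a a' \<beta>))\<^sup>2))"
      using e by (intro sum_mono one) auto
    also have "\<dots> = 4 / (real D - 2)\<^sup>2" unfolding sum_distrib_left[symmetric] using total i by simp
    finally show "(\<Sum>\<beta>\<in>?B. \<integral>V. F e i i' \<beta> V \<partial>\<mu>) \<le> 4 / (real D - 2)\<^sup>2" .
  qed (use \<omega> in auto)
  also have "\<dots> = (\<Sum>e<D. (\<Sum>i<D. \<omega> i) * (\<Sum>i<D. \<omega> i) * (4 / (real D - 2)\<^sup>2))"
    by (simp only: sum_product) (simp only: sum_distrib_right)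
  finally show ?thesis unfolding \<omega>(2) by (simp add: mult.commute)
qed

text \<open>As \<open>D\<close> is at least 3^5, \<open>D - 2\<close> is at least half of
  \<open>D\<close>, and the fluctuation term is at most 16 n^3 / D. The purity error is 22 * 8 = 176
  times n^3 / D, and 176/4 + 16/12 is below 46. Estimating n^3 by n^4, hence by D^(4/5), produces
  exactly the exponent -1/5.\<close>

lemma error_terms_le:
  fixes n D :: nat
  assumes n: "3 \<le> n" and D: "n ^ 5 \<le> D"
  shows "22 * (real (2 * n) ^ 3 / real D) / 4 + 4 * real D / (real D - 2)\<^sup>2 / 12 \<le> 46 * real D powr (- 1 / 5)"
proof -
  have "3 ^ 5 \<le> n ^ 5" using n by (rule power_mono) simp
  then have D4: "4 \<le> D" using D by simp
  then have D0: "0 < real D" by simp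
  have "(real D / 2)\<^sup>2 \<le> (real D - 2)\<^sup>2" using D4 by (intro power_mono) auto
  then have "4 * real D / (real D - 2)\<^sup>2 \<le> 4 * real D / (real D / 2)\<^sup>2"
    using D0 D4 by (intro divide_left_mono mult_pos_pos) auto
  also have "\<dots> = 16 / real D" using D0 by (simp add: power2_eq_square field_simps)
  also have "\<dots> \<le> 16 * (real n ^ 3 / real D)"
    using n D0 by (simp add: divide_right_mono one_le_power)
  finally have f: "4 * real D / (real D - 2)\<^sup>2 \<le> 16 * (real n ^ 3 / real D)" .
  have p: "22 * (real (2 * n) ^ 3 / real D) = 176 * (real n ^ 3 / real D)"
    by (simp add: power_mult_distrib)
  have "real n ^ 3 / real D \<le> real D powr (- 1 / 5)"
  proof -
    have n0: "0 < real n" using n by simp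
    have "real n ^ 3 \<le> real n ^ 4" using n by (intro power_increasing) auto
    also have "real n ^ 4 = real n powr 4" using n0 by (simp add: powr_numeral)
    also have "\<dots> = (real n powr 5) powr (4 / 5)" unfolding powr_powr by simp
    also have "real n powr 5 = real n ^ 5" using n0 by (simp add: powr_numeral)
    also have "(real n ^ 5) powr (4 / 5) \<le> real D powr (4 / 5)"
    proof (rule powr_mono2)
      show "real n ^ 5 \<le> real D" using D by (metis of_nat_le_iff of_nat_power)
    qed auto
    finally have "real n ^ 3 / real D \<le> real D powr (4 / 5) / real D powr 1"
      using D0 by (simp add: divide_right_mono)
    also have "\<dots> = real D powr (4 / 5 - 1)" by (rule powr_diff[symmetric])
    finally show ?thesis by simp
  qed
  moreover have "0 \<le> real D powr (- 1 / 5)" by simp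
  moreover have "176 * z / 4 + B / 12 \<le> 46 * y" if "z \<le> y" "0 \<le> y" "B \<le> 16 * z" for z y B :: real
    using that by linarith
  ultimately show ?thesis using f unfolding p by blast
qed

lemma expected_tr_sq_le:
  assumes d: "2 \<le> d" and t: "1 \<le> t" and l: "1 \<le> l" and D: "(2 * t + l) ^ 5 \<le> D"
    and \<omega>: "\<And>i. i < D \<Longrightarrow> 0 \<le> \<omega> i" "(\<Sum>i<D. \<omega> i) = 1"
    and hU: "is_haar (D * d) \<mu>U" and hD: "is_haar D \<mu>D"
  shows "Re (\<integral>U. \<integral>V. \<integral>W. \<integral>lam. tr_sq d l (rho_l D d t l (conj_diag D V lam) U (conj_diag D W \<omega>))
       \<partial>unif_cube D \<partial>\<mu>D \<partial>\<mu>D \<partial>\<mu>U) \<le> 1 / (4 * real d ^ l) + 46 * real D powr (- 1 / 5)"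
proof -
  define n where "n = 2 * t + l"
  have n3: "3 \<le> n" using t l unfolding n_def by simp
  have Dn: "n ^ 5 \<le> D" using D unfolding n_def .
  have tl: "t + l \<le> n" unfolding n_def by simp
  have d0: "0 < d" using d by simp
  have "3 ^ 5 \<le> n ^ 5" using n3 by (rule power_mono) simp
  then have D2: "2 < D" using Dn by simp
  note hUd = is_haarD[OF hU] and hDd = is_haarD[OF hD]
  define SU where "SU = {U. unitary_mat (D * d) U}"
  define SD where "SD = {V. unitary_mat D V}"
  have sets: "SU \<in> sets \<mu>U" "SD \<in> sets \<mu>D"
    using hU hD emeasure_notin_sets[of SU \<mu>U] emeasure_notin_sets[of SD \<mu>D]
    unfolding is_haar_def SU_def SD_def by auto
  define M2 where "M2 = \<mu>D \<Otimes>\<^sub>M \<mu>D"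
  define P where "P = \<mu>U \<Otimes>\<^sub>M M2"
  let ?S = "SU \<times> SD \<times> SD"
  let ?A = "\<lambda>z. purity_part D d n t l \<omega> (fst z) (snd (snd z))"
  let ?B = "\<lambda>z. fluct_part D d n \<omega> (fst (snd z)) (fst z) (snd (snd z))"
  let ?a = "1 / real d ^ l + 22 * (real (2 * n) ^ 3 / real D)" and ?b = "4 * real D / (real D - 2)\<^sup>2"
  have ps2: "prob_space M2" unfolding M2_def by (rule prob_space_pair[OF hDd(1) hDd(1)])
  have psP: "prob_space P" unfolding P_def by (rule prob_space_pair[OF hUd(1) ps2])
  have sets2: "SD \<times> SD \<in> sets M2" unfolding M2_def using sets by simp
  have ae2: "AE z in M2. z \<in> SD \<times> SD"
    unfolding M2_def using hDd(3) sets by (intro AE_pair_Times hDd(1)) (auto simp: SD_def)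
  have aeP: "AE z in P. z \<in> ?S"
    unfolding P_def using hUd(3) by (intro AE_pair_Times hUd(1) ps2 sets sets2 ae2) (simp add: SU_def)
  have eU: "bmeas P (?S) (\<lambda>z. fst z i j)" for i j
    unfolding P_def SU_def by (rule bmeas_compose[OF bmeas_entry[OF hUd(2)]]) auto
  have e2: "bmeas M2 (SD \<times> SD) (\<lambda>z. fst z i j)" "bmeas M2 (SD \<times> SD) (\<lambda>z. snd z i j)" for i j
    unfolding M2_def SD_def by (rule bmeas_compose[OF bmeas_entry[OF hDd(2)]], auto)+
  have sP: "snd \<in> measurable P M2" unfolding P_def by simp
  have eV: "bmeas P (?S) (\<lambda>z. fst (snd z) i j)" for i j
    by (rule bmeas_compose[OF e2(1) sP]) auto
  have eW: "bmeas P (?S) (\<lambda>z. snd (snd z) i j)" for i j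
    by (rule bmeas_compose[OF e2(2) sP]) auto
  \<comment> \<open>The spectral average is evaluated first. What remains is a polynomial in the
    entries of \<open>U\<close>, \<open>V\<close>, \<open>W\<close> and their conjugates, hence
    bounded on the carrier and integrable.\<close>
  define J where "J = (\<lambda>U V W. \<integral>lam. tr_sq d l (rho_l D d t l (conj_diag D V lam) U (conj_diag D W \<omega>)) \<partial>unif_cube D)"
  let ?J = "\<lambda>z. J (fst z) (fst (snd z)) (snd (snd z))"
  have "bmeas P (?S) (\<lambda>z. ?J z)"
    unfolding J_def tr_sq_rho_l[OF d0 n_def] cube_quadratic_form
    by (intro bmeas_add bmeas_mult bmeas_sum bmeas_const bmeas_overlap bmeas_phi eU eV eW)
  then have intJ: "integrable P (\<lambda>z. ?J z)"
    by (rule bmeas_integrable[OF psP _ aeP])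
  have "bmeas P (?S) (\<lambda>z. ?A z)"
    unfolding purity_part_def
    by (intro bmeas_mult bmeas_sum bmeas_const bmeas_overlap bmeas_psi eU eW)
  then have intA: "integrable P (\<lambda>z. Re (?A z))"
    by (intro integrable_Re bmeas_integrable[OF psP _ aeP])
  have intF: "integrable M (\<lambda>z. fluct_part D d n \<omega> (V z) (U z) (W z))"
    if "prob_space M" "AE z in M. z \<in> S" "\<And>i j. bmeas M S (\<lambda>z. V z i j)" "\<And>i j. bmeas M S (\<lambda>z. U z i j)" "\<And>i j. bmeas M S (\<lambda>z. W z i j)"
    for M :: "'x measure" and S U V W
    unfolding fluct_part_def
    by (intro Bochner_Integration.integrable_sum integrable_mult_right bmeas_norm_square_integrable[OF that(1) _ that(2)] bmeas_mult bmeas_phi that)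
  have intB: "integrable P (\<lambda>z. ?B z)"
    by (rule intF[OF psP aeP eV eU eW])
  have "(\<integral>U. \<integral>V. \<integral>W. J U V W \<partial>\<mu>D \<partial>\<mu>D \<partial>\<mu>U) = (\<integral>z. ?J z \<partial>P)"
  proof -
    interpret U: prob_space \<mu>U by (rule hUd(1))
    interpret D: prob_space \<mu>D by (rule hDd(1))
    interpret M2: prob_space M2 by (rule ps2)
    interpret DD: pair_sigma_finite \<mu>D \<mu>D ..
    interpret UM: pair_sigma_finite \<mu>U M2 ..
    have "(\<integral>U. \<integral>V. \<integral>W. J U V W \<partial>\<mu>D \<partial>\<mu>D \<partial>\<mu>U) = (\<integral>U. \<integral>y. J U (fst y) (snd y) \<partial>M2 \<partial>\<mu>U)"
    proof -
      \<comment> \<open>For fixed \<open>U\<close> its entries are constants, so this holds for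
        every \<open>U\<close>, unitary or not, and the outer integrands agree everywhere.\<close>
      have "bmeas M2 (SD \<times> SD) (\<lambda>z. J U (fst z) (snd z))" for U
        unfolding J_def tr_sq_rho_l[OF d0 n_def] cube_quadratic_form
        by (intro bmeas_add bmeas_mult bmeas_sum bmeas_const bmeas_overlap bmeas_phi e2)
      then have "integrable M2 (\<lambda>z. J U (fst z) (snd z))" for U by (rule bmeas_integrable[OF ps2 _ ae2])
      then have "(\<integral>V. \<integral>W. J U V W \<partial>\<mu>D \<partial>\<mu>D) = (\<integral>y. J U (fst y) (snd y) \<partial>M2)" for U
        using DD.integral_fst'[of "\<lambda>z. J U (fst z) (snd z)"] unfolding M2_def by simp
      then show ?thesis by simp
    qed
    also have "\<dots> = (\<integral>z. ?J z \<partial>P)"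
      using UM.integral_fst'[of "\<lambda>z. ?J z"] intJ unfolding P_def by simp
    finally show ?thesis .
  qed
  then have "Re (\<integral>U. \<integral>V. \<integral>W. J U V W \<partial>\<mu>D \<partial>\<mu>D \<partial>\<mu>U) = (\<integral>z. Re (?J z) \<partial>P)"
    using intJ by simp
  also have "\<dots> \<le> (\<integral>z. Re (?A z) / 4 + ?B z / 12 \<partial>P)"
  proof (rule integral_mono_AE)
    show "AE z in P. Re (?J z) \<le>
        Re (?A z) / 4 + ?B z / 12"
      using aeP
    proof eventually_elim
      case (elim z)
      then have "unitary_mat D (fst (snd z))" unfolding SD_def by auto
      from spectrum_average_le[OF d0 n_def this, of \<omega> "fst z" "snd (snd z)"] \<omega>(1) show ?case
        unfolding J_def by simp
    qed
  qed (use intJ intA intB in auto)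
  also have "\<dots> = (\<integral>z. Re (?A z) \<partial>P) / 4
      + (\<integral>z. ?B z \<partial>P) / 12"
    using intA intB by simp
  \<comment> \<open>Here \<open>U\<close> is integrated first, with a unitary \<open>W\<close> held
    fixed.\<close>
  also have "(\<integral>z. Re (?A z) \<partial>P) \<le> ?a"
    unfolding P_def
  proof (rule integral_pair_le_snd[OF hUd(1) ps2 intA[unfolded P_def]])
    show "AE y in M2. (\<integral>x. Re (purity_part D d n t l \<omega> (fst (x, y)) (snd (snd (x, y)))) \<partial>\<mu>U) \<le> ?a"
      using ae2
    proof eventually_elim
      case (elim y)
      then have "unitary_mat D (snd y)" unfolding SD_def by auto
      from purity_part_haar_le[OF hU this d n3 Dn tl \<omega>] show ?case by simp
    qed
  qed
  \<comment> \<open>Here \<open>V\<close> is integrated first, with unitary \<open>U\<close> and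
    \<open>W\<close> held fixed; the inner use of \<open>integral_pair_le_snd\<close> puts
    \<open>V\<close> before \<open>W\<close>.\<close>
  also have "(\<integral>z. ?B z \<partial>P) \<le> ?b"
    unfolding P_def
  proof (rule integral_pair_le_fst[OF hUd(1) ps2 intB[unfolded P_def]])
    show "AE x in \<mu>U. (\<integral>y. fluct_part D d n \<omega> (fst (snd (x, y))) (fst (x, y)) (snd (snd (x, y))) \<partial>M2) \<le> ?b"
      using hUd(3)
    proof eventually_elim
      case (elim U)
      then have U: "unitary_mat (D * d) U" by simp
      have "integrable M2 (\<lambda>y. fluct_part D d n \<omega> (fst y) U (snd y))"
        by (rule intF[OF ps2 ae2 e2(1) _ e2(2)]) simp
      then have "(\<integral>y. fluct_part D d n \<omega> (fst y) U (snd y) \<partial>M2) \<le> ?b"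
        unfolding M2_def
      proof (rule integral_pair_le_snd[OF hDd(1) hDd(1)])
        show "AE W in \<mu>D. (\<integral>V. fluct_part D d n \<omega> (fst (V, W)) U (snd (V, W)) \<partial>\<mu>D) \<le> ?b"
          using hDd(3)
        proof eventually_elim
          case (elim W)
          then have "unitary_mat D W" by simp
          from fluct_part_haar_le[OF hD U this d0 D2 \<omega>] show ?case by simp
        qed
      qed
      then show ?case by simp
    qed
  qed
  finally have "Re (\<integral>U. \<integral>V. \<integral>W. J U V W \<partial>\<mu>D \<partial>\<mu>D \<partial>\<mu>U)
     \<le> (?a) / 4 + ?b / 12"
    by simp
  also have "\<dots> = 1 / (4 * real d ^ l) + (22 * (real (2 * n) ^ 3 / real D) / 4 + ?b / 12)"
    by (simp add: add_divide_distrib)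
  also have "\<dots> \<le> 1 / (4 * real d ^ l) + 46 * real D powr (- 1 / 5)"
    using error_terms_le[OF n3 Dn] by simp
  finally show ?thesis unfolding J_def .
qed

theorem theorem6:
  shows "\<exists>C::real. \<forall>(d::nat) (D::nat) (t::nat) (l::nat) (\<omega>::nat \<Rightarrow> real) \<mu>U \<mu>D.
     2 \<le> d \<longrightarrow> 1 \<le> D \<longrightarrow> 1 \<le> t \<longrightarrow> 1 \<le> l \<longrightarrow> (2 * t + l) ^ 5 \<le> D \<longrightarrow>
     (\<forall>i<D. 0 \<le> \<omega> i) \<longrightarrow> (\<Sum>i<D. \<omega> i) = 1 \<longrightarrow>
     is_haar (d * D) \<mu>U \<longrightarrow> is_haar D \<mu>D \<longrightarrow>
     Re (\<integral>U. \<integral>V. \<integral>W. \<integral>lam.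
            tr_sq d l (rho_l D d t l
               (mmul D V (mmul D (mdiag D (\<lambda>i. complex_of_real (lam i))) (madj V)))
               U
               (mmul D W (mmul D (mdiag D (\<lambda>i. complex_of_real (\<omega> i))) (madj W))))
          \<partial>unif_cube D \<partial>\<mu>D \<partial>\<mu>D \<partial>\<mu>U)
       \<le> 1 / (4 * real d ^ l) + C * real D powr (-1/5)"
  by (rule exI[where x = 46]) (use expected_tr_sq_le in \<open>simp add: mult.commute\<close>)

end
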